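(* Let $K$ be an algebraically closed field of characteristic $0$ and let $d \geq e \geq 1$ be integers. The Segre-Veronese embedding of $\mathbb{P}^1 \times \mathbb{P}^1$ of degree $(d,e)$ is non-defective unless $e=2$ and $d$ is even, in which case the $(d+1)$-st secant variety has codimension $1$ rather than the expected $0$.
   Context: All varieties are over $K$. The Segre-Veronese embedding of $\mathbb{P}^1\times\mathbb{P}^1$ of degree $(d,e)$ is the map $\iota:\mathbb{P}^1\times\mathbb{P}^1 \to \mathbb{P}(V)$, $V=S^d(K^2)\otimes S^e(K^2)$, given by $([u],[v])\mapsto [u^d\otimes v^e]$. For an embedding $\iota:X\to\mathbb{P}(V)$ of a projective variety $X$ whose image spans $\mathbb{P}(V)$, and for an integer $k\ge 1$, the $k$-th (higher) secant variety $k\iota(X)$ is the closure in $\mathbb{P}(V)$ of the union of all subspaces of $\mathbb{P}(V)$ spanned by $k$ points on $\iota(X)$. The expected dimension of $k\iota(X)$ is $\min\{k(\dim X+1)-1,\ \dim V-1\}$ (always an upper bound for $\dim k\iota(X)$). $k\iota(X)$ is called non-defective if it has the expected dimension and defective otherwise. The embedding $\iota$ is called non-defective if $k\iota(X)$ is non-defective for all $k$, and defective otherwise. Codimensions are taken in $\mathbb{P}(V)$; the expected codimension is $\dim V-1$ minus the expected dimension. *)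

theory Defs
  imports
    "HOL-Analysis.Abstract_Topology"
    "HOL-Computational_Algebra.Polynomial"
    "HOL-Library.Extended_Nat"
    "HOL-Library.Function_Algebras"
begin

definition fscale :: "'k::field \<Rightarrow> ('i \<Rightarrow> 'k) \<Rightarrow> 'i \<Rightarrow> 'k" where
  "fscale c v = (\<lambda>i. c * v i)"

global_interpretation fun_vs: vector_space "fscale :: 'k::field \<Rightarrow> ('i \<Rightarrow> 'k) \<Rightarrow> 'i \<Rightarrow> 'k"
  by standard (simp_all add: fscale_def fun_eq_iff algebra_simps)

text \<open>The space \<open>K\<^sup>I\<close>, for an index set \<open>I\<close> that need not be a whole type.\<close>

definition coord_space :: "'i set \<Rightarrow> ('i \<Rightarrow> 'k::field) set" where
  "coord_space I = {v. \<forall>i. i \<notin> I \<longrightarrow> v i = 0}"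

text \<open>A point of \<open>P(V)\<close> is a one-dimensional linear subspace of \<open>V\<close>, as a set of vectors.\<close>

definition proj_space :: "('i \<Rightarrow> 'k::field) set \<Rightarrow> ('i \<Rightarrow> 'k) set set" where
  "proj_space V = {fun_vs.span {v} | v. v \<in> V \<and> v \<noteq> 0}"

text \<open>Homogeneous polynomials of degree \<open>m\<close> in the coordinates, as functions.\<close>

inductive hom_form :: "nat \<Rightarrow> (('i \<Rightarrow> 'k::field) \<Rightarrow> 'k) \<Rightarrow> bool" where
  const: "hom_form 0 (\<lambda>v. c)"
| coord: "hom_form 1 (\<lambda>v. v i)"
| add: "hom_form m f \<Longrightarrow> hom_form m g \<Longrightarrow> hom_form m (\<lambda>v. f v + g v)"
| mult: "hom_form m f \<Longrightarrow> hom_form n g \<Longrightarrow> hom_form (m + n) (\<lambda>v. f v * g v)"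

definition zero_locus ::
  "('i \<Rightarrow> 'k::field) set \<Rightarrow> (('i \<Rightarrow> 'k) \<Rightarrow> 'k) set \<Rightarrow> ('i \<Rightarrow> 'k) set set" where
  "zero_locus V F = {P \<in> proj_space V. \<forall>f\<in>F. \<forall>v\<in>P. f v = 0}"

definition zariski_closed :: "('i \<Rightarrow> 'k::field) set \<Rightarrow> ('i \<Rightarrow> 'k) set set \<Rightarrow> bool" where
  "zariski_closed V Z \<longleftrightarrow> (\<exists>F. (\<forall>f\<in>F. \<exists>m. hom_form m f) \<and> Z = zero_locus V F)"

definition zariski :: "('i \<Rightarrow> 'k::field) set \<Rightarrow> ('i \<Rightarrow> 'k) set topology" where
  "zariski V = topology (\<lambda>U. U \<subseteq> proj_space V \<and> zariski_closed V (proj_space V - U))"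

lemma hom_form_scale:
  assumes "hom_form m f"
  shows "f (fscale c v) = c ^ m * f v"
  using assms
proof induction
  case (add m f g)
  then show ?case by (simp add: distrib_left)
next
  case (mult m f n g)
  then show ?case by (simp add: power_add mult.assoc mult.left_commute)
qed (simp_all add: fscale_def)

lemma zero_locus_span:
  assumes "\<forall>f\<in>F. \<exists>m. hom_form m f" "v \<in> V" "v \<noteq> 0"
  shows "fun_vs.span {v} \<in> zero_locus V F \<longleftrightarrow> (\<forall>f\<in>F. f v = 0)"
proof -
  have "fun_vs.span {v} \<in> proj_space V"
    unfolding proj_space_def using assms(2,3) by (intro CollectI exI[of _ v]) simp
  moreover have "(\<forall>w\<in>fun_vs.span {v}. f w = 0) \<longleftrightarrow> f v = 0" if f: "f \<in> F" for f
  proof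
    assume "\<forall>w\<in>fun_vs.span {v}. f w = 0"
    then show "f v = 0" by (rule bspec) (rule fun_vs.span_base[OF singletonI])
  next
    assume *: "f v = 0"
    obtain m where m: "hom_form m f" using assms(1) f by blast
    show "\<forall>w\<in>fun_vs.span {v}. f w = 0"
      unfolding fun_vs.span_singleton by (simp add: hom_form_scale[OF m] *)
  qed
  ultimately show ?thesis
    unfolding zero_locus_def by simp
qed

lemma zariski_closed_Un:
  assumes "zariski_closed V A" "zariski_closed V B"
  shows "zariski_closed V (A \<union> B)"
proof -
  obtain F G where F: "\<forall>f\<in>F. \<exists>m. hom_form m f" "A = zero_locus V F"
    and G: "\<forall>f\<in>G. \<exists>m. hom_form m f" "B = zero_locus V G"
    using assms by (auto simp: zariski_closed_def)
  define H where "H = {(\<lambda>v. f v * g v) | f g. f \<in> F \<and> g \<in> G}"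
  have H: "\<forall>h\<in>H. \<exists>m. hom_form m h"
    using F(1) G(1) unfolding H_def by (auto dest!: bspec intro: hom_form.mult)
  have "P \<in> A \<union> B \<longleftrightarrow> P \<in> zero_locus V H" if "P \<in> proj_space V" for P
  proof -
    obtain v where v: "P = fun_vs.span {v}" "v \<in> V" "v \<noteq> 0"
      using \<open>P \<in> proj_space V\<close> by (auto simp: proj_space_def)
    have "(\<forall>h\<in>H. h v = 0) \<longleftrightarrow> (\<forall>f\<in>F. f v = 0) \<or> (\<forall>g\<in>G. g v = 0)"
      unfolding H_def by fastforce
    then show ?thesis
      by (simp add: F(2) G(2) v zero_locus_span[OF F(1) v(2,3)]
          zero_locus_span[OF G(1) v(2,3)] zero_locus_span[OF H v(2,3)])
  qed
  moreover have "A \<union> B \<subseteq> proj_space V" "zero_locus V H \<subseteq> proj_space V"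
    by (auto simp: F(2) G(2) zero_locus_def)
  ultimately have "A \<union> B = zero_locus V H" by blast
  with H show ?thesis by (auto simp: zariski_closed_def)
qed

lemma zariski_closed_Inter:
  assumes "\<And>Z. Z \<in> \<Z> \<Longrightarrow> zariski_closed V Z"
  shows "zariski_closed V (proj_space V \<inter> \<Inter>\<Z>)"
proof -
  have "\<forall>Z\<in>\<Z>. \<exists>F. (\<forall>f\<in>F. \<exists>m. hom_form m f) \<and> Z = zero_locus V F"
    using assms by (simp add: zariski_closed_def)
  then obtain F where F: "\<And>Z. Z \<in> \<Z> \<Longrightarrow> \<forall>f\<in>F Z. \<exists>m. hom_form m f"
    "\<And>Z. Z \<in> \<Z> \<Longrightarrow> Z = zero_locus V (F Z)"
    by metis
  have "P \<in> proj_space V \<inter> \<Inter>\<Z> \<longleftrightarrow> P \<in> zero_locus V (\<Union>Z\<in>\<Z>. F Z)" for P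
    using F(2) unfolding zero_locus_def by blast
  then show ?thesis
    unfolding zariski_closed_def using F(1) by (intro exI[of _ "\<Union>Z\<in>\<Z>. F Z"]) blast
qed

lemma istopology_zariski:
  "istopology (\<lambda>U. U \<subseteq> proj_space V \<and> zariski_closed V (proj_space V - U))"
  unfolding istopology_def
proof (intro conjI allI impI)
  fix S T
  assume "S \<subseteq> proj_space V \<and> zariski_closed V (proj_space V - S)"
    and "T \<subseteq> proj_space V \<and> zariski_closed V (proj_space V - T)"
  then show "zariski_closed V (proj_space V - S \<inter> T)"
    using zariski_closed_Un[of V "proj_space V - S" "proj_space V - T"]
    by (simp add: Diff_Int)
next
  fix \<U>
  assume "\<forall>U\<in>\<U>. U \<subseteq> proj_space V \<and> zariski_closed V (proj_space V - U)"
  then have "zariski_closed V (proj_space V \<inter> \<Inter>((\<lambda>U. proj_space V - U) ` \<U>))"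
    by (intro zariski_closed_Inter) auto
  moreover have "proj_space V \<inter> \<Inter>((\<lambda>U. proj_space V - U) ` \<U>) = proj_space V - \<Union>\<U>"
    by auto
  ultimately show "zariski_closed V (proj_space V - \<Union>\<U>)"
    by simp
qed auto

lemma openin_zariski:
  "openin (zariski V) U \<longleftrightarrow> U \<subseteq> proj_space V \<and> zariski_closed V (proj_space V - U)"
  by (simp add: zariski_def istopology_zariski)

lemma topspace_zariski [simp]: "topspace (zariski V) = proj_space V"
proof -
  have "P \<noteq> {}" if "P \<in> proj_space V" for P
    using that fun_vs.span_zero unfolding proj_space_def by blast
  then have "{} = zero_locus V {\<lambda>v. 1}"
    by (auto simp: zero_locus_def)
  then have "zariski_closed V {}"
    unfolding zariski_closed_def using hom_form.const[of 1] by blast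
  then have "openin (zariski V) (proj_space V)"
    by (simp add: openin_zariski)
  then show ?thesis
    using openin_subset[of "zariski V" "proj_space V"]
      openin_zariski[of V "topspace (zariski V)"] openin_topspace[of "zariski V"]
    by blast
qed

lemma closedin_zariski: "closedin (zariski V) Z \<longleftrightarrow> zariski_closed V Z"
proof -
  have "Z \<subseteq> proj_space V" if "zariski_closed V Z"
    using that by (auto simp: zariski_closed_def zero_locus_def)
  then show ?thesis
    by (auto simp: closedin_def openin_zariski double_diff)
qed

definition irreducible_closedin :: "'a topology \<Rightarrow> 'a set \<Rightarrow> bool" where
  "irreducible_closedin X Z \<longleftrightarrow> closedin X Z \<and> Z \<noteq> {} \<and>
     (\<forall>A B. closedin X A \<and> closedin X B \<and> Z \<subseteq> A \<union> B \<longrightarrow> Z \<subseteq> A \<or> Z \<subseteq> B)"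

text \<open>Krull dimension of a topological space, with the convention that the empty space has
  dimension \<open>0\<close>.\<close>

definition krull_dim :: "'a topology \<Rightarrow> enat" where
  "krull_dim X = (SUP n \<in> {n. \<exists>Z. (\<forall>i\<le>n. irreducible_closedin X (Z i)) \<and>
                                 (\<forall>i<n. Z i \<subset> Z (Suc i))}. enat n)"

definition proj_dim :: "('i \<Rightarrow> 'k::field) set \<Rightarrow> ('i \<Rightarrow> 'k) set set \<Rightarrow> enat" where
  "proj_dim V X = krull_dim (subtopology (zariski V) X)"

text \<open>Throughout, \<open>X\<close> is the image in \<open>P(V)\<close> of the embedded variety. The subspace of \<open>P(V)\<close>
  spanned by a set \<open>S\<close> of points is the projective space of the linear span of the union of
  the lines in \<open>S\<close>.\<close>

definition secant_variety ::
  "('i \<Rightarrow> 'k::field) set \<Rightarrow> ('i \<Rightarrow> 'k) set set \<Rightarrow> nat \<Rightarrow> ('i \<Rightarrow> 'k) set set" where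
  "secant_variety V X k =
     zariski V closure_of (\<Union>S \<in> {S. S \<subseteq> X \<and> finite S \<and> card S = k}. proj_space (fun_vs.span (\<Union>S)))"

text \<open>The truncated subtractions on \<^typ>\<open>enat\<close> are exact for \<open>k \<ge> 1\<close> and \<open>V \<noteq> {0}\<close>.\<close>

definition expected_dim :: "('i \<Rightarrow> 'k::field) set \<Rightarrow> ('i \<Rightarrow> 'k) set set \<Rightarrow> nat \<Rightarrow> enat" where
  "expected_dim V X k = min (enat k * (proj_dim V X + 1) - 1) (enat (fun_vs.dim V) - 1)"

definition secant_codim :: "('i \<Rightarrow> 'k::field) set \<Rightarrow> ('i \<Rightarrow> 'k) set set \<Rightarrow> nat \<Rightarrow> enat" where
  "secant_codim V X k = (enat (fun_vs.dim V) - 1) - proj_dim V (secant_variety V X k)"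

definition expected_codim :: "('i \<Rightarrow> 'k::field) set \<Rightarrow> ('i \<Rightarrow> 'k) set set \<Rightarrow> nat \<Rightarrow> enat" where
  "expected_codim V X k = (enat (fun_vs.dim V) - 1) - expected_dim V X k"

definition nondefective_secant ::
  "('i \<Rightarrow> 'k::field) set \<Rightarrow> ('i \<Rightarrow> 'k) set set \<Rightarrow> nat \<Rightarrow> bool" where
  "nondefective_secant V X k \<longleftrightarrow> proj_dim V (secant_variety V X k) = expected_dim V X k"

definition nondefective :: "('i \<Rightarrow> 'k::field) set \<Rightarrow> ('i \<Rightarrow> 'k) set set \<Rightarrow> bool" where
  "nondefective V X \<longleftrightarrow> (\<forall>k\<ge>1. nondefective_secant V X k)"

text \<open>\<open>S\<^sup>d(K\<^sup>2)\<close> is the space of binary forms of degree \<open>d\<close>, identified with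
  \<open>coord_space {..d}\<close> through the basis \<open>x\<^sup>d\<^sup>-\<^sup>iy\<^sup>i\<close> for \<open>0 \<le> i \<le> d\<close>; in particular
  \<open>K\<^sup>2\<close> is \<open>coord_space {..1}\<close>, with \<open>u\<close> being the form \<open>u\<^sub>0x + u\<^sub>1y\<close>. The \<open>d\<close>-th power of
  \<open>u\<close> is then given by the binomial theorem.\<close>

definition sym_power :: "nat \<Rightarrow> (nat \<Rightarrow> 'k::field) \<Rightarrow> nat \<Rightarrow> 'k" where
  "sym_power d u = (\<lambda>i. of_nat (d choose i) * u 0 ^ (d - i) * u 1 ^ i)"

text \<open>The tensor product of coordinate spaces \<open>K\<^sup>I\<close> and \<open>K\<^sup>J\<close> is \<open>K\<^sup>I\<^sup>\<times>\<^sup>J\<close>.\<close>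

definition tensor :: "('i \<Rightarrow> 'k::field) \<Rightarrow> ('j \<Rightarrow> 'k) \<Rightarrow> 'i \<times> 'j \<Rightarrow> 'k" where
  "tensor a b = (\<lambda>(i, j). a i * b j)"

definition sv_space :: "nat \<Rightarrow> nat \<Rightarrow> (nat \<times> nat \<Rightarrow> 'k::field) set" where
  "sv_space d e = coord_space ({..d} \<times> {..e})"

definition proj_line :: "(nat \<Rightarrow> 'k::field) set set" where
  "proj_line = proj_space (coord_space {..1})"

definition segre_veronese ::
  "nat \<Rightarrow> nat \<Rightarrow> (nat \<Rightarrow> 'k::field) set \<times> (nat \<Rightarrow> 'k) set \<Rightarrow> (nat \<times> nat \<Rightarrow> 'k) set" where
  "segre_veronese d e = (\<lambda>(P, Q).
     fun_vs.span {tensor (sym_power d u) (sym_power e v) | u v. u \<in> P \<and> v \<in> Q})"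

lemma sym_power_scale: "sym_power d (fscale c u) = fscale (c ^ d) (sym_power d u)"
proof
  fix i
  show "sym_power d (fscale c u) i = fscale (c ^ d) (sym_power d u) i"
  proof (cases "i \<le> d")
    case True
    then have "c ^ d = c ^ (d - i) * c ^ i" by (simp flip: power_add)
    then show ?thesis by (simp add: sym_power_def fscale_def power_mult_distrib)
  qed (simp add: sym_power_def fscale_def binomial_eq_0)
qed

text \<open>On representatives, \<^const>\<open>segre_veronese\<close> is \<open>([u], [v]) \<mapsto> [u\<^sup>d \<otimes> v\<^sup>e]\<close>.\<close>

lemma segre_veronese_span:
  "segre_veronese d e (fun_vs.span {u}, fun_vs.span {v}) =
     fun_vs.span {tensor (sym_power d u) (sym_power e v)}" (is "_ = fun_vs.span {?t}")
proof -
  have *: "tensor (sym_power d (fscale a u)) (sym_power e (fscale b v)) =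
      fscale (a ^ d * b ^ e) ?t" for a b
    unfolding sym_power_scale by (simp add: tensor_def fscale_def fun_eq_iff)
  let ?T = "{tensor (sym_power d u') (sym_power e v') | u' v'.
               u' \<in> fun_vs.span {u} \<and> v' \<in> fun_vs.span {v}}"
  have "?T \<subseteq> fun_vs.span {?t}"
    unfolding fun_vs.span_singleton using * by blast
  moreover have "?t \<in> ?T"
    by (intro CollectI exI[of _ u] exI[of _ v] conjI refl fun_vs.span_base singletonI)
  then have "{?t} \<subseteq> fun_vs.span ?T"
    using fun_vs.span_superset[of ?T] by blast
  ultimately have "fun_vs.span ?T = fun_vs.span {?t}"
    unfolding fun_vs.span_eq by (rule conjI)
  then show ?thesis unfolding segre_veronese_def by simp
qed

end

theory Submission
  imports Defs "Jordan_Normal_Form.Determinant"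
begin

text \<open>
The proof counts forms; it uses neither tangent spaces nor intersection theory.

Let \<open>N = (d + 1)(e + 1)\<close> be the dimension of the ambient vector space. A general point of the
\<open>k\<close>-th secant variety is represented by the vector \<open>\<Sum>\<^sub>i s\<^sub>i (1, x\<^sub>i)\<^sup>d \<otimes> (1, y\<^sub>i)\<^sup>e\<close>, which is a polynomial
map of the \<open>3k\<close> parameters \<open>s\<^sub>i, x\<^sub>i, y\<^sub>i\<close>, and the forms that vanish on its range vanish on the
whole secant variety.

\<^item> Upper bounds. Let \<open>Z\<^sub>0 \<subset> \<dots> \<subset> Z\<^sub>n\<close> be a chain of irreducible closed sets. Forms
  \<open>f\<^sub>i\<close> that vanish on \<open>Z\<^sub>i\<close> but not on \<open>Z\<^sub>i\<^sub>+\<^sub>1\<close>, together with a coordinate that does not vanish on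
  \<open>Z\<^sub>0\<close>, are algebraically independent on the cone over \<open>Z\<^sub>n\<close>. If that cone lies in the closure of
  the range of a polynomial map with \<open>p\<close> parameters, then comparing the number of monomials in the
  \<open>f\<^sub>i\<close> with the number of monomials in the parameters gives \<open>n < p\<close>
  (\<open>chain_length_less_parameters\<close>). With \<open>p = 3k\<close> and \<open>p = N\<close> this says that the dimension never
  exceeds the expected one.

\<^item> Lower bounds. Freeze all but the first \<open>j\<close> parameters, for \<open>j = 1, 2, \<dots>\<close>. The ranges are nested
  cones. If \<open>j\<close> coordinates of the ambient space are algebraically independent on the \<open>j\<close>-th cone,
  for every \<open>j\<close>, then the same count shows that the closures increase strictly, so that they form a
  long chain (\<open>proj_dim_ge_parameters\<close>).

\<^item> Independence of coordinates. The coordinate with index \<open>b = (b\<^sub>1, b\<^sub>2)\<close> of the secant vector is,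
  up to a nonzero factor, the sum of the monomials \<open>s\<^sub>i x\<^sub>i\<^bsup>b\<^sub>1\<^esup> y\<^sub>i\<^bsup>b\<^sub>2\<^esup>\<close>. Substitute powers of a
  single variable for the parameters. The exponent of the \<open>i\<close>-th monomial is then an affine function
  of \<open>b\<close>, and \<open>b\<close> belongs to the cell of the \<open>i\<close> whose function is largest at \<open>b\<close>. If the points of
  each cell are affinely independent, hence at most three, then distinct monomials in the coordinates
  get distinct leading exponents after a small perturbation of the weights, so the coordinates are
  algebraically independent (\<open>coords_alg_indep_cells\<close>). This is Draisma's tropical lower bound.

\<^item> Combinatorics. It remains to cut the grid \<open>{0..d} \<times> {0..e}\<close> by straight lines into triangles,
  with at most two points left over; every such cutting comes from affine functions (\<open>tiled_join\<close>).
  This succeeds by induction from twelve small grids unless one side has three points and the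
  other an odd number (\<open>tileable_grid\<close>). In the exceptional case it succeeds for the grid without
  one point (\<open>tiled_odd_by_3\<close>).

In the exceptional case \<open>e = 2\<close>, \<open>d = 2m\<close>, a tensor defines a square matrix of size \<open>d + 2\<close>, its
flattening \<open>(S\<^sup>m \<otimes> S\<^sup>1)\<^sup>* \<longrightarrow> S\<^sup>m \<otimes> S\<^sup>1\<close>, which has rank one on the surface. Its determinant is a nonzero
form that vanishes on sums of \<open>d + 1\<close> points, so the \<open>(d + 1)\<close>-st secant variety is not the whole
space; the cutting of the grid without a point shows that it has codimension exactly one.
\<close>

section \<open>Polynomial functions of finitely many parameters\<close>

definition lin_indep_on :: "'v set \<Rightarrow> 'i set \<Rightarrow> ('i \<Rightarrow> 'v \<Rightarrow> 'k::field) \<Rightarrow> bool" where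
  "lin_indep_on S I g \<longleftrightarrow> (\<forall>c. (\<forall>v\<in>S. (\<Sum>i\<in>I. c i * g i v) = 0) \<longrightarrow> (\<forall>i\<in>I. c i = 0))"

definition monomials :: "'p set \<Rightarrow> nat \<Rightarrow> (('p \<Rightarrow> 'k::field) \<Rightarrow> 'k) set" where
  "monomials P C = (\<lambda>e z. \<Prod>p\<in>P. z p ^ e p) ` (P \<rightarrow>\<^sub>E {..C})"

text \<open>The polynomial functions in the parameters \<open>P\<close> whose degree in \<^emph>\<open>each\<close> parameter is at
  most \<open>C\<close>. Bounding the degrees separately makes the number of monomials a plain power.\<close>

definition poly_fun :: "'p set \<Rightarrow> nat \<Rightarrow> (('p \<Rightarrow> 'k::field) \<Rightarrow> 'k) set" where
  "poly_fun P C = fun_vs.span (monomials P C)"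

lemma monomial_in_poly_fun:
  fixes P :: "'p set"
  assumes "\<And>p. p \<in> P \<Longrightarrow> e p \<le> C"
  shows "(\<lambda>z. \<Prod>p\<in>P. z p ^ e p) \<in> (poly_fun P C :: (('p \<Rightarrow> 'k::field) \<Rightarrow> 'k) set)"
proof -
  have "(\<lambda>z::'p \<Rightarrow> 'k. \<Prod>p\<in>P. z p ^ e p) = (\<lambda>z. \<Prod>p\<in>P. z p ^ restrict e P p)"
    by (intro ext prod.cong) auto
  moreover have "restrict e P \<in> P \<rightarrow>\<^sub>E {..C}"
    using assms by auto
  ultimately show ?thesis
    unfolding poly_fun_def monomials_def by (intro fun_vs.span_base) blast
qed

lemma finite_monomials: "finite P \<Longrightarrow> finite (monomials P C)"
  unfolding monomials_def by (intro finite_imageI finite_PiE) auto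

lemma card_monomials:
  assumes "finite P"
  shows "card (monomials P C) \<le> (C + 1) ^ card P"
proof -
  have "card (monomials P C) \<le> card (P \<rightarrow>\<^sub>E {..C})"
    unfolding monomials_def using assms by (intro card_image_le finite_PiE) auto
  then show ?thesis using assms by (simp add: card_PiE)
qed

lemma poly_fun_mono: "C \<le> C' \<Longrightarrow> poly_fun P C \<subseteq> poly_fun P C'"
  unfolding poly_fun_def monomials_def
  by (intro fun_vs.span_mono image_mono PiE_mono) auto

lemma poly_fun_add: "f \<in> poly_fun P C \<Longrightarrow> g \<in> poly_fun P C \<Longrightarrow> (\<lambda>z. f z + g z) \<in> poly_fun P C"
  unfolding poly_fun_def using fun_vs.span_add[of f _ g] by (simp add: plus_fun_def)

lemma poly_fun_scale: "f \<in> poly_fun P C \<Longrightarrow> (\<lambda>z. c * f z) \<in> poly_fun P C"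
  unfolding poly_fun_def using fun_vs.span_scale[of f _ c] by (simp add: fscale_def)

lemma poly_fun_const: "(\<lambda>z. c) \<in> poly_fun P C"
  using poly_fun_scale[OF monomial_in_poly_fun[of P "\<lambda>_. 0" C], of c] by simp

lemma poly_fun_sum:
  "(\<And>i. i \<in> I \<Longrightarrow> f i \<in> poly_fun P C) \<Longrightarrow> (\<lambda>z. \<Sum>i\<in>I. f i z) \<in> poly_fun P C"
  by (induction I rule: infinite_finite_induct) (auto intro: poly_fun_add poly_fun_const)

lemma poly_fun_coord:
  fixes P :: "'p set"
  assumes "finite P" "p \<in> P"
  shows "(\<lambda>z. z p) \<in> (poly_fun P 1 :: (('p \<Rightarrow> 'k::field) \<Rightarrow> 'k) set)"
proof -
  have "(\<Prod>q\<in>P. z q ^ (if q = p then 1 else 0)) = z p" for z :: "'p \<Rightarrow> 'k"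
    using assms by (subst prod.remove[of P p]) (auto intro!: prod.neutral)
  moreover have "(\<lambda>z. \<Prod>q\<in>P. z q ^ (if q = p then 1 else 0))
      \<in> (poly_fun P 1 :: (('p \<Rightarrow> 'k) \<Rightarrow> 'k) set)"
    by (rule monomial_in_poly_fun) simp
  ultimately show ?thesis by simp
qed

lemma poly_fun_mult:
  fixes f g :: "('p \<Rightarrow> 'k::field) \<Rightarrow> 'k"
  assumes f: "f \<in> poly_fun P C" and g: "g \<in> poly_fun P C'"
  shows "(\<lambda>z. f z * g z) \<in> poly_fun P (C + C')"
proof -
  have mono: "(\<lambda>z. (\<Prod>p\<in>P. z p ^ e p) * g z) \<in> poly_fun P (C + C')"
    if e: "e \<in> P \<rightarrow>\<^sub>E {..C}" for e
    using g unfolding poly_fun_def[of P C']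
  proof (induction rule: fun_vs.span_induct_alt)
    case base
    show ?case using poly_fun_const[of 0] by simp
  next
    case (step c m h)
    then obtain e' where e': "e' \<in> P \<rightarrow>\<^sub>E {..C'}" "m = (\<lambda>z. \<Prod>p\<in>P. z p ^ e' p)"
      by (auto simp: monomials_def)
    have "(\<lambda>z :: 'p \<Rightarrow> 'k. \<Prod>p\<in>P. z p ^ (e p + e' p)) \<in> poly_fun P (C + C')"
      using e e'(1) by (intro monomial_in_poly_fun add_mono) (auto simp: PiE_def Pi_def)
    moreover have "(\<lambda>z :: 'p \<Rightarrow> 'k. \<Prod>p\<in>P. z p ^ (e p + e' p)) = (\<lambda>z. (\<Prod>p\<in>P. z p ^ e p) * m z)"
      by (simp add: e'(2) power_add prod.distrib)
    ultimately have "(\<lambda>z. c * ((\<Prod>p\<in>P. z p ^ e p) * m z) + (\<Prod>p\<in>P. z p ^ e p) * h z)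
        \<in> poly_fun P (C + C')"
      using step.IH by (intro poly_fun_add poly_fun_scale) simp_all
    then show ?case by (simp add: fscale_def algebra_simps)
  qed
  show ?thesis
    using f unfolding poly_fun_def[of P C]
  proof (induction rule: fun_vs.span_induct_alt)
    case base
    show ?case using poly_fun_const[of 0] by simp
  next
    case (step c m h)
    then obtain e where "e \<in> P \<rightarrow>\<^sub>E {..C}" "m = (\<lambda>z. \<Prod>p\<in>P. z p ^ e p)"
      by (auto simp: monomials_def)
    with mono have "(\<lambda>z. c * (m z * g z) + h z * g z) \<in> poly_fun P (C + C')"
      using step.IH by (intro poly_fun_add poly_fun_scale) simp_all
    then show ?case by (simp add: fscale_def algebra_simps)
  qed
qed

lemma poly_fun_power:
  "f \<in> poly_fun P C \<Longrightarrow> (\<lambda>z. f z ^ n) \<in> poly_fun P (n * C)"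
  by (induction n) (auto intro: poly_fun_const poly_fun_mult)

lemma poly_fun_on_line:
  assumes "f \<in> poly_fun P C"
  shows "\<exists>q. \<forall>x. f (\<lambda>p. z p + x * w p) = poly q x"
  using assms unfolding poly_fun_def
proof (induction rule: fun_vs.span_induct_alt)
  case base
  show ?case by (intro exI[of _ 0]) simp
next
  case (step c m h)
  then obtain e q where "m = (\<lambda>z. \<Prod>p\<in>P. z p ^ e p)" "\<forall>x. h (\<lambda>p. z p + x * w p) = poly q x"
    by (auto simp: monomials_def)
  then show ?case
    by (intro exI[of _ "[:c:] * (\<Prod>p\<in>P. [:z p, w p:] ^ e p) + q"])
       (simp add: fscale_def poly_prod)
qed

lemma sum_apply: "(\<Sum>i\<in>I. f i) x = (\<Sum>i\<in>I. f i x)"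
  by (induction I rule: infinite_finite_induct) simp_all

lemma lin_indep_card_le:
  assumes "finite I" "lin_indep_on UNIV I g" "finite M" "\<And>i. i \<in> I \<Longrightarrow> g i \<in> fun_vs.span M"
  shows "card I \<le> card M"
proof -
  have inj: "inj_on g I"
  proof (rule inj_onI, rule ccontr)
    fix i j assume ij: "i \<in> I" "j \<in> I" "g i = g j" "i \<noteq> j"
    define c :: "'a \<Rightarrow> 'c" where "c l = (if l = i then 1 else if l = j then - 1 else 0)" for l
    have "(\<Sum>l\<in>I. c l * g l v) = (\<Sum>l\<in>{i, j}. c l * g l v)" for v
      using ij assms(1) by (intro sum.mono_neutral_right) (auto simp: c_def)
    then have "(\<Sum>l\<in>I. c l * g l v) = 0" for v
      using ij by (simp add: c_def)
    with assms(2) ij(1) have "c i = 0" unfolding lin_indep_on_def by blast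
    then show False by (simp add: c_def)
  qed
  have "fun_vs.independent (g ` I)"
  proof (subst fun_vs.dependent_finite)
    show "finite (g ` I)" using assms(1) by simp
    have "\<forall>i\<in>I. u (g i) = 0" if u: "(\<Sum>v\<in>g ` I. fscale (u v) v) = 0" for u
    proof -
      have "(\<Sum>i\<in>I. u (g i) * g i v) = (\<Sum>w\<in>g ` I. fscale (u w) w) v" for v
        using inj by (simp add: sum.reindex sum_apply fscale_def)
      then have "\<forall>v\<in>UNIV. (\<Sum>i\<in>I. u (g i) * g i v) = 0" using u by simp
      then show ?thesis
        using assms(2)[unfolded lin_indep_on_def, rule_format, of "\<lambda>i. u (g i)"] by blast
    qed
    then show "\<not> (\<exists>u. (\<exists>v\<in>g ` I. u v \<noteq> 0) \<and> (\<Sum>v\<in>g ` I. fscale (u v) v) = 0)"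
      by blast
  qed
  then have "card (g ` I) \<le> card M"
    using assms(3,4) fun_vs.independent_span_bound[of M "g ` I"] by blast
  then show ?thesis using inj by (simp add: card_image)
qed

text \<open>The functions \<open>g\<^sub>i \<circ> \<phi>\<close> are independent and lie in a space spanned by
  \<open>(C (T + 1) + 1)\<^bsup>card P\<^esup>\<close> monomials. Since this is \<open>O(T\<^bsup>card P\<^esup>)\<close>, it cannot keep up with
  \<open>(T + 1)\<^sup>r\<close> functions if \<open>r > card P\<close>.\<close>

lemma growth_le_card_parameters:
  fixes \<phi> :: "('p \<Rightarrow> 'k::field) \<Rightarrow> 'v"
  assumes P: "finite P"
    and fam: "\<And>T. \<exists>(I :: 'i set) g. finite I \<and> card I = (T + 1) ^ r \<and> lin_indep_on (range \<phi>) I g \<and>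
                  (\<forall>i\<in>I. (\<lambda>z. g i (\<phi> z)) \<in> poly_fun P (C * (T + 1)))"
  shows "r \<le> card P"
proof (rule ccontr)
  assume r: "\<not> r \<le> card P"
  define T where "T = (C + 1) ^ card P"
  obtain I :: "'i set" and g where I: "finite I" "card I = (T + 1) ^ r" "lin_indep_on (range \<phi>) I g"
    "\<forall>i\<in>I. (\<lambda>z. g i (\<phi> z)) \<in> poly_fun P (C * (T + 1))"
    using fam by metis
  have "lin_indep_on UNIV I (\<lambda>i z. g i (\<phi> z))"
    using I(3) unfolding lin_indep_on_def by simp
  then have "card I \<le> card (monomials P (C * (T + 1)) :: (('p \<Rightarrow> 'k) \<Rightarrow> 'k) set)"
    using I(1,4) by (intro lin_indep_card_le finite_monomials P) (auto simp: poly_fun_def)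
  also have "\<dots> \<le> (C * (T + 1) + 1) ^ card P"
    by (rule card_monomials[OF P])
  also have "\<dots> \<le> ((C + 1) * (T + 1)) ^ card P"
    by (rule power_mono) auto
  also have "\<dots> = T * (T + 1) ^ card P"
    by (simp only: power_mult_distrib T_def)
  also have "\<dots> < (T + 1) * (T + 1) ^ card P"
    by simp
  also have "\<dots> = (T + 1) ^ Suc (card P)" by simp
  also have "\<dots> \<le> (T + 1) ^ r"
    using r by (intro power_increasing) auto
  finally show False using I(2) by simp
qed

section \<open>Forms on cones and on ranges of polynomial maps\<close>

lemma hom_form_scalar: "hom_form m f \<Longrightarrow> hom_form m (\<lambda>v. c * f v)"
  using hom_form.mult[OF hom_form.const[of c], of m f] by simp

lemma hom_form_power: "hom_form m f \<Longrightarrow> hom_form (n * m) (\<lambda>v. f v ^ n)"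
  by (induction n) (auto intro: hom_form.const hom_form.mult)

lemma hom_form_zero: "hom_form m (\<lambda>v. 0)"
  using hom_form_scalar[OF hom_form_power[OF hom_form.coord[of undefined], of m], of 0] by simp

lemma hom_form_sum:
  "(\<And>i. i \<in> I \<Longrightarrow> hom_form m (f i)) \<Longrightarrow> hom_form m (\<lambda>v. \<Sum>i\<in>I. f i v)"
  by (induction I rule: infinite_finite_induct) (auto intro: hom_form.add hom_form_zero)

lemma hom_form_prod:
  "(\<And>i. i \<in> I \<Longrightarrow> hom_form (m i) (f i)) \<Longrightarrow> hom_form (\<Sum>i\<in>I. m i) (\<lambda>v. \<Prod>i\<in>I. f i v)"
  by (induction I rule: infinite_finite_induct) (auto intro: hom_form.mult hom_form.const)

lemma hom_form_poly_fun:
  assumes "hom_form m f" "\<And>i. (\<lambda>z. \<phi> z i) \<in> poly_fun P C"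
  shows "(\<lambda>z. f (\<phi> z)) \<in> poly_fun P (m * C)"
  using assms(1)
proof induction
  case (mult m f n g)
  then show ?case using poly_fun_mult by (simp add: add_mult_distrib)
qed (auto intro: assms(2) poly_fun_add poly_fun_const)

lemma hom_form_poly:
  assumes "hom_form m f" "\<And>i. \<exists>q. \<forall>x. \<gamma> x i = poly q x"
  shows "\<exists>q. \<forall>x. f (\<gamma> x) = poly q x"
  using assms(1)
proof induction
  case (const c)
  show ?case by (intro exI[of _ "[:c:]"]) simp
next
  case (coord i)
  show ?case using assms(2) .
next
  case (add m f g)
  then obtain p q where "\<forall>x. f (\<gamma> x) = poly p x" "\<forall>x. g (\<gamma> x) = poly q x" by blast
  then show ?case by (intro exI[of _ "p + q"]) simp
next
  case (mult m f n g)
  then obtain p q where "\<forall>x. f (\<gamma> x) = poly p x" "\<forall>x. g (\<gamma> x) = poly q x" by blast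
  then show ?case by (intro exI[of _ "p * q"]) simp
qed

definition cone :: "('i \<Rightarrow> 'k::field) set \<Rightarrow> bool" where
  "cone S \<longleftrightarrow> (\<forall>c. \<forall>v\<in>S. fscale c v \<in> S)"

text \<open>At the vector \<open>c v\<close> the sum becomes the polynomial \<open>\<Sum>\<^sub>j h\<^sub>j(v) c\<^bsup>m j\<^esup>\<close> in \<open>c\<close>. It vanishes
  for all \<open>c\<close>, so its coefficients do.\<close>

lemma homogeneous_parts_vanish:
  fixes S :: "('i \<Rightarrow> 'k::field_char_0) set"
  assumes S: "cone S" and J: "finite J" and inj: "inj_on m J"
    and h: "\<And>j. j \<in> J \<Longrightarrow> hom_form (m j) (h j)"
    and 0: "\<And>v. v \<in> S \<Longrightarrow> (\<Sum>j\<in>J. h j v) = 0"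
    and v: "v \<in> S" and j: "j \<in> J"
  shows "h j v = 0"
proof -
  define q where "q = (\<Sum>j\<in>J. monom (h j v) (m j))"
  have "poly q c = (\<Sum>j\<in>J. h j (fscale c v))" for c
    unfolding q_def poly_sum poly_monom
    by (intro sum.cong refl) (simp add: hom_form_scale[OF h])
  also have "\<dots> c = 0" for c
    using S v by (intro 0) (simp add: cone_def)
  finally have "q = 0" using poly_all_0_iff_0 by blast
  then have "0 = coeff q (m j)" by simp
  also have "\<dots> = (\<Sum>i\<in>J. if i = j then h i v else 0)"
    unfolding q_def coeff_sum coeff_monom
    using inj j by (intro sum.cong refl) (auto dest: inj_onD)
  also have "\<dots> = h j v" using J j by simp
  finally show ?thesis by simp
qed

text \<open>The range of a polynomial map is irreducible: if \<open>f\<close> is nonzero at the parameter \<open>z\<close> and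
  \<open>g\<close> at the parameter \<open>w\<close>, then on the line through \<open>z\<close> and \<open>w\<close> both become nonzero polynomials
  in one variable, whose product is nonzero.\<close>

lemma form_product_vanishes_on_range:
  fixes \<phi> :: "('p \<Rightarrow> 'k::field_char_0) \<Rightarrow> 'i \<Rightarrow> 'k"
  assumes \<phi>: "\<And>i. (\<lambda>z. \<phi> z i) \<in> poly_fun P C"
    and f: "hom_form m f" and g: "hom_form n g"
    and fg: "\<And>v. v \<in> range \<phi> \<Longrightarrow> f v * g v = 0"
  shows "(\<forall>v\<in>range \<phi>. f v = 0) \<or> (\<forall>v\<in>range \<phi>. g v = 0)"
proof (rule ccontr)
  assume "\<not> ?thesis"
  then obtain z w where zw: "f (\<phi> z) \<noteq> 0" "g (\<phi> w) \<noteq> 0" by auto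
  define l where "l x = (\<lambda>p. z p + x * (w p - z p))" for x
  obtain p where p: "\<And>x. f (\<phi> (l x)) = poly p x"
    using poly_fun_on_line[OF hom_form_poly_fun[of _ f \<phi>, OF f \<phi>], of z "\<lambda>p. w p - z p"]
    unfolding l_def by blast
  obtain q where q: "\<And>x. g (\<phi> (l x)) = poly q x"
    using poly_fun_on_line[OF hom_form_poly_fun[of _ g \<phi>, OF g \<phi>], of z "\<lambda>p. w p - z p"]
    unfolding l_def by blast
  have "poly (p * q) x = 0" for x
    using fg[of "\<phi> (l x)"] by (simp flip: p q)
  then have "p * q = 0" using poly_all_0_iff_0 by blast
  moreover have "poly p 0 \<noteq> 0" "poly q 1 \<noteq> 0"
    using zw by (simp_all flip: p q add: l_def)
  ultimately show False by auto
qed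

section \<open>Chains of irreducible closed sets\<close>

text \<open>Irreducibility of \<open>S\<close>, as far as forms can detect it.\<close>

definition prime_for_forms :: "('i \<Rightarrow> 'k::field) set \<Rightarrow> bool" where
  "prime_for_forms S \<longleftrightarrow> (\<forall>m n f g. hom_form m f \<longrightarrow> hom_form n g \<longrightarrow> (\<forall>v\<in>S. f v * g v = 0) \<longrightarrow>
     (\<forall>v\<in>S. f v = 0) \<or> (\<forall>v\<in>S. g v = 0))"

lemma prime_for_formsD:
  assumes "prime_for_forms S" "hom_form m f" "hom_form n g" "\<And>v. v \<in> S \<Longrightarrow> f v * g v = 0"
    "w \<in> S" "f w \<noteq> 0" "v \<in> S"
  shows "g v = 0"
  using assms unfolding prime_for_forms_def by blast

lemma prime_for_forms_powerD:
  assumes S: "prime_for_forms S" and f: "hom_form m f" and g: "hom_form n g"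
    and 0: "\<And>v. v \<in> S \<Longrightarrow> f v ^ N * g v = 0" and w: "w \<in> S" "f w \<noteq> 0" and v: "v \<in> S"
  shows "g v = 0"
  using 0 v
proof (induction N arbitrary: v)
  case (Suc N)
  have "f u ^ N * g u = 0" if "u \<in> S" for u
    using Suc.prems(1) w that
    by (intro prime_for_formsD[OF S f hom_form.mult[OF hom_form_power[OF f] g]])
       (simp_all add: mult.assoc)
  with Suc.IH Suc.prems(2) show ?case by blast
qed simp

lemma irreducible_subset:
  assumes "irreducible_closedin (subtopology (zariski V) X) Z"
  shows "Z \<subseteq> X \<inter> proj_space V"
proof -
  have "closedin (subtopology (zariski V) X) Z"
    using assms unfolding irreducible_closedin_def by simp
  then have "Z \<subseteq> topspace (subtopology (zariski V) X)" by (rule closedin_subset)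
  then show ?thesis by (simp add: Int_commute)
qed

lemma closedin_zero_locus:
  assumes "\<And>f. f \<in> F \<Longrightarrow> \<exists>m. hom_form m f"
  shows "closedin (subtopology (zariski V) X) (zero_locus V F \<inter> X)"
proof -
  have "closedin (zariski V) (zero_locus V F)"
    unfolding closedin_zariski zariski_closed_def using assms by (intro exI[of _ F]) simp
  then show ?thesis unfolding closedin_subtopology by (intro exI[of _ "zero_locus V F"]) simp
qed

lemma irreducible_prime_for_forms:
  assumes irr: "irreducible_closedin (subtopology (zariski V) X) Z"
  shows "prime_for_forms (\<Union>Z)"
  unfolding prime_for_forms_def
proof (intro allI impI)
  fix m n f g
  assume f: "hom_form m f" and g: "hom_form n g" and fg: "\<forall>v\<in>\<Union>Z. f v * g v = 0"
  have Z: "Z \<subseteq> X" "Z \<subseteq> proj_space V"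
    using irreducible_subset[OF irr] by simp_all
  let ?A = "\<lambda>h. zero_locus V {h} \<inter> X"
  have closed: "closedin (subtopology (zariski V) X) (?A h)" if "hom_form l h" for l h
    by (rule closedin_zero_locus) (use that in auto)
  have on_A: "fun_vs.span {w} \<in> ?A h"
    if "hom_form l h" "h w = 0" "fun_vs.span {w} \<in> Z" "w \<in> V" "w \<noteq> 0" for l h w
  proof -
    have "fun_vs.span {w} \<in> zero_locus V {h}"
      using that by (subst zero_locus_span) auto
    then show ?thesis using that(3) Z(1) by blast
  qed
  have "Z \<subseteq> ?A f \<union> ?A g"
  proof
    fix P assume P: "P \<in> Z"
    have "P \<in> proj_space V" by (rule subsetD[OF Z(2) P])
    then obtain w where w: "P = fun_vs.span {w}" "w \<in> V" "w \<noteq> 0"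
      unfolding proj_space_def mem_Collect_eq by (elim exE conjE)
    have "w \<in> \<Union>Z" using P w(1) fun_vs.span_base[of w "{w}"] by (intro UnionI[of P]) simp_all
    with fg have "f w * g w = 0" by (rule bspec)
    then have "f w = 0 \<or> g w = 0" by simp
    then show "P \<in> ?A f \<union> ?A g"
      using on_A[OF f _ P[unfolded w(1)] w(2,3)] on_A[OF g _ P[unfolded w(1)] w(2,3)] w(1)
      by (elim disjE) simp_all
  qed
  then have "Z \<subseteq> ?A f \<or> Z \<subseteq> ?A g"
    using irr[unfolded irreducible_closedin_def, THEN conjunct2, THEN conjunct2, rule_format,
        of "?A f" "?A g"] closed[OF f] closed[OF g] by simp
  moreover have "\<forall>v\<in>\<Union>Z. h v = 0" if "Z \<subseteq> ?A h" for h
    using that unfolding zero_locus_def by fastforce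
  ultimately show "(\<forall>v\<in>\<Union>Z. f v = 0) \<or> (\<forall>v\<in>\<Union>Z. g v = 0)" by (elim disjE) simp_all
qed

lemma closed_separating_form:
  assumes "closedin (subtopology (zariski V) X) Z" "P \<in> X" "P \<in> proj_space V" "P \<notin> Z"
  obtains m f v where "hom_form m f" "\<forall>v\<in>\<Union>Z. f v = 0" "v \<in> P" "f v \<noteq> 0"
proof -
  obtain Z' where Z': "zariski_closed V Z'" "Z = Z' \<inter> X"
    using assms(1) unfolding closedin_subtopology closedin_zariski by blast
  then obtain F where F: "\<forall>f\<in>F. \<exists>m. hom_form m f" "Z' = zero_locus V F"
    unfolding zariski_closed_def by (elim exE conjE)
  have "P \<notin> zero_locus V F" using assms(2,4) Z'(2) F(2) by simp
  then obtain f v where fv: "f \<in> F" "v \<in> P" "f v \<noteq> 0"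
    using assms(3) unfolding zero_locus_def by auto
  moreover have "f w = 0" if w: "w \<in> \<Union>Z" for w
  proof -
    obtain Q where "Q \<in> zero_locus V F" "w \<in> Q" using w unfolding Z'(2) F(2) by auto
    then show ?thesis using fv(1) unfolding zero_locus_def by simp
  qed
  moreover obtain m where "hom_form m f" using F(1) fv(1) by auto
  ultimately show ?thesis using that[of m f v] by simp
qed

lemma lin_indep_onD:
  assumes "lin_indep_on S I g" "\<And>v. v \<in> S \<Longrightarrow> (\<Sum>i\<in>I. c i * g i v) = 0" "i \<in> I"
  shows "c i = 0"
  using assms unfolding lin_indep_on_def by simp

text \<open>Passing from \<open>A\<close> to the larger set \<open>S\<close> multiplies the number of independent forms by
  \<open>T + 1\<close>. In a relation, restriction to \<open>A\<close> leaves only the terms without \<open>F\<close>, whose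
  coefficients vanish by the independence on \<open>A\<close>; the remaining relation on \<open>S\<close> can be divided
  by \<open>F\<close>, and so on. The powers of the linear form \<open>l\<close> pad all products to the same degree, so
  that the notion \<^const>\<open>prime_for_forms\<close>, which is about homogeneous functions only, applies.\<close>

lemma lin_indep_extend:
  fixes F l :: "('i \<Rightarrow> 'k::field) \<Rightarrow> 'k"
  assumes sub: "A \<subseteq> S" and I: "finite I" and indep: "lin_indep_on A I g"
    and g: "\<And>i. i \<in> I \<Longrightarrow> hom_form n (g i)"
    and F: "hom_form a F" "\<And>v. v \<in> A \<Longrightarrow> F v = 0" "w \<in> S" "F w \<noteq> 0"
    and l: "hom_form 1 l" "u \<in> A" "l u \<noteq> 0"
    and prime: "prime_for_forms A" "prime_for_forms S"
  shows "lin_indep_on S ({..T} \<times> I) (\<lambda>(j, i) v. F v ^ j * l v ^ (a * (T - j)) * g i v)"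
proof -
  let ?h = "\<lambda>c (j::nat) v. \<Sum>i\<in>I. c (j, i) * g i v"
  have h: "hom_form n (?h c j)" for c j
    by (intro hom_form_sum hom_form_scalar g)
  have sum_eq: "(\<Sum>p\<in>{..T} \<times> I. c p * (case p of (j, i) \<Rightarrow> \<lambda>v. F v ^ j * l v ^ (a * (T
      - j)) * g i v) v)
      = (\<Sum>j\<le>T. F v ^ j * l v ^ (a * (T - j)) * ?h c j v)" for c v T
    unfolding sum_distrib_left sum.cartesian_product
    by (intro sum.cong) (auto simp: mult_ac)
  have "\<forall>p\<in>{..T} \<times> I. c p = 0"
    if "\<And>v. v \<in> S \<Longrightarrow> (\<Sum>j\<le>T. F v ^ j * l v ^ (a * (T - j)) * ?h c j v) = 0" for c
    using that
  proof (induction T arbitrary: c)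
    case 0
    have "?h c 0 v = 0" if "v \<in> A" for v
      using 0[of v] sub that by auto
    then have "c (0, i) = 0" if "i \<in> I" for i
      using lin_indep_onD[OF indep, of "\<lambda>i. c (0, i)"] that by simp
    then show ?case by auto
  next
    case (Suc T)
    have split: "(\<Sum>j\<le>Suc T. F v ^ j * l v ^ (a * (Suc T - j)) * ?h c j v) =
        l v ^ (a * Suc T) * ?h c 0 v +
        F v * (\<Sum>j\<le>T. F v ^ j * l v ^ (a * (T - j)) * ?h c (Suc j) v)" for v
      unfolding sum.atMost_Suc_shift by (simp add: sum_distrib_left mult.assoc)
    \<comment> \<open>On \<open>A\<close> only the summand without \<open>F\<close> survives.\<close>
    have "l v ^ (a * Suc T) * ?h c 0 v = 0" if "v \<in> A" for v
      using Suc.prems[of v] sub that F(2)[OF that] unfolding split by auto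
    then have "?h c 0 v = 0" if "v \<in> A" for v
      using prime_for_forms_powerD[OF prime(1) l(1) h _ l(2,3) that] by blast
    then have c0: "c (0, i) = 0" if "i \<in> I" for i
      using lin_indep_onD[OF indep, of "\<lambda>i. c (0, i)"] that by simp
    have form: "hom_form (a * T + n) (\<lambda>v. \<Sum>j\<le>T. F v ^ j * l v ^ (a * (T - j)) * ?h c (Suc j) v)"
    proof (intro hom_form_sum)
      fix j assume "j \<in> {..T}"
      then have "j * a + a * (T - j) * 1 = a * T"
        by (simp add: mult.commute[of j] flip: add_mult_distrib2)
      moreover have "hom_form (j * a + a * (T - j) * 1 + n)
          (\<lambda>v. F v ^ j * l v ^ (a * (T - j)) * ?h c (Suc j) v)"
        by (intro hom_form.mult hom_form_power F(1) l(1) h)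
      ultimately show "hom_form (a * T + n) (\<lambda>v. F v ^ j * l v ^ (a * (T - j)) * ?h c (Suc j) v)"
        by (simp only:)
    qed
    have "(\<Sum>j\<le>T. F v ^ j * l v ^ (a * (T - j)) * ?h c (Suc j) v) = 0" if "v \<in> S" for v
    proof (rule prime_for_formsD[OF prime(2) F(1) form _ F(3,4) that])
      fix v assume "v \<in> S"
      from Suc.prems[OF this] show
        "F v * (\<Sum>j\<le>T. F v ^ j * l v ^ (a * (T - j)) * ?h c (Suc j) v) = 0"
        unfolding split using c0 by simp
    qed
    then have "\<forall>p\<in>{..T} \<times> I. c (Suc (fst p), snd p) = 0"
      using Suc.IH[of "\<lambda>p. c (Suc (fst p), snd p)"] by simp
    then have cS: "c (Suc j, i) = 0" if "j \<le> T" "i \<in> I" for j i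
      using that by (metis atMost_iff fst_conv mem_Sigma_iff snd_conv)
    have "c (j, i) = 0" if "j \<le> Suc T" "i \<in> I" for j i
      using that c0 cS by (cases j) auto
    then show ?case by auto
  qed
  then show ?thesis unfolding lin_indep_on_def sum_eq by simp
qed

text \<open>One more factor \<open>T + 1\<close> comes from the grading: on a cone, forms of different degrees
  cannot cancel. It accounts for the difference between the dimension of a projective variety
  and that of the cone over it.\<close>

lemma lin_indep_cone:
  fixes l :: "('i \<Rightarrow> 'k::field_char_0) \<Rightarrow> 'k" and g :: "'j \<Rightarrow> ('i \<Rightarrow> 'k) \<Rightarrow> 'k"
  assumes S: "cone S" and dense: "\<And>m f v. hom_form m f \<Longrightarrow> \<forall>w\<in>S. f w = 0 \<Longrightarrow> v \<in> A \<Longrightarrow> f v = 0"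
    and I: "finite I" and indep: "lin_indep_on A I g"
    and g: "\<And>i. i \<in> I \<Longrightarrow> hom_form n (g i)"
    and l: "hom_form 1 l" "u \<in> A" "l u \<noteq> 0"
    and prime: "prime_for_forms A"
  shows "lin_indep_on S ({..T} \<times> I) (\<lambda>(j, i) v. l v ^ j * g i v)"
  unfolding lin_indep_on_def
proof (intro allI impI)
  fix c :: "nat \<times> 'j \<Rightarrow> 'k"
  let ?h = "\<lambda>(j::nat) v. \<Sum>i\<in>I. c (j, i) * g i v"
  assume 0: "\<forall>v\<in>S. (\<Sum>p\<in>{..T} \<times> I. c p * (case p of (j, i) \<Rightarrow> \<lambda>v. l v ^ j * g i v) v) = 0"
  have sum_eq: "(\<Sum>p\<in>{..T} \<times> I. c p * (case p of (j, i) \<Rightarrow> \<lambda>v. l v ^ j * g i v) v)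
      = (\<Sum>j\<le>T. l v ^ j * ?h j v)" for v
    unfolding sum_distrib_left sum.cartesian_product
    by (intro sum.cong) (auto simp: mult_ac)
  have h: "hom_form n (?h j)" for j
    by (intro hom_form_sum hom_form_scalar g)
  have lh: "hom_form (j * 1 + n) (\<lambda>v. l v ^ j * ?h j v)" for j
    by (intro hom_form.mult hom_form_power l(1) h)
  have "l v ^ j * ?h j v = 0" if "v \<in> S" "j \<le> T" for v j
    by (rule homogeneous_parts_vanish[OF S, of "{..T}" "\<lambda>j. j * 1 + n" "\<lambda>j v. l v ^ j * ?h j v"])
       (use that 0 lh in \<open>auto simp: sum_eq intro: inj_onI\<close>)
  then have "l v ^ j * ?h j v = 0" if "v \<in> A" "j \<le> T" for v j
    using dense[OF lh] that by blast
  then have "?h j v = 0" if "v \<in> A" "j \<le> T" for v j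
    using prime_for_forms_powerD[OF prime l(1) h _ l(2,3) that(1)] that(2) by blast
  then have "c (j, i) = 0" if "j \<le> T" "i \<in> I" for j i
    using lin_indep_onD[OF indep, of "\<lambda>i. c (j, i)"] that by simp
  then show "\<forall>p\<in>{..T} \<times> I. c p = 0" by auto
qed

lemma nonzero_vector_of_irreducible:
  assumes "irreducible_closedin (subtopology (zariski V) X) Z"
  shows "\<exists>v\<in>\<Union>Z. v \<noteq> 0"
proof -
  obtain P where "P \<in> Z" using assms unfolding irreducible_closedin_def by blast
  moreover have "Z \<subseteq> proj_space V"
    using irreducible_subset[OF assms] by simp
  ultimately obtain w where "P = fun_vs.span {w}" "w \<noteq> 0"
    unfolding proj_space_def by blast
  then show ?thesis using \<open>P \<in> Z\<close> fun_vs.span_base[of w "{w}"] by blast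
qed

text \<open>Applying \<open>lin_indep_extend\<close> \<open>n\<close> times and \<open>lin_indep_cone\<close> once gives \<open>(T + 1)\<^bsup>n + 1\<^esup>\<close>
  independent products of forms whose degrees are bounded by a multiple of \<open>T\<close>; there are too
  many of them if \<open>n \<ge> card P\<close>.\<close>

lemma chain_length_less_parameters:
  fixes V :: "('i \<Rightarrow> 'k::field_char_0) set" and \<phi> :: "('p \<Rightarrow> 'k) \<Rightarrow> 'i \<Rightarrow> 'k"
  assumes P: "finite P" and \<phi>: "\<And>i. (\<lambda>z. \<phi> z i) \<in> poly_fun P C" and cone: "cone (range \<phi>)"
    and dense: "\<And>m f v. hom_form m f \<Longrightarrow> \<forall>w\<in>range \<phi>. f w = 0 \<Longrightarrow> v \<in> \<Union>X \<Longrightarrow> f v = 0"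
    and irr: "\<And>i. i \<le> n \<Longrightarrow> irreducible_closedin (subtopology (zariski V) X) (Z i)"
    and strict: "\<And>i. i < n \<Longrightarrow> Z i \<subset> Z (Suc i)"
  shows "n < card P"
proof -
  have mono: "Z i \<subseteq> Z j" if "i \<le> j" "j \<le> n" for i j
    using that
  proof (induction j rule: dec_induct)
    case (step j)
    then show ?case using strict[of j] by auto
  qed simp
  have ZX: "Z i \<subseteq> X \<inter> proj_space V" if "i \<le> n" for i
    using irr[OF that] by (rule irreducible_subset)
  have "\<exists>m f. hom_form m f \<and> (\<forall>v\<in>\<Union>(Z i). f v = 0) \<and> (\<exists>v\<in>\<Union>(Z (Suc i)). f v \<noteq> 0)" if i: "i < n" for i
  proof -
    obtain Q where Q: "Q \<in> Z (Suc i)" "Q \<notin> Z i" using strict[OF i] by auto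
    moreover have "closedin (subtopology (zariski V) X) (Z i)"
      using irr[of i] i unfolding irreducible_closedin_def by simp
    ultimately show ?thesis
      using ZX[of "Suc i"] i by (elim closed_separating_form[of V X "Z i" Q]) auto
  qed
  then obtain a f where f: "\<And>i. i < n \<Longrightarrow> hom_form (a i) (f i)"
    "\<And>i v. i < n \<Longrightarrow> v \<in> \<Union>(Z i) \<Longrightarrow> f i v = 0" "\<And>i. i < n \<Longrightarrow> \<exists>v\<in>\<Union>(Z (Suc i)). f i v \<noteq> 0"
    by metis
  obtain u i where u: "u \<in> \<Union>(Z 0)" "u i \<noteq> 0"
    using nonzero_vector_of_irreducible[OF irr[of 0]] by (auto simp: fun_eq_iff)
  define l where "l v = v i" for v :: "'i \<Rightarrow> 'k"
  have l: "hom_form 1 l" unfolding l_def by (rule hom_form.coord)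
  have uZ: "u \<in> \<Union>(Z i)" if "i \<le> n" for i using u mono[of 0 i] that by blast
  have lu: "l u \<noteq> 0" using u by (simp add: l_def)
  have prime: "prime_for_forms (\<Union>(Z i))" if "i \<le> n" for i
    using irr[OF that] by (rule irreducible_prime_for_forms)
  have fam: "\<exists>(I :: nat list set) g. finite I \<and> card I = (T + 1) ^ m \<and> lin_indep_on (\<Union>(Z m)) I g \<and>
      (\<forall>i\<in>I. hom_form (T * (\<Sum>i<m. a i)) (g i))" if "m \<le> n" for m T
    using that
  proof (induction m)
    case 0
    show ?case
      using uZ[of 0]
      by (intro exI[of _ "{[]}"] exI[of _ "\<lambda>_ _. 1"]) (auto simp: lin_indep_on_def intro:
          hom_form.const)
  next
    case (Suc m)
    then obtain I :: "nat list set" and g where I: "finite I" "card I = (T + 1) ^ m"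
      "lin_indep_on (\<Union>(Z m)) I g" "\<And>i. i \<in> I \<Longrightarrow> hom_form (T * (\<Sum>i<m. a i)) (g i)"
      by auto
    obtain w where w: "w \<in> \<Union>(Z (Suc m))" "f m w \<noteq> 0" using f(3)[of m] Suc.prems by auto
    let ?g = "\<lambda>(j, i) v. f m v ^ j * l v ^ (a m * (T - j)) * g i v"
    have indep: "lin_indep_on (\<Union>(Z (Suc m))) ({..T} \<times> I) ?g"
      using Suc.prems mono[of m "Suc m"] w
      by (intro lin_indep_extend[OF _ I(1,3,4) f(1,2) _ _ l uZ lu] prime) auto
    have forms: "hom_form (T * (\<Sum>i<Suc m. a i)) (?g (j, i))" if "j \<le> T" "i \<in> I" for j i
    proof -
      have "j * a m + a m * (T - j) * 1 = a m * T"
        using that(1) by (simp add: mult.commute[of j] flip: add_mult_distrib2)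
      then have "j * a m + a m * (T - j) * 1 + T * (\<Sum>i<m. a i) = T * (\<Sum>i<Suc m. a i)"
        by (simp add: add_mult_distrib2)
      moreover have "hom_form (j * a m + a m * (T - j) * 1 + T * (\<Sum>i<m. a i)) (?g (j, i))"
        unfolding prod.case using Suc.prems
        by (intro hom_form.mult hom_form_power f(1) l I(4) that(2)) simp
      ultimately show ?thesis by (simp only:)
    qed
    \<comment> \<open>Index the enlarged family by lists again.\<close>
    let ?c = "\<lambda>(j, i). j # i"
    have inj: "inj_on ?c ({..T} \<times> I)" by (auto intro: inj_onI)
    have "lin_indep_on (\<Union>(Z (Suc m))) (?c ` ({..T} \<times> I)) (\<lambda>xs. ?g (hd xs, tl xs))"
      unfolding lin_indep_on_def
    proof (intro allI impI)
      fix c assume 0: "\<forall>v\<in>\<Union>(Z (Suc m)). (\<Sum>xs\<in>?c ` ({..T} \<times> I). c xs * ?g (hd xs, tl xs) v) = 0"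
      have "(\<Sum>xs\<in>?c ` ({..T} \<times> I). c xs * ?g (hd xs, tl xs) v) =
          (\<Sum>p\<in>{..T} \<times> I. c (?c p) * ?g p v)" for v
        unfolding sum.reindex[OF inj] by (intro sum.cong) auto
      with 0 indep have "\<forall>p\<in>{..T} \<times> I. c (?c p) = 0"
        unfolding lin_indep_on_def by (elim allE[of _ "\<lambda>p. c (?c p)"]) simp
      then show "\<forall>xs\<in>?c ` ({..T} \<times> I). c xs = 0" by blast
    qed
    moreover have "card (?c ` ({..T} \<times> I)) = (T + 1) ^ Suc m"
      using inj I(2) by (simp add: card_image card_cartesian_product)
    moreover have "\<forall>xs\<in>?c ` ({..T} \<times> I). hom_form (T * (\<Sum>i<Suc m. a i)) (?g (hd xs, tl xs))"
      using forms by auto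
    ultimately show ?case
      using I(1) by (intro exI[of _ "?c ` ({..T} \<times> I)"] exI[of _ "\<lambda>xs. ?g (hd xs, tl xs)"]) blast
  qed
  define A where "A = (\<Sum>i<n. a i)"
  have "n + 1 \<le> card P"
  proof (rule growth_le_card_parameters[OF P, of "n + 1" \<phi> "(1 + A) * C"])
    fix T
    obtain I :: "nat list set" and g where I: "finite I" "card I = (T + 1) ^ n"
      "lin_indep_on (\<Union>(Z n)) I g" "\<And>i. i \<in> I \<Longrightarrow> hom_form (T * A) (g i)"
      using fam[of n T] unfolding A_def by auto
    let ?g = "\<lambda>(j, i) v. l v ^ j * g i v"
    have "lin_indep_on (range \<phi>) ({..T} \<times> I) ?g"
      by (rule lin_indep_cone[OF cone _ I(1,3,4) l uZ lu prime]) (use dense ZX[of n] in blast)+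
    moreover have "(\<lambda>z. ?g p (\<phi> z)) \<in> poly_fun P ((1 + A) * C * (T + 1))" if p: "p \<in> {..T} \<times> I"
        for p
    proof -
      obtain j i where ji: "p = (j, i)" "j \<le> T" "i \<in> I" using p by auto
      have "hom_form (j * 1 + T * A) (?g p)"
        unfolding ji(1) prod.case by (intro hom_form.mult hom_form_power l I(4) ji(3))
      then have "(\<lambda>z. ?g p (\<phi> z)) \<in> poly_fun P ((j * 1 + T * A) * C)"
        using \<phi> by (rule hom_form_poly_fun)
      moreover have "(j * 1 + T * A) * C \<le> (1 + A) * C * (T + 1)"
      proof -
        have "j * 1 + T * A \<le> T + T * A" using ji(2) by simp
        also have "\<dots> \<le> (1 + A) * (T + 1)" by (simp add: algebra_simps)
        finally have "(j * 1 + T * A) * C \<le> (1 + A) * (T + 1) * C" by (rule mult_le_mono1)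
        then show ?thesis by (simp only: mult_ac)
      qed
      ultimately show ?thesis using poly_fun_mono by blast
    qed
    moreover have "card ({..T} \<times> I) = (T + 1) ^ (n + 1)" "finite ({..T} \<times> I)"
      using I by (simp_all add: card_cartesian_product)
    ultimately show "\<exists>(J :: (nat \<times> nat list) set) h. finite J \<and> card J = (T + 1) ^ (n + 1) \<and>
        lin_indep_on (range \<phi>) J h \<and> (\<forall>p\<in>J. (\<lambda>z. h p (\<phi> z)) \<in> poly_fun P ((1 + A) * C * (T + 1)))"
      by blast
  qed
  then show ?thesis by simp
qed

lemma proj_dim_le_parameters:
  fixes V :: "('i \<Rightarrow> 'k::field_char_0) set" and \<phi> :: "('p \<Rightarrow> 'k) \<Rightarrow> 'i \<Rightarrow> 'k"
  assumes "finite P" "\<And>i. (\<lambda>z. \<phi> z i) \<in> poly_fun P C" "cone (range \<phi>)"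
    and "\<And>m f v. hom_form m f \<Longrightarrow> \<forall>w\<in>range \<phi>. f w = 0 \<Longrightarrow> v \<in> \<Union>X \<Longrightarrow> f v = 0"
  shows "proj_dim V X \<le> enat (card P - 1)"
  unfolding proj_dim_def krull_dim_def
proof (rule SUP_least)
  fix n assume "n \<in> {n. \<exists>Z. (\<forall>i\<le>n. irreducible_closedin (subtopology (zariski V) X) (Z i)) \<and>
                            (\<forall>i<n. Z i \<subset> Z (Suc i))}"
  then obtain Z where Z: "\<forall>i\<le>n. irreducible_closedin (subtopology (zariski V) X) (Z i)"
    "\<forall>i<n. Z i \<subset> Z (Suc i)"
    unfolding mem_Collect_eq by (elim exE conjE)
  have irr: "irreducible_closedin (subtopology (zariski V) X) (Z i)" if "i \<le> n" for i
    using Z(1) that by (elim allE impE)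
  have strict: "Z i \<subset> Z (Suc i)" if "i < n" for i
    using Z(2) that by (elim allE impE)
  have "n < card P"
    by (rule chain_length_less_parameters[where \<phi> = \<phi> and X = X and V = V and Z = Z and C = C])
       (fact assms(1), fact assms(2), fact assms(3), rule assms(4), assumption+, fact irr,
           fact strict)
  then show "enat n \<le> enat (card P - 1)" by simp
qed

lemma chain_length_le_proj_dim:
  assumes "\<And>i. i \<le> n \<Longrightarrow> irreducible_closedin (subtopology (zariski V) X) (Z i)"
    "\<And>i. i < n \<Longrightarrow> Z i \<subset> Z (Suc i)"
  shows "enat n \<le> proj_dim V X"
  unfolding proj_dim_def krull_dim_def
proof (rule SUP_upper)
  show "n \<in> {n. \<exists>Z. (\<forall>i\<le>n. irreducible_closedin (subtopology (zariski V) X) (Z i)) \<and>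
                  (\<forall>i<n. Z i \<subset> Z (Suc i))}"
    unfolding mem_Collect_eq using assms by (intro exI[of _ Z] conjI allI impI)
qed

section \<open>Chains from nested polynomial maps\<close>

text \<open>The points of \<open>X\<close> in the Zariski closure of the image of the cone \<open>S\<close> in projective space.
  The set \<open>X\<close> need not be closed: this form of the definition also serves for the surface
  itself.\<close>

definition closure_in :: "('i \<Rightarrow> 'k::field) set \<Rightarrow> ('i \<Rightarrow> 'k) set set \<Rightarrow> ('i \<Rightarrow> 'k) set \<Rightarrow>
    ('i \<Rightarrow> 'k) set set" where
  "closure_in V X S = zero_locus V {f. (\<exists>m. hom_form m f) \<and> (\<forall>v\<in>S. f v = 0)} \<inter> X"

lemma closure_in_mono: "S \<subseteq> S' \<Longrightarrow> closure_in V X S \<subseteq> closure_in V X S'"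
  unfolding closure_in_def zero_locus_def by fastforce

lemma span_in_closure_in:
  assumes "v \<in> S" "v \<in> V" "v \<noteq> 0" "fun_vs.span {v} \<in> X"
  shows "fun_vs.span {v} \<in> closure_in V X S"
  unfolding closure_in_def using assms by (subst Int_iff, subst zero_locus_span) auto

lemma form_vanishes_on_closure_in:
  assumes "hom_form m f" "\<And>v. v \<in> S \<Longrightarrow> f v = 0" "P \<in> closure_in V X S" "w \<in> P"
  shows "f w = 0"
  using assms unfolding closure_in_def zero_locus_def by auto

lemma irreducible_closure_in:
  fixes \<phi> :: "('p \<Rightarrow> 'k::field_char_0) \<Rightarrow> 'i \<Rightarrow> 'k"
  assumes \<phi>: "\<And>i. (\<lambda>z. \<phi> z i) \<in> poly_fun P C"
    and V: "range \<phi> \<subseteq> V" and X: "\<And>v. v \<in> range \<phi> \<Longrightarrow> v \<noteq> 0 \<Longrightarrow> fun_vs.span {v} \<in> X"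
    and u: "u \<in> range \<phi>" "u \<noteq> 0"
  shows "irreducible_closedin (subtopology (zariski V) X) (closure_in V X (range \<phi>))"
    (is "irreducible_closedin ?X ?Z")
  unfolding irreducible_closedin_def
proof (intro conjI allI impI)
  show "closedin ?X ?Z"
    unfolding closure_in_def by (rule closedin_zero_locus) simp
  have span: "fun_vs.span {v} \<in> ?Z" if "v \<in> range \<phi>" "v \<noteq> 0" for v
    using that V X by (intro span_in_closure_in) auto
  from span[OF u] show "?Z \<noteq> {}" by auto
  fix A B assume AB: "closedin ?X A \<and> closedin ?X B \<and> ?Z \<subseteq> A \<union> B"
  have separate: "\<exists>m f w. hom_form m f \<and> (\<forall>v\<in>\<Union>A. f v = 0) \<and> w \<in> range \<phi> \<and> f w \<noteq> 0"
    if A: "closedin ?X A" "\<not> ?Z \<subseteq> A" for A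
  proof -
    obtain Q where Q: "Q \<in> ?Z" "Q \<notin> A" using A(2) by auto
    then have "Q \<in> X" "Q \<in> proj_space V" unfolding closure_in_def zero_locus_def by auto
    then obtain m f v where f: "hom_form m f" "\<forall>v\<in>\<Union>A. f v = 0" "v \<in> Q" "f v \<noteq> 0"
      using closed_separating_form[OF A(1) _ _ Q(2)] by metis
    have "\<not> (\<forall>w\<in>range \<phi>. f w = 0)"
      using form_vanishes_on_closure_in[OF f(1) _ Q(1) f(3)] f(4) by metis
    then show ?thesis using f(1,2) by blast
  qed
  show "?Z \<subseteq> A \<or> ?Z \<subseteq> B"
  proof (rule ccontr)
    assume "\<not> ?thesis"
    then obtain m f w n g w' where f: "hom_form m f" "\<forall>v\<in>\<Union>A. f v = 0" "w \<in> range \<phi>" "f w \<noteq> 0"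
      and g: "hom_form n g" "\<forall>v\<in>\<Union>B. g v = 0" "w' \<in> range \<phi>" "g w' \<noteq> 0"
      using separate[of A] separate[of B] AB by metis
    have on_Z: "f v * g v = 0" if "Q \<in> ?Z" "v \<in> Q" for Q v
    proof -
      have "Q \<in> A \<or> Q \<in> B" using AB that(1) by blast
      then show ?thesis using f(2) g(2) that(2) by auto
    qed
    have "f v * g v = 0" if "v \<in> range \<phi>" for v
    proof (cases "v = 0")
      case True
      then show ?thesis using on_Z[OF span[OF u] fun_vs.span_zero] by simp
    next
      case False
      then show ?thesis using on_Z[OF span[OF that False] fun_vs.span_base] by simp
    qed
    then have "(\<forall>v\<in>range \<phi>. f v = 0) \<or> (\<forall>v\<in>range \<phi>. g v = 0)"
      by (rule form_product_vanishes_on_range[OF \<phi> f(1) g(1)])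
    then show False using f(3,4) g(3,4) by auto
  qed
qed

definition coords_alg_indep :: "('i \<Rightarrow> 'k::field) set \<Rightarrow> 'i set \<Rightarrow> bool" where
  "coords_alg_indep S D \<longleftrightarrow> (\<forall>T. lin_indep_on S (D \<rightarrow>\<^sub>E {..T}) (\<lambda>m v. \<Prod>b\<in>D. v b ^ m b))"

lemma hom_form_monomial: "hom_form (\<Sum>b\<in>D. m b) (\<lambda>v. \<Prod>b\<in>D. v b ^ m b)"
proof (rule hom_form_prod)
  fix b
  show "hom_form (m b) (\<lambda>v. v b ^ m b)"
    using hom_form_power[OF hom_form.coord[of b], of "m b"] by simp
qed

text \<open>The monomials in \<open>card D\<close> algebraically independent coordinates grow like \<open>T\<^bsup>card D\<^esup>\<close>.\<close>

lemma card_coords_alg_indep_le: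
  fixes \<phi> :: "('p \<Rightarrow> 'k::field) \<Rightarrow> 'i \<Rightarrow> 'k"
  assumes P: "finite P" and \<phi>: "\<And>i. (\<lambda>z. \<phi> z i) \<in> poly_fun P C"
    and D: "finite D" and indep: "coords_alg_indep (range \<phi>) D"
  shows "card D \<le> card P"
proof (rule growth_le_card_parameters[OF P, of _ \<phi> "card D * C"])
  fix T
  let ?g = "\<lambda>m v. \<Prod>b\<in>D. v b ^ m b"
  have "(\<lambda>z. ?g m (\<phi> z)) \<in> poly_fun P (card D * C * (T + 1))" if m: "m \<in> D \<rightarrow>\<^sub>E {..T}" for m
  proof -
    have "(\<Sum>b\<in>D. m b) \<le> card D * T"
      using sum_bounded_above[of D m T] m by (auto simp: PiE_def Pi_def)
    then have "(\<Sum>b\<in>D. m b) * C \<le> card D * (T + 1) * C"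
      by (intro mult_le_mono1) simp
    then have "(\<Sum>b\<in>D. m b) * C \<le> card D * C * (T + 1)" by (simp only: mult_ac)
    then show ?thesis
      using hom_form_poly_fun[of _ "?g m" \<phi>, OF hom_form_monomial \<phi>] poly_fun_mono by blast
  qed
  moreover have "card (D \<rightarrow>\<^sub>E {..T}) = (T + 1) ^ card D" "finite (D \<rightarrow>\<^sub>E {..T})"
    using D by (simp_all add: card_PiE finite_PiE)
  moreover have "lin_indep_on (range \<phi>) (D \<rightarrow>\<^sub>E {..T}) ?g"
    using indep unfolding coords_alg_indep_def by simp
  ultimately show "\<exists>(I :: ('i \<Rightarrow> nat) set) g. finite I \<and> card I = (T + 1) ^ card D \<and>
      lin_indep_on (range \<phi>) I g \<and> (\<forall>i\<in>I. (\<lambda>z. g i (\<phi> z)) \<in> poly_fun P (card D * C * (T + 1)))"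
    by blast
qed

text \<open>A polynomial relation between the coordinates that holds on \<open>S\<close> but not on \<open>S'\<close> has a
  homogeneous part with the same property.\<close>

lemma form_from_dependence:
  fixes S S' :: "('i \<Rightarrow> 'k::field_char_0) set"
  assumes S: "cone S" and D: "finite D"
    and dep: "\<not> coords_alg_indep S D" and indep: "coords_alg_indep S' D"
  obtains m f v where "hom_form m f" "\<And>v. v \<in> S \<Longrightarrow> f v = 0" "v \<in> S'" "f v \<noteq> 0"
proof -
  let ?g = "\<lambda>m v. \<Prod>b\<in>D. v b ^ m b"
  obtain T where "\<not> lin_indep_on S (D \<rightarrow>\<^sub>E {..T}) ?g"
    using dep unfolding coords_alg_indep_def by auto
  then obtain c m0 where c: "\<And>v. v \<in> S \<Longrightarrow> (\<Sum>m\<in>D \<rightarrow>\<^sub>E {..T}. c m * ?g m v) = 0"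
    "m0 \<in> D \<rightarrow>\<^sub>E {..T}" "c m0 \<noteq> 0"
    unfolding lin_indep_on_def by auto
  let ?deg = "\<lambda>m. \<Sum>b\<in>D. m b"
  let ?M = "\<lambda>t. {m \<in> D \<rightarrow>\<^sub>E {..T}. ?deg m = t}"
  let ?f = "\<lambda>t v. \<Sum>m\<in>?M t. c m * ?g m v"
  have fin: "finite (D \<rightarrow>\<^sub>E {..T})" using D by (simp add: finite_PiE)
  have f: "hom_form t (?f t)" for t
  proof (intro hom_form_sum hom_form_scalar)
    fix m assume "m \<in> ?M t"
    then show "hom_form t (?g m)" using hom_form_monomial[of m D] by simp
  qed
  have "?f (?deg m0) v = 0" if "v \<in> S" for v
  proof (rule homogeneous_parts_vanish[OF S, of "?deg ` (D \<rightarrow>\<^sub>E {..T})" "\<lambda>t. t" ?f])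
    fix v assume "v \<in> S"
    have "(\<Sum>t\<in>?deg ` (D \<rightarrow>\<^sub>E {..T}). ?f t v) = (\<Sum>m\<in>D \<rightarrow>\<^sub>E {..T}. c m * ?g m v)"
      by (rule sum.group) (use fin in auto)
    then show "(\<Sum>t\<in>?deg ` (D \<rightarrow>\<^sub>E {..T}). ?f t v) = 0" using c(1)[OF \<open>v \<in> S\<close>] by simp
  qed (use f fin that c(2) in auto)
  moreover have "\<exists>v\<in>S'. ?f (?deg m0) v \<noteq> 0"
  proof (rule ccontr)
    assume "\<not> ?thesis"
    moreover have "(\<Sum>m\<in>D \<rightarrow>\<^sub>E {..T}. (if ?deg m = ?deg m0 then c m else 0) * ?g m v) = ?f
        (?deg m0) v" for v
    proof -
      have "(\<Sum>m\<in>D \<rightarrow>\<^sub>E {..T}. (if ?deg m = ?deg m0 then c m else 0) * ?g m v) =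
          (\<Sum>m\<in>D \<rightarrow>\<^sub>E {..T}. if ?deg m = ?deg m0 then c m * ?g m v else 0)"
        by (intro sum.cong) auto
      also have "\<dots> = ?f (?deg m0) v" using fin by (simp add: sum.inter_filter)
      finally show ?thesis .
    qed
    moreover have "lin_indep_on S' (D \<rightarrow>\<^sub>E {..T}) ?g"
      using indep unfolding coords_alg_indep_def by simp
    ultimately have "(if ?deg m0 = ?deg m0 then c m0 else 0) = 0"
      using c(2) lin_indep_onD[of S' "D \<rightarrow>\<^sub>E {..T}" ?g "\<lambda>m. if ?deg m =
          ?deg m0 then c m else 0" m0] by simp
    then show False using c(3) by simp
  qed
  ultimately show ?thesis using f[of "?deg m0"] that by blast
qed

lemma coords_alg_indep_nonzero:
  fixes S :: "('a \<Rightarrow> 'b::field) set"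
  assumes "coords_alg_indep S D" "finite D" "D \<noteq> {}"
  shows "\<exists>v\<in>S. v \<noteq> 0"
proof (rule ccontr)
  let ?g = "\<lambda>m v. \<Prod>b\<in>D. v b ^ m b"
  define m1 where "m1 = restrict (\<lambda>_. 1::nat) D"
  let ?c = "\<lambda>m. if m = m1 then 1 else 0 :: 'b"
  assume "\<not> ?thesis"
  moreover have "?g m1 (0 :: 'a \<Rightarrow> 'b) = 0" using assms(2,3) by (intro prod_zero) (auto simp: m1_def)
  ultimately have 0: "(\<Sum>m\<in>D \<rightarrow>\<^sub>E {..1}. ?c m * ?g m v) = 0" if "v \<in> S" for v
    using that by (intro sum.neutral) auto
  have indep: "lin_indep_on S (D \<rightarrow>\<^sub>E {..1}) ?g"
    using assms(1) unfolding coords_alg_indep_def by simp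
  have "m1 \<in> D \<rightarrow>\<^sub>E {..1}" by (auto simp: m1_def)
  from lin_indep_onD[of S _ ?g ?c, OF indep 0 this] have "?c m1 = 0" by blast
  then show False by simp
qed

text \<open>The \<open>j\<close>-th map has at most \<open>j + 1\<close> parameters, so the \<open>j + 2\<close> coordinates that are
  independent for the next map satisfy a relation on its range. This relation is a form that
  separates the two closures.\<close>

lemma proj_dim_ge_parameters:
  fixes V :: "('i \<Rightarrow> 'k::field_char_0) set" and \<phi> :: "nat \<Rightarrow> ('p \<Rightarrow> 'k) \<Rightarrow> 'i \<Rightarrow> 'k"
  assumes P: "\<And>j. j \<le> n \<Longrightarrow> finite (P j)" "\<And>j. j \<le> n \<Longrightarrow> card (P j) \<le> Suc j"
    and \<phi>: "\<And>i j. j \<le> n \<Longrightarrow> (\<lambda>z. \<phi> j z i) \<in> poly_fun (P j) C"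
    and cone: "\<And>j. j \<le> n \<Longrightarrow> cone (range (\<phi> j))"
    and nested: "\<And>j. j < n \<Longrightarrow> range (\<phi> j) \<subseteq> range (\<phi> (Suc j))"
    and D: "\<And>j. j \<le> n \<Longrightarrow> finite (D j)" "\<And>j. j \<le> n \<Longrightarrow> card (D j) = Suc j"
    and indep: "\<And>j. j \<le> n \<Longrightarrow> coords_alg_indep (range (\<phi> j)) (D j)"
    and V: "range (\<phi> n) \<subseteq> V" and X: "\<And>v. v \<in> range (\<phi> n) \<Longrightarrow> v \<noteq> 0 \<Longrightarrow> fun_vs.span {v} \<in> X"
  shows "enat n \<le> proj_dim V X"
proof (rule chain_length_le_proj_dim)
  have sub: "range (\<phi> j) \<subseteq> range (\<phi> n)" if "j \<le> n" for j
    using that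
  proof (induction j rule: inc_induct)
    case (step j)
    then show ?case using nested[of j] by (simp add: order_trans)
  qed simp
  show irr: "irreducible_closedin (subtopology (zariski V) X) (closure_in V X (range (\<phi> j)))"
    if j: "j \<le> n" for j
  proof -
    have "D j \<noteq> {}" using D(2)[OF j] by auto
    from coords_alg_indep_nonzero[OF indep[OF j] D(1)[OF j] this]
    obtain u where u: "u \<in> range (\<phi> j)" "u \<noteq> 0" by (elim bexE)
    have "fun_vs.span {v} \<in> X" if "v \<in> range (\<phi> j)" "v \<noteq> 0" for v
      by (rule X[OF subsetD[OF sub[OF j] that(1)] that(2)])
    then show ?thesis
      using u by (intro irreducible_closure_in[OF \<phi>[OF j] order_trans[OF sub[OF j] V]])
  qed
  show "closure_in V X (range (\<phi> j)) \<subset> closure_in V X (range (\<phi> (Suc j)))" if j: "j < n" for j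
  proof -
    have jn: "j \<le> n" "Suc j \<le> n" using j by simp_all
    have "\<not> coords_alg_indep (range (\<phi> j)) (D (Suc j))"
    proof
      assume "coords_alg_indep (range (\<phi> j)) (D (Suc j))"
      then have "card (D (Suc j)) \<le> card (P j)"
        by (rule card_coords_alg_indep_le[OF P(1)[OF jn(1)] \<phi>[OF jn(1)] D(1)[OF jn(2)]])
      with P(2)[of j] D(2)[of "Suc j"] j show False by simp
    qed
    then obtain m f v where f: "hom_form m f" "\<And>w. w \<in> range (\<phi> j) \<Longrightarrow> f w = 0"
      "v \<in> range (\<phi> (Suc j))" "f v \<noteq> 0"
      by (rule form_from_dependence[OF cone[OF jn(1)] D(1)[OF jn(2)] _ indep[OF jn(2)]]) (rule that)
    show ?thesis
    proof (cases "v = 0")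
      case True
      obtain u where u: "fun_vs.span {u} \<in> closure_in V X (range (\<phi> j))"
      proof -
        have "closure_in V X (range (\<phi> j)) \<noteq> {}" "closure_in V X (range (\<phi> j)) \<subseteq> proj_space V"
          using irr[OF jn(1)] irreducible_subset[OF irr[OF jn(1)]]
              unfolding irreducible_closedin_def by simp_all
        then obtain Q where "Q \<in> closure_in V X (range (\<phi> j))" "Q \<in> proj_space V" by auto
        then show ?thesis using that unfolding proj_space_def by auto
      qed
      have "f 0 = 0"
        by (rule form_vanishes_on_closure_in[OF f(1) _ u fun_vs.span_zero]) (rule f(2))
      with f(4) True show ?thesis by simp
    next
      case False
      have "fun_vs.span {v} \<in> closure_in V X (range (\<phi> (Suc j)))"
        using subsetD[OF sub[OF jn(2)] f(3)] V False f(3)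
        by (intro span_in_closure_in X) auto
      moreover have "fun_vs.span {v} \<notin> closure_in V X (range (\<phi> j))"
      proof
        assume *: "fun_vs.span {v} \<in> closure_in V X (range (\<phi> j))"
        have "f v = 0"
          by (rule form_vanishes_on_closure_in[OF f(1) _ * fun_vs.span_base]) (simp_all add: f(2))
        with f(4) show False by simp
      qed
      ultimately show ?thesis using closure_in_mono[OF nested[OF j], of V X] by auto
    qed
  qed
qed

section \<open>Algebraic independence by leading exponents\<close>

text \<open>The triple \<open>(f\<^sub>0, f\<^sub>1, f\<^sub>2)\<close> stands for the affine function \<open>f\<^sub>0 + f\<^sub>1 b\<^sub>1 + f\<^sub>2 b\<^sub>2\<close> on
  the plane.\<close>

definition affine :: "int \<times> int \<times> int \<Rightarrow> nat \<times> nat \<Rightarrow> int" where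
  "affine f b = (case f of (f0, f1, f2) \<Rightarrow> f0 + f1 * int (fst b) + f2 * int (snd b))"

definition affine_coord :: "nat \<times> nat \<Rightarrow> nat \<Rightarrow> nat" where
  "affine_coord b c = (if c = 0 then 1 else if c = 1 then fst b else snd b)"

lemma digit_sum_less:
  fixes e :: "nat \<Rightarrow> nat"
  assumes "\<And>q. q < j \<Longrightarrow> e q < L"
  shows "(\<Sum>q<j. e q * L ^ q) < L ^ j"
  using assms
proof (induction j)
  case (Suc j)
  have "(\<Sum>q<Suc j. e q * L ^ q) < L ^ j + e j * L ^ j" using Suc by simp
  also have "\<dots> = (e j + 1) * L ^ j" by simp
  also have "\<dots> \<le> L * L ^ j" using Suc.prems[of j] by (intro mult_le_mono1) simp
  finally show ?case by simp
qed simp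

lemma digits_unique:
  fixes e e' :: "nat \<Rightarrow> nat"
  assumes "\<And>q. q < j \<Longrightarrow> e q < L" "\<And>q. q < j \<Longrightarrow> e' q < L"
    and "(\<Sum>q<j. e q * L ^ q) = (\<Sum>q<j. e' q * L ^ q)" and "q < j"
  shows "e q = e' q"
  using assms
proof (induction j)
  case (Suc j)
  have less: "(\<Sum>q<j. e q * L ^ q) < L ^ j" "(\<Sum>q<j. e' q * L ^ q) < L ^ j"
    using Suc.prems(1,2) by (intro digit_sum_less; simp)+
  have eq: "(\<Sum>q<j. e q * L ^ q) + e j * L ^ j = (\<Sum>q<j. e' q * L ^ q) + e' j * L ^ j"
    using Suc.prems(3) by simp
  from arg_cong[OF this, of "\<lambda>x. x div L ^ j"] have "e j = e' j"
    using less by (cases "L ^ j = 0") simp_all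
  then show ?case using Suc.IH Suc.prems eq by (cases "q = j") auto
qed simp

lemma lin_indep_distinct_degrees:
  fixes R :: "'i \<Rightarrow> 'k::field poly"
  assumes I: "finite I" and R: "\<And>i. i \<in> I \<Longrightarrow> R i \<noteq> 0" and inj: "inj_on (\<lambda>i. degree (R i)) I"
    and sum: "(\<Sum>i\<in>I. [:c i:] * R i) = 0" and i: "i \<in> I"
  shows "c i = 0"
proof (rule ccontr)
  assume "c i \<noteq> 0"
  let ?J = "{i \<in> I. c i \<noteq> 0}"
  define t where "t = Max ((\<lambda>i. degree (R i)) ` ?J)"
  have fin: "finite ((\<lambda>i. degree (R i)) ` ?J)" "(\<lambda>i. degree (R i)) ` ?J \<noteq> {}"
    using I i \<open>c i \<noteq> 0\<close> by auto
  from Max_in[OF fin] obtain l where l: "l \<in> ?J" "degree (R l) = t" unfolding t_def by auto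
  have "0 = coeff (\<Sum>i\<in>I. [:c i:] * R i) t" by (simp only: sum coeff_0)
  also have "\<dots> = (\<Sum>i\<in>I. c i * coeff (R i) t)" by (simp add: coeff_sum)
  also have "\<dots> = (\<Sum>i\<in>{l}. c i * coeff (R i) t)"
  proof (rule sum.mono_neutral_right)
    show "\<forall>i\<in>I - {l}. c i * coeff (R i) t = 0"
    proof
      fix i assume i: "i \<in> I - {l}"
      show "c i * coeff (R i) t = 0"
      proof (cases "c i = 0")
        case False
        then have "degree (R i) \<le> t" unfolding t_def using i fin(1) by (intro Max_ge) auto
        moreover have "degree (R i) \<noteq> t" using i l inj by (auto dest: inj_onD)
        ultimately show ?thesis by (simp add: coeff_eq_0)
      qed simp
    qed
  qed (use I l in auto)
  also have "\<dots> = c l * lead_coeff (R l)" using l by simp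
  finally have "lead_coeff (R l) = 0" using l by simp
  then have "R l = 0" by (simp only: leading_coeff_0_iff)
  then show False using l R[of l] by simp
qed

lemma degree_sum_unique_max:
  fixes w :: "'i \<Rightarrow> nat"
  assumes "finite I" "i \<in> I" "\<And>l. l \<in> I \<Longrightarrow> l \<noteq> i \<Longrightarrow> w l < w i"
  shows "degree (\<Sum>l\<in>I. monom (1::'k::field) (w l)) = w i" "(\<Sum>l\<in>I. monom (1::'k::field) (w l)) \<noteq> 0"
proof -
  let ?q = "\<Sum>l\<in>I. monom (1::'k) (w l)"
  have "coeff ?q (w i) = (\<Sum>l\<in>I. if l = i then 1 else 0)"
    unfolding coeff_sum coeff_monom
  proof (rule sum.cong)
    fix l assume "l \<in> I"
    then show "(if w l = w i then 1 else 0) = (if l = i then 1 else 0 :: 'k)"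
      using assms(3)[of l] by (cases "l = i") auto
  qed simp
  then have c: "coeff ?q (w i) = 1" using assms by simp
  then show "?q \<noteq> 0" by auto
  have "degree ?q \<le> w i"
  proof (rule degree_sum_le)
    fix l assume "l \<in> I"
    then have "w l \<le> w i" using assms(3)[of l] by (cases "l = i") auto
    then show "degree (monom (1::'k) (w l)) \<le> w i" using degree_monom_le[of 1 "w l"] by
        (rule order_trans[rotated])
  qed (use assms in simp)
  moreover have "w i \<le> degree ?q" using c by (intro le_degree) simp
  ultimately show "degree ?q = w i" by simp
qed

text \<open>Affinely independent points have no affine relation. Truncating at \<open>t < 3\<close> corresponds to
  an incomplete cell, for which only the first \<open>t\<close> of the three coordinates \<open>1, x, y\<close> are
  available.\<close>

lemma cell_sums_determine:
  fixes x y :: "nat \<Rightarrow> int" and t :: nat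
  assumes t: "t \<le> 3"
    and x: "2 \<le> t \<Longrightarrow> x 0 \<noteq> x 1"
    and det: "t = 3 \<Longrightarrow> (x 1 - x 0) * (y 2 - y 0) - (x 2 - x 0) * (y 1 - y 0) \<noteq> 0"
    and s0: "1 \<le> t \<Longrightarrow> (\<Sum>c<t. n c) = 0" and s1: "2 \<le> t \<Longrightarrow> (\<Sum>c<t. n c * x c) = 0"
    and s2: "t = 3 \<Longrightarrow> (\<Sum>c<t. n c * y c) = 0" and c: "c < t"
  shows "n c = 0"
proof -
  consider "t = 1" | "t = 2" | "t = 3" using t c by linarith
  then show ?thesis
  proof cases
    case 1
    then show ?thesis using s0 c by simp
  next
    case 2
    then have "n 0 + n 1 = 0" "n 0 * x 0 + n 1 * x 1 = 0" using s0 s1 by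
        (simp_all add: numeral_2_eq_2)
    moreover have "n 1 * (x 1 - x 0) = (n 0 * x 0 + n 1 * x 1) - (n 0 + n 1) * x 0"
      by (simp add: algebra_simps)
    ultimately have "n 0 = - n 1" "n 1 * (x 1 - x 0) = 0" by simp_all
    then have "n 1 = 0" "n 0 = 0" using x 2 by auto
    then show ?thesis using c 2 by (auto simp: less_Suc_eq numeral_2_eq_2)
  next
    case 3
    then have e: "n 0 + n 1 + n 2 = 0" "n 0 * x 0 + n 1 * x 1 + n 2 * x 2 = 0"
      "n 0 * y 0 + n 1 * y 1 + n 2 * y 2 = 0"
      using s0 s1 s2 by (simp_all add: numeral_3_eq_3 numeral_2_eq_2)
    then have n0: "n 0 = - n 1 - n 2" by simp
    have a: "n 1 * (x 1 - x 0) + n 2 * (x 2 - x 0) = 0" "n 1 * (y 1 - y 0) + n 2 * (y 2 - y 0) = 0"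
      using e(2,3) unfolding n0 by (simp_all add: algebra_simps)
    let ?D = "(x 1 - x 0) * (y 2 - y 0) - (x 2 - x 0) * (y 1 - y 0)"
    have "n 1 * ?D = (n 1 * (x 1 - x 0) + n 2 * (x 2 - x 0)) * (y 2 - y 0) -
        (n 1 * (y 1 - y 0) + n 2 * (y 2 - y 0)) * (x 2 - x 0)"
      "n 2 * ?D = (n 1 * (y 1 - y 0) + n 2 * (y 2 - y 0)) * (x 1 - x 0) -
        (n 1 * (x 1 - x 0) + n 2 * (x 2 - x 0)) * (y 1 - y 0)"
      by (simp_all add: algebra_simps)
    then have "n 1 = 0" "n 2 = 0" using det[OF 3] unfolding a by simp_all
    with n0 have "n 0 = 0" by simp
    then show ?thesis using c 3 \<open>n 1 = 0\<close> \<open>n 2 = 0\<close>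
      by (auto simp: less_Suc_eq numeral_3_eq_3 numeral_2_eq_2)
  qed
qed

definition sv_chart :: "nat \<Rightarrow> nat \<Rightarrow> 'k::field \<Rightarrow> 'k \<Rightarrow> nat \<times> nat \<Rightarrow> 'k" where
  "sv_chart d e x y = (\<lambda>(i, j). of_nat (d choose i) * of_nat (e choose j) * x ^ i * y ^ j)"

text \<open>The three parameters of the \<open>i\<close>-th summand have the numbers \<open>3i\<close>, \<open>3i + 1\<close>, \<open>3i + 2\<close>: a
  scalar and the affine coordinates of a point on each of the two projective lines.\<close>

definition secant_param :: "nat \<Rightarrow> nat \<Rightarrow> nat \<Rightarrow> (nat \<Rightarrow> 'k::field) \<Rightarrow> nat \<times> nat \<Rightarrow> 'k" where
  "secant_param d e k z = (\<lambda>b. \<Sum>i<k. z (3 * i) * sv_chart d e (z (3 * i + 1)) (z (3 * i + 2)) b)"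

text \<open>Only the first \<open>j\<close> parameters remain free. Frozen scalars are \<open>0\<close>, which removes a
  summand, and frozen coordinates are \<open>1\<close>, which makes them disappear from the monomials.\<close>

definition freeze :: "nat \<Rightarrow> (nat \<Rightarrow> 'k::field) \<Rightarrow> nat \<Rightarrow> 'k" where
  "freeze j z p = (if p < j then z p else if p mod 3 = 0 then 0 else 1)"

text \<open>The numbers less than \<open>j\<close> of the parameters in the \<open>i\<close>-th summand, and at the same time
  the numbers of the points in the \<open>i\<close>-th cell: there are as many points as free parameters.\<close>

definition cell :: "nat \<Rightarrow> nat \<Rightarrow> nat set" where
  "cell j i = {q. q < j \<and> q div 3 = i}"

lemma cell_eq: "cell j i = (\<lambda>c. 3 * i + c) ` {..<min 3 (j - 3 * i)}"
proof -
  have "q \<in> (\<lambda>c. 3 * i + c) ` {..<min 3 (j - 3 * i)}" if "q \<in> cell j i" for q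
  proof (rule image_eqI[of _ _ "q mod 3"])
    show *: "q = 3 * i + q mod 3" using that by (auto simp: cell_def)
    have "q mod 3 < j - 3 * (q div 3)" if "q < j" using that by presburger
    then show "q mod 3 \<in> {..<min 3 (j - 3 * i)}" using that by (auto simp: cell_def)
  qed
  then show ?thesis by (auto simp: cell_def)
qed

lemma secant_param_freeze:
  fixes z :: "nat \<Rightarrow> 'a::field"
  assumes k: "j \<le> 3 * k" and j: "0 < j"
  shows "secant_param d e k (freeze j z) b = of_nat (d choose fst b) * of_nat (e choose snd b) *
           (\<Sum>i\<le>(j - 1) div 3. \<Prod>q\<in>cell j i. z q ^ affine_coord b (q mod 3))"
proof -
  have summand: "freeze j z (3 * i) * freeze j z (3 * i + 1) ^ fst b * freeze j z (3 * i
      + 2) ^ snd b =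
      (if i \<le> (j - 1) div 3 then \<Prod>q\<in>cell j i. z q ^ affine_coord b (q mod 3) else 0)" for i
  proof (cases "3 * i < j")
    case True
    then have "i \<le> (j - 1) div 3" by auto
    have inj: "inj_on (\<lambda>c. 3 * i + c) A" for A by (rule inj_onI) simp
    have prods: "(\<Prod>c<2. h c) = h 0 * h 1" "(\<Prod>c<3. h c) = h 0 * h 1 * h 2" for h :: "nat \<Rightarrow> 'a"
      by (simp_all add: numeral_2_eq_2 numeral_3_eq_3)
    have mod3: "Suc (3 * i) mod 3 = 1" "Suc (Suc (3 * i)) mod 3 = 2" by presburger+
    consider "j = 3 * i + 1" | "j = 3 * i + 2" | "3 * i + 3 \<le> j" using True by linarith
    then have "(\<Prod>q\<in>cell j i. z q ^ affine_coord b (q mod 3)) =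
        freeze j z (3 * i) * freeze j z (3 * i + 1) ^ fst b * freeze j z (3 * i + 2) ^ snd b"
      unfolding cell_eq prod.reindex[OF inj] comp_def
    proof cases
      case 1
      then show "(\<Prod>c<min 3 (j - 3 * i). z (3 * i + c) ^ affine_coord b ((3 * i + c) mod 3)) =
        freeze j z (3 * i) * freeze j z (3 * i + 1) ^ fst b * freeze j z (3 * i + 2) ^ snd b"
        by (simp add: freeze_def affine_coord_def mod3)
    next
      case 2
      then have "min 3 (j - 3 * i) = 2" by simp
      with 2 show "(\<Prod>c<min 3 (j - 3 * i). z (3 * i + c) ^ affine_coord b ((3 * i + c) mod 3)) =
        freeze j z (3 * i) * freeze j z (3 * i + 1) ^ fst b * freeze j z (3 * i + 2) ^ snd b"
        by (simp add: freeze_def affine_coord_def mod3 prods)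
    next
      case 3
      then have "min 3 (j - 3 * i) = 3" by simp
      with 3 show "(\<Prod>c<min 3 (j - 3 * i). z (3 * i + c) ^ affine_coord b ((3 * i + c) mod 3)) =
        freeze j z (3 * i) * freeze j z (3 * i + 1) ^ fst b * freeze j z (3 * i + 2) ^ snd b"
        by (simp add: freeze_def affine_coord_def mod3 prods)
    qed
    with \<open>i \<le> (j - 1) div 3\<close> show ?thesis by simp
  next
    case False
    then have "\<not> i \<le> (j - 1) div 3" using j by auto
    then show ?thesis using False by (simp add: freeze_def)
  qed
  have "secant_param d e k (freeze j z) b = of_nat (d choose fst b) * of_nat (e choose snd b) *
      (\<Sum>i<k. freeze j z (3 * i) * freeze j z (3 * i + 1) ^ fst b * freeze j z (3 * i + 2) ^ snd b)"
    unfolding secant_param_def sv_chart_def sum_distrib_left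
    by (intro sum.cong refl) (simp add: split_beta mult_ac)
  also have "(\<Sum>i<k. freeze j z (3 * i) * freeze j z (3 * i + 1) ^ fst b * freeze j z (3 * i
      + 2) ^ snd b) =
      (\<Sum>i\<in>{..<k} \<inter> {..(j - 1) div 3}. \<Prod>q\<in>cell j i. z q ^ affine_coord b (q mod 3))"
    unfolding summand by (simp add: sum.inter_restrict)
  also have "{..<k} \<inter> {..(j - 1) div 3} = {..(j - 1) div 3}"
    using k j by auto
  finally show ?thesis .
qed

lemma prod_power_int: "x \<noteq> 0 \<Longrightarrow> (\<Prod>q\<in>A. x powi w q) = x powi (\<Sum>q\<in>A. w q)" for x :: "'a::field"
  by (induction A rule: infinite_finite_induct) (simp_all add: power_int_add)

text \<open>The exponent of the \<open>q\<close>-th parameter in the product of the leading monomials, when the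
  \<open>p\<close>-th coordinate occurs \<open>n p\<close> times.\<close>

definition exponent :: "(nat \<Rightarrow> nat \<times> nat) \<Rightarrow> nat \<Rightarrow> (nat \<Rightarrow> nat) \<Rightarrow> nat \<Rightarrow> nat" where
  "exponent pt j n q = (\<Sum>p\<in>cell j (q div 3). n p * affine_coord (pt p) (q mod 3))"

lemma card_cell_le: "card (cell j i) \<le> 3"
  unfolding cell_eq by (rule order_trans[OF card_image_le]) simp_all

lemma exponents_determine:
  assumes edge: "\<And>i. 3 * i + 1 < j \<Longrightarrow> fst (pt (3 * i)) \<noteq> fst (pt (3 * i + 1))"
    and tri: "\<And>i. 3 * i + 2 < j \<Longrightarrow>
      (int (fst (pt (3 * i + 1))) - int (fst (pt (3 * i)))) * (int (snd (pt (3 * i + 2))) - int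
          (snd (pt (3 * i)))) -
      (int (fst (pt (3 * i + 2))) - int (fst (pt (3 * i)))) * (int (snd (pt (3 * i + 1))) - int
          (snd (pt (3 * i)))) \<noteq> 0"
    and eq: "\<And>q. q < j \<Longrightarrow> exponent pt j n q = exponent pt j n' q"
    and p: "p < j"
  shows "n p = n' p"
proof -
  define i where "i = p div 3"
  define t where "t = min 3 (j - 3 * i)"
  define x y where "x c = int (fst (pt (3 * i + c)))" and "y c = int (snd (pt (3 * i + c)))" for c
  let ?\<delta> = "\<lambda>c. int (n (3 * i + c)) - int (n' (3 * i + c))"
  have inj: "inj_on (\<lambda>c. 3 * i + c) A" for A by (rule inj_onI) simp
  have expo: "int (exponent pt j m (3 * i + c)) =
      (\<Sum>c'<t. int (m (3 * i + c')) * int (affine_coord (pt (3 * i + c')) c))" if "c < 3" for m c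
  proof -
    have "(3 * i + c) div 3 = i" "(3 * i + c) mod 3 = c" using that by simp_all
    then show ?thesis
      unfolding exponent_def cell_eq t_def by (simp only: sum.reindex[OF inj] o_def of_nat_sum
          of_nat_mult)
  qed
  have sums: "(\<Sum>c'<t. ?\<delta> c' * int (affine_coord (pt (3 * i + c')) c)) = 0" if "c < t" for c
  proof -
    have "c < 3" "3 * i + c < j" using that unfolding t_def by auto
    then show ?thesis
      using expo[of c n] expo[of c n'] eq[of "3 * i + c"]
      by (simp only: left_diff_distrib sum_subtractf diff_self)
  qed
  have "3 * i + p mod 3 < j" using p unfolding i_def by simp
  then have "p mod 3 < t" unfolding t_def by simp
  then have "?\<delta> (p mod 3) = 0"
  proof (rule cell_sums_determine[where x = x and y = y and n = ?\<delta>, rotated -1])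
    show "t \<le> 3" unfolding t_def by simp
    show "x 0 \<noteq> x 1" if "2 \<le> t" using edge[of i] that unfolding x_def t_def by simp
    show "(x 1 - x 0) * (y 2 - y 0) - (x 2 - x 0) * (y 1 - y 0) \<noteq> 0" if "t = 3"
      using tri[of i] that unfolding x_def y_def t_def by simp
    show "(\<Sum>c<t. ?\<delta> c) = 0" if "1 \<le> t" using sums[of 0] that by (simp add: affine_coord_def)
    show "(\<Sum>c<t. ?\<delta> c * x c) = 0" if "2 \<le> t" using sums[of 1] that by
        (simp add: affine_coord_def x_def)
    show "(\<Sum>c<t. ?\<delta> c * y c) = 0" if "t = 3" using sums[of 2] that by
        (simp add: affine_coord_def y_def)
  qed
  then show ?thesis by (simp add: i_def)
qed

lemma poly_eq_0_off_0:
  fixes p :: "'a::field_char_0 poly"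
  assumes "\<And>x. x \<noteq> 0 \<Longrightarrow> poly p x = 0"
  shows "p = 0"
proof -
  have "poly ([:0, 1:] * p) x = 0" for x using assms[of x] by (cases "x = 0") simp_all
  then have "[:0, 1:] * p = 0" using poly_all_0_iff_0 by blast
  then show ?thesis by simp
qed

text \<open>The weights of the parameters of the \<open>i\<close>-th summand are the coefficients of \<open>f i\<close>, after
  subtraction of the function of the last cell that is in use. This leaves the comparison
  between the functions intact and gives weight \<open>0\<close> to the frozen parameters of that cell, as it
  must. The weights are scaled by a large \<open>M\<close> and perturbed by \<open>L\<^sup>q\<close> for the \<open>q\<close>-th parameter.
  Modulo \<open>M\<close>, the leading exponent of a monomial in the coordinates is then the number whose
  digits in base \<open>L\<close> are the exponents of the parameters in its leading monomial. These
  exponents determine the monomial, so distinct monomials have distinct leading exponents and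
  are linearly independent.\<close>

lemma coords_alg_indep_cells:
  fixes pt :: "nat \<Rightarrow> nat \<times> nat" and f :: "nat \<Rightarrow> int \<times> int \<times> int"
  assumes k: "j \<le> 3 * k" and j: "0 < j"
    and box: "\<And>p. p < j \<Longrightarrow> fst (pt p) \<le> d \<and> snd (pt p) \<le> e"
    and inj: "inj_on pt {..<j}"
    and win: "\<And>p i. p < j \<Longrightarrow> i \<le> (j - 1) div 3 \<Longrightarrow> i \<noteq> p div 3 \<Longrightarrow>
      affine (f i) (pt p) < affine (f (p div 3)) (pt p)"
    and edge: "\<And>i. 3 * i + 1 < j \<Longrightarrow> fst (pt (3 * i)) \<noteq> fst (pt (3 * i + 1))"
    and tri: "\<And>i. 3 * i + 2 < j \<Longrightarrow>
      (int (fst (pt (3 * i + 1))) - int (fst (pt (3 * i)))) * (int (snd (pt (3 * i + 2))) - int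
          (snd (pt (3 * i)))) -
      (int (fst (pt (3 * i + 2))) - int (fst (pt (3 * i)))) * (int (snd (pt (3 * i + 1))) - int
          (snd (pt (3 * i)))) \<noteq> 0"
  shows "coords_alg_indep (range (\<lambda>z :: nat \<Rightarrow> 'k::field_char_0. secant_param d e k (freeze j z)))
      (pt ` {..<j})"
  unfolding coords_alg_indep_def
proof
  fix T
  define i0 where "i0 = (j - 1) div 3"
  \<comment> \<open>\<open>L\<close> exceeds every exponent that can occur, so that exponents are digits in base \<open>L\<close>.\<close>
  define L where "L = 3 * (T * (d + e + 1)) + d + e + 2"
  define M where "M = L ^ j"
  have M0: "M > 0" unfolding M_def L_def by simp
  \<comment> \<open>A common shift of all scalars that makes the exponents of the variable nonnegative.\<close>
  define N1 where "N1 = (\<Sum>i\<le>i0. \<Sum>p<j. \<bar>affine (f i) (pt p) - affine (f i0) (pt p)\<bar>)"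
  define coef where "coef g c = (if c = 0 then fst g else if c = 1 then fst (snd g) else snd
      (snd g))"
    for g :: "int \<times> int \<times> int" and c :: nat
  define w where "w q = int M * (coef (f (q div 3)) (q mod 3) - coef (f i0) (q mod 3) +
      (if q mod 3 = 0 then N1 else 0)) + int (L ^ q)" for q
  define \<alpha> where "\<alpha> i p = nat (affine (f i) (pt p) - affine (f i0) (pt p) + N1)" for i p
  define \<kappa> where "\<kappa> i p = (\<Sum>q\<in>cell j i. affine_coord (pt p) (q mod 3) * L ^ q)" for i p
  define W where "W i p = M * \<alpha> i p + \<kappa> i p" for i p
  let ?D = "pt ` {..<j}"
  have div_le: "p div 3 \<le> i0" if "p < j" for p using that unfolding i0_def by
      (intro div_le_mono) simp
  have coord_le: "affine_coord (pt p) c \<le> d + e + 1" if "p < j" for p c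
    using box[OF that] by (auto simp: affine_coord_def)
  have \<alpha>: "int (\<alpha> i p) = affine (f i) (pt p) - affine (f i0) (pt p) + N1" if "i \<le> i0" "p < j"
      for i p
  proof -
    have "\<bar>affine (f i) (pt p) - affine (f i0) (pt p)\<bar> \<le> (\<Sum>p<j. \<bar>affine (f i) (pt p) - affine
        (f i0) (pt p)\<bar>)"
      using that by (intro member_le_sum) simp_all
    also have "\<dots> \<le> N1"
      unfolding N1_def using that
      by (intro member_le_sum[of i _ "\<lambda>i. \<Sum>p<j. \<bar>affine (f i) (pt p) - affine (f i0) (pt p)\<bar>"])
          (simp_all add: sum_nonneg)
    finally show ?thesis unfolding \<alpha>_def by linarith
  qed
  have weight: "(\<Sum>q\<in>cell j i. w q * int (affine_coord (pt p) (q mod 3))) = int (W i p)"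
    if ip: "i \<le> i0" "p < j" for i p
  proof -
    let ?x = "\<lambda>c. int (affine_coord (pt p) c)"
    let ?\<Delta> = "\<lambda>c. coef (f i) c - coef (f i0) c + (if c = 0 then N1 else 0)"
    have inj3: "inj_on (\<lambda>c. 3 * i + c) A" for A by (rule inj_onI) simp
    have "(\<Sum>q\<in>cell j i. w q * ?x (q mod 3)) =
        int M * (\<Sum>q\<in>cell j i. ?\<Delta> (q mod 3) * ?x (q mod 3)) + int (\<kappa> i p)"
      unfolding \<kappa>_def sum_distrib_left of_nat_sum sum.distrib[symmetric]
      by (intro sum.cong refl) (auto simp: w_def cell_def algebra_simps)
    also have "(\<Sum>q\<in>cell j i. ?\<Delta> (q mod 3) * ?x (q mod 3)) = (\<Sum>c<min 3 (j - 3 * i). ?\<Delta> c * ?x c)"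
      unfolding cell_eq sum.reindex[OF inj3] by (intro sum.cong) auto
    \<comment> \<open>If the last cell is incomplete, \<open>\<Delta>\<close> vanishes at the coordinates that it lacks.\<close>
    also have "\<dots> = (\<Sum>c<3. ?\<Delta> c * ?x c)"
    proof (rule sum.mono_neutral_left)
      have "3 * i0 < j" using j unfolding i0_def by simp
      show "\<forall>c\<in>{..<3} - {..<min 3 (j - 3 * i)}. ?\<Delta> c * ?x c = 0"
      proof (cases "i = i0")
        case True
        then show ?thesis using \<open>3 * i0 < j\<close> by auto
      next
        case False
        then have "3 * i + 3 \<le> j" using ip(1) \<open>3 * i0 < j\<close> by linarith
        then show ?thesis by auto
      qed
    qed auto
    also have "\<dots> = int (\<alpha> i p)"
      unfolding \<alpha>[OF ip]
      by (simp add: numeral_3_eq_3 coef_def affine_coord_def affine_def split_beta algebra_simps)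
    finally show ?thesis unfolding W_def by simp
  qed
  have \<kappa>_less: "\<kappa> i p < M" if "p < j" for i p
  proof -
    have "\<kappa> i p = (\<Sum>q<j. (if q div 3 = i then affine_coord (pt p) (q mod 3) else 0) * L ^ q)"
      unfolding \<kappa>_def by (rule sum.mono_neutral_cong_left) (auto simp: cell_def)
    also have "\<dots> < M"
      unfolding M_def
    proof (rule digit_sum_less)
      fix q
      have "affine_coord (pt p) (q mod 3) < L"
        using coord_le[OF that, of "q mod 3"] unfolding L_def by linarith
      then show "(if q div 3 = i then affine_coord (pt p) (q mod 3) else 0) < L"
        by (simp add: L_def)
    qed
    finally show ?thesis .
  qed
  have W_less: "W i p < W (p div 3) p" if "i \<le> i0" "p < j" "i \<noteq> p div 3" for i p
  proof -
    have "int (\<alpha> i p) < int (\<alpha> (p div 3) p)"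
      using win[OF that(2) _ that(3)] that \<alpha>[OF that(1,2)] \<alpha>[OF div_le that(2)] unfolding i0_def
          by simp
    then have "\<alpha> i p + 1 \<le> \<alpha> (p div 3) p" by simp
    then have "M * (\<alpha> i p + 1) \<le> M * \<alpha> (p div 3) p" by (rule mult_le_mono2)
    then show ?thesis using \<kappa>_less[OF that(2), of i] unfolding W_def by simp
  qed
  \<comment> \<open>The coordinate at \<open>pt p\<close> after the substitution, up to the factor \<open>C p\<close>.\<close>
  define Q :: "nat \<Rightarrow> 'k poly" where "Q p = (\<Sum>i\<le>i0. monom 1 (W i p))" for p
  have Q: "degree (Q p) = W (p div 3) p" "Q p \<noteq> 0" if "p < j" for p
    unfolding Q_def
    by (rule degree_sum_unique_max; use W_less[OF _ that] div_le[OF that] in simp)+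
  define C :: "nat \<Rightarrow> 'k" where "C p = of_nat (d choose fst (pt p)) * of_nat (e choose snd (pt p))"
      for p
  have C: "C p \<noteq> 0" if "p < j" for p using box[OF that] by (simp add: C_def)
  have eval: "secant_param d e k (freeze j (\<lambda>q. x powi w q)) (pt p) = C p * poly (Q p) x"
    if "x \<noteq> 0" "p < j" for x :: 'k and p
  proof -
    have "(\<Prod>q\<in>cell j i. (x powi w q) ^ affine_coord (pt p) (q mod 3)) = x ^ W i p" if i: "i \<le> i0"
        for i
    proof -
      have "(\<Prod>q\<in>cell j i. (x powi w q) ^ affine_coord (pt p) (q mod 3)) =
          (\<Prod>q\<in>cell j i. x powi (w q * int (affine_coord (pt p) (q mod 3))))"
        by (simp add: power_int_mult)
      also have "\<dots> = x ^ W i p"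
        unfolding prod_power_int[OF \<open>x \<noteq> 0\<close>] weight[OF i \<open>p < j\<close>] by simp
      finally show ?thesis .
    qed
    then have "(\<Sum>i\<le>i0. \<Prod>q\<in>cell j i. (x powi w q) ^ affine_coord (pt p) (q mod 3)) = poly (Q p) x"
      unfolding Q_def poly_sum poly_monom by (intro sum.cong) simp_all
    then show ?thesis
      unfolding secant_param_freeze[OF k j] C_def i0_def by (simp only:)
  qed
  define R where "R m = (\<Prod>p<j. Q p ^ m (pt p))" for m
  have R0: "R m \<noteq> 0" for m unfolding R_def using Q(2) by simp
  have degR: "degree (R m) = M * (\<Sum>p<j. m (pt p) * \<alpha> (p div 3) p) + (\<Sum>q<j. exponent pt j (\<lambda>p. m
      (pt p)) q * L ^ q)" for m
  proof -
    have "degree (R m) = (\<Sum>p<j. m (pt p) * W (p div 3) p)"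
      unfolding R_def using Q by (subst degree_prod_eq_sum_degree) (auto simp: degree_power_eq)
    also have "\<dots> = M * (\<Sum>p<j. m (pt p) * \<alpha> (p div 3) p) + (\<Sum>p<j. m (pt p) * \<kappa> (p div 3) p)"
      by (simp add: W_def sum_distrib_left algebra_simps sum.distrib)
    also have "(\<Sum>p<j. m (pt p) * \<kappa> (p div 3) p) =
        (\<Sum>p<j. \<Sum>q<j. if q div 3 = p div 3 then m (pt p) * affine_coord (pt p)
            (q mod 3) * L ^ q else 0)"
      unfolding \<kappa>_def sum_distrib_left
      by (intro sum.cong refl sum.mono_neutral_cong_left) (auto simp: cell_def)
    also have "\<dots> = (\<Sum>q<j. \<Sum>p<j. if q div 3 = p div 3 then m (pt p) * affine_coord (pt p)
        (q mod 3) * L ^ q else 0)"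
      by (rule sum.swap)
    also have "\<dots> = (\<Sum>q<j. exponent pt j (\<lambda>p. m (pt p)) q * L ^ q)"
      unfolding exponent_def sum_distrib_right
      by (intro sum.cong refl sum.mono_neutral_cong_right) (auto simp: cell_def)
    finally show ?thesis .
  qed
  have expo_less: "exponent pt j (\<lambda>p. m (pt p)) q < L" if m: "m \<in> ?D \<rightarrow>\<^sub>E {..T}" for m q
  proof -
    have "m (pt p) * affine_coord (pt p) (q mod 3) \<le> T * (d + e + 1)" if "p \<in> cell j (q div 3)"
        for p
    proof -
      have p: "p < j" using that by (simp add: cell_def)
      then have "m (pt p) \<in> {..T}" using m by (intro PiE_mem[OF m]) simp
      then show ?thesis using coord_le[OF p] by (intro mult_le_mono) simp_all
    qed
    then have "exponent pt j (\<lambda>p. m (pt p)) q \<le> card (cell j (q div 3)) * (T * (d + e + 1))"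
      unfolding exponent_def by (rule order_trans[OF sum_bounded_above]) simp_all
    also have "\<dots> \<le> 3 * (T * (d + e + 1))" by (intro mult_le_mono1 card_cell_le)
    finally show ?thesis unfolding L_def by simp
  qed
  have inj_deg: "inj_on (\<lambda>m. degree (R m)) (?D \<rightarrow>\<^sub>E {..T})"
  proof (rule inj_onI)
    fix m m' assume m: "m \<in> ?D \<rightarrow>\<^sub>E {..T}" "m' \<in> ?D \<rightarrow>\<^sub>E {..T}" and "degree (R m) = degree (R m')"
    then have "degree (R m) mod M = degree (R m') mod M" by simp
    then have "(\<Sum>q<j. exponent pt j (\<lambda>p. m (pt p)) q * L ^ q) = (\<Sum>q<j. exponent pt j (\<lambda>p. m'
        (pt p)) q * L ^ q)"
    proof -
      have "(\<Sum>q<j. exponent pt j (\<lambda>p. m (pt p)) q * L ^ q) < M"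
        "(\<Sum>q<j. exponent pt j (\<lambda>p. m' (pt p)) q * L ^ q) < M"
        unfolding M_def by (intro digit_sum_less expo_less m)+
      then show ?thesis
        using \<open>degree (R m) mod M = degree (R m') mod M\<close> unfolding degR by simp
    qed
    then have "exponent pt j (\<lambda>p. m (pt p)) q = exponent pt j (\<lambda>p. m' (pt p)) q" if "q < j" for q
      by (rule digits_unique[OF expo_less[OF m(1)] expo_less[OF m(2)] _ that])
    then have "m (pt p) = m' (pt p)" if "p < j" for p
      using exponents_determine[OF edge tri, of j "\<lambda>p. m (pt p)" "\<lambda>p. m' (pt p)" p] that by simp
    then show "m = m'" by (intro PiE_ext[OF m]) auto
  qed
  have fin: "finite (?D \<rightarrow>\<^sub>E {..T})" by (simp add: finite_PiE)
  show "lin_indep_on (range (\<lambda>z :: nat \<Rightarrow> 'k. secant_param d e k (freeze j z))) (?D \<rightarrow>\<^sub>E {..T})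
      (\<lambda>m v. \<Prod>b\<in>?D. v b ^ m b)"
    unfolding lin_indep_on_def
  proof (intro allI impI ballI)
    fix c m
    assume 0: "\<forall>v\<in>range (\<lambda>z. secant_param d e k (freeze j z)). (\<Sum>m\<in>?D \<rightarrow>\<^sub>E {..T}. c m *
        (\<Prod>b\<in>?D. v b ^ m b)) = (0 :: 'k)"
      and m: "m \<in> ?D \<rightarrow>\<^sub>E {..T}"
    let ?c = "\<lambda>m. c m * (\<Prod>p<j. C p ^ m (pt p))"
    have "(\<Sum>m\<in>?D \<rightarrow>\<^sub>E {..T}. [:?c m:] * R m) = 0"
    proof (rule poly_eq_0_off_0)
      fix x :: 'k assume x: "x \<noteq> 0"
      let ?v = "secant_param d e k (freeze j (\<lambda>q. x powi w q))"
      have "(\<Prod>b\<in>?D. ?v b ^ m b) = (\<Prod>p<j. C p ^ m (pt p)) * poly (R m) x" for m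
        by (simp add: prod.reindex[OF inj] eval[OF x] R_def poly_prod power_mult_distrib
            prod.distrib)
      then have "poly (\<Sum>m\<in>?D \<rightarrow>\<^sub>E {..T}. [:?c m:] * R m) x = (\<Sum>m\<in>?D \<rightarrow>\<^sub>E {..T}. c m *
          (\<Prod>b\<in>?D. ?v b ^ m b))"
        by (simp add: poly_sum mult.assoc)
      also have "\<dots> = 0" using 0 by blast
      finally show "poly (\<Sum>m\<in>?D \<rightarrow>\<^sub>E {..T}. [:?c m:] * R m) x = 0" .
    qed
    from lin_indep_distinct_degrees[OF fin R0 inj_deg this m] show "c m = 0"
      using C by simp
  qed
qed

section \<open>Cutting a grid into triangles\<close>

definition det3 :: "nat \<times> nat \<Rightarrow> nat \<times> nat \<Rightarrow> nat \<times> nat \<Rightarrow> int" where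
  "det3 a b c = (int (fst b) - int (fst a)) * (int (snd c) - int (snd a)) -
                (int (fst c) - int (fst a)) * (int (snd b) - int (snd a))"

type_synonym tile = "(int \<times> int \<times> int) \<times> (nat \<times> nat) list"

text \<open>A tile is an affine function together with the points of its cell. One tile beats another
  one if its function is the larger one on its own points.\<close>

definition beats :: "tile \<Rightarrow> tile \<Rightarrow> bool" where
  "beats s t \<longleftrightarrow> (\<forall>b\<in>set (snd s). affine (fst t) b < affine (fst s) b)"

definition separated :: "tile list \<Rightarrow> bool" where
  "separated = sorted_wrt (\<lambda>s t. beats s t \<and> beats t s)"

text \<open>The two points that come first must have different first coordinates, because they have to
  be affinely independent already when only the scalar and the first coordinate are free.\<close>

definition triangle :: "(nat \<times> nat) list \<Rightarrow> bool" where
  "triangle ps \<longleftrightarrow> (\<exists>a b c. ps = [a, b, c] \<and> fst a \<noteq> fst b \<and> det3 a b c \<noteq> 0)"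

text \<open>The points of \<open>B\<close> are distributed over triangles; \<open>L\<close> holds further points, which form a
  cell of their own. A function is reserved for that cell even if it is empty.\<close>

definition tiled :: "(nat \<times> nat) set \<Rightarrow> (nat \<times> nat) list \<Rightarrow> bool" where
  "tiled B L \<longleftrightarrow> (\<exists>ts f. separated (ts @ [(f, L)]) \<and> (\<forall>t\<in>set ts. triangle (snd t)) \<and>
     (\<Union>t\<in>set ts. set (snd t)) = B)"

lemma tiled_empty: "tiled {} L"
  unfolding tiled_def separated_def by (intro exI[of _ "[]"]) simp

lemma tiled_triangle:
  assumes "det3 a b c \<noteq> 0"
  shows "tiled {a, b, c} []"
proof -
  have "\<exists>ps. triangle ps \<and> set ps = {a, b, c}"
  proof (cases "fst a = fst b")
    case False
    then show ?thesis using assms unfolding triangle_def by (intro exI[of _ "[a, b, c]"]) auto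
  next
    case True
    moreover from this have "fst a \<noteq> fst c" using assms by (auto simp: det3_def)
    moreover have "det3 a c b = - det3 a b c" by (simp add: det3_def)
    ultimately show ?thesis using assms unfolding triangle_def by (intro exI[of _ "[a, c, b]"]) auto
  qed
  then obtain ps where "triangle ps" "set ps = {a, b, c}" by blast
  then show ?thesis
    unfolding tiled_def separated_def
    by (intro exI[of _ "[((0, 0, 0), ps)]"] exI[of _ "(- 1, 0, 0)"])
        (simp add: beats_def affine_def)
qed

text \<open>Adds a large multiple of \<open>2 g + 1\<close>. On integer points this is negative where \<open>g < 0\<close> and
  positive where \<open>g \<ge> 0\<close>, so no point lies on the cutting line.\<close>

definition tilt :: "int \<Rightarrow> int \<times> int \<times> int \<Rightarrow> int \<times> int \<times> int \<Rightarrow> int \<times> int \<times> int" where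
  "tilt M g f = (case g of (g0, g1, g2) \<Rightarrow> case f of (f0, f1, f2) \<Rightarrow>
     (f0 + M * (2 * g0 + 1), f1 + 2 * M * g1, f2 + 2 * M * g2))"

lemma affine_tilt: "affine (tilt M g f) b = affine f b + M * (2 * affine g b + 1)"
  by (simp add: tilt_def affine_def split_beta algebra_simps)

lemma finite_int_bound: "finite A \<Longrightarrow> \<exists>M::int. \<forall>a\<in>A. a < M"
proof (induction rule: finite_induct)
  case (insert a A)
  then obtain M where "\<forall>a\<in>A. a < M" by blast
  then show ?case by (intro exI[of _ "max M (a + 1)"]) auto
qed simp

text \<open>Tilting all functions on one side of a line by a steep function that vanishes near the
  line makes them win on their side and lose on the other, without changing the comparisons
  among themselves.\<close>

lemma tiled_join:
  assumes 1: "tiled B L" and 2: "tiled B' []"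
    and g: "\<And>b. b \<in> B \<union> set L \<Longrightarrow> affine g b < 0" and g': "\<And>b. b \<in> B' \<Longrightarrow> 0 \<le> affine g b"
  shows "tiled (B \<union> B') L"
proof -
  obtain ts f where ts: "separated (ts @ [(f, L)])" "\<forall>t\<in>set ts. triangle (snd t)"
    "(\<Union>t\<in>set ts. set (snd t)) = B"
    using 1 unfolding tiled_def by blast
  obtain us f' where us: "separated (us @ [(f', [])])" "\<forall>t\<in>set us. triangle (snd t)"
    "(\<Union>t\<in>set us. set (snd t)) = B'"
    using 2 unfolding tiled_def by blast
  let ?ts = "ts @ [(f, L)]"
  let ?A = "(\<lambda>(s, t, b). \<bar>affine (fst s) b - affine (fst t) b\<bar>) ` (set ?ts \<times> set us \<times>
      (B \<union> set L \<union> B'))"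
  have "finite ?A" unfolding ts(3)[symmetric] us(3)[symmetric] by simp
  then obtain M where M: "\<forall>a\<in>?A. a < M" using finite_int_bound by blast
  have bound: "\<bar>affine (fst s) b - affine (fst t) b\<bar> < M"
    if "s \<in> set ?ts" "t \<in> set us" "b \<in> B \<union> set L \<union> B'" for s t b
    using M that by force
  let ?tilt = "\<lambda>t :: tile. (tilt M g (fst t), snd t)"
  have vs: "beats s (?tilt t) \<and> beats (?tilt t) s" if st: "s \<in> set ?ts" "t \<in> set us" for s t
  proof
    show "beats s (?tilt t)"
      unfolding beats_def
    proof
      fix b assume "b \<in> set (snd s)"
      then have b: "b \<in> B \<union> set L" using st(1) ts(3) by auto
      have "affine g b \<le> - 1" using g[OF b] by simp
      then have "(2 * affine g b + 1) \<le> - 1" by simp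
      moreover have "0 \<le> M" using bound[OF st, of b] b by auto
      ultimately have "M * (2 * affine g b + 1) \<le> M * (- 1)" by (intro mult_left_mono)
      then show "affine (fst (?tilt t)) b < affine (fst s) b"
        using bound[OF st UnI1[OF b]] by (simp add: affine_tilt)
    qed
    show "beats (?tilt t) s"
      unfolding beats_def
    proof
      fix b assume "b \<in> set (snd (?tilt t))"
      then have b: "b \<in> B'" using st(2) us(3) by auto
      have "1 \<le> (2 * affine g b + 1)" using g'[OF b] by simp
      moreover have "0 \<le> M" using bound[OF st, of b] b by auto
      ultimately have "M * 1 \<le> M * (2 * affine g b + 1)" by (intro mult_left_mono)
      then show "affine (fst s) b < affine (fst (?tilt t)) b"
        using bound[OF st, of b] b by (simp add: affine_tilt)
    qed
  qed
  have "separated us" using us(1) unfolding separated_def sorted_wrt_append by simp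
  then have "separated (map ?tilt us)"
    unfolding separated_def sorted_wrt_map by (rule sorted_wrt_mono_rel[rotated])
        (simp add: beats_def affine_tilt)
  then have "separated ((map ?tilt us @ ts) @ [(f, L)])"
    using ts(1) vs unfolding separated_def append_assoc sorted_wrt_append[of _ "map ?tilt us"]
        by auto
  moreover have "\<forall>t\<in>set (map ?tilt us @ ts). triangle (snd t)" using ts(2) us(2) by auto
  moreover have "(\<Union>t\<in>set (map ?tilt us @ ts). set (snd t)) = B \<union> B'" using ts(3) us(3) by auto
  ultimately show ?thesis unfolding tiled_def by blast
qed

definition translate :: "nat \<times> nat \<Rightarrow> nat \<times> nat \<Rightarrow> nat \<times> nat" where
  "translate v b = (fst v + fst b, snd v + snd b)"

lemma tiled_translate:
  assumes "tiled B []"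
  shows "tiled (translate v ` B) []"
proof -
  obtain ts f where ts: "separated (ts @ [(f, [])])" "\<forall>t\<in>set ts. triangle (snd t)"
    "(\<Union>t\<in>set ts. set (snd t)) = B"
    using assms unfolding tiled_def by blast
  define h where "h f = (case f of (f0, f1, f2) \<Rightarrow> (f0 - f1 * int (fst v) - f2 * int (snd v), f1,
      f2))"
    for f :: "int \<times> int \<times> int"
  have h: "affine (h f) (translate v b) = affine f b" for f b
    by (simp add: h_def affine_def translate_def split_beta algebra_simps)
  let ?h = "\<lambda>t :: tile. (h (fst t), map (translate v) (snd t))"
  have "separated (map ?h (ts @ [(f, [])]))"
    using ts(1) unfolding separated_def sorted_wrt_map
    by (rule sorted_wrt_mono_rel[rotated]) (simp add: beats_def h)
  then have "separated (map ?h ts @ [(h f, [])])" by simp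
  moreover have "\<forall>t\<in>set (map ?h ts). triangle (snd t)"
  proof
    fix t assume "t \<in> set (map ?h ts)"
    then obtain s where s: "s \<in> set ts" "t = ?h s" by auto
    then obtain a b c where "snd s = [a, b, c]" "fst a \<noteq> fst b" "det3 a b c \<noteq> 0"
      using ts(2) unfolding triangle_def by blast
    then show "triangle (snd t)"
      unfolding triangle_def s(2)
      by (intro exI[of _ "translate v a"] exI[of _ "translate v b"] exI[of _ "translate v c"])
         (simp add: translate_def det3_def)
  qed
  moreover have "(\<Union>t\<in>set (map ?h ts). set (snd t)) = translate v ` B" unfolding ts(3)[symmetric]
      by auto
  ultimately show ?thesis unfolding tiled_def by blast
qed

text \<open>A certificate for a tiling that rewriting can check: each line cuts one triangle off the
  rest.\<close>

fun peels :: "(int \<times> int \<times> int) list \<Rightarrow> (nat \<times> nat) list \<Rightarrow> (nat \<times> nat) list \<Rightarrow> bool" where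
  "peels [] ps L \<longleftrightarrow> ps = L"
| "peels (g # gs) ps L \<longleftrightarrow> (case filter (\<lambda>b. 0 \<le> affine g b) ps of
     [a, b, c] \<Rightarrow> det3 a b c \<noteq> 0 \<and> peels gs (filter (\<lambda>b. affine g b < 0) ps) L
   | _ \<Rightarrow> False)"

lemma tiled_if_peels: "peels gs ps L \<Longrightarrow> \<exists>B. tiled B L \<and> B \<union> set L = set ps"
proof (induction gs ps L rule: peels.induct)
  case (1 ps L)
  then show ?case using tiled_empty by auto
next
  case (2 g gs ps L)
  then obtain a b c where abc: "filter (\<lambda>b. 0 \<le> affine g b) ps = [a, b, c]" "det3 a b c \<noteq> 0"
    "peels gs (filter (\<lambda>b. affine g b < 0) ps) L"
    by (auto split: list.splits)
  obtain B where B: "tiled B L" "B \<union> set L = set (filter (\<lambda>b. affine g b < 0) ps)"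
    using "2.IH"[OF abc(1) refl refl refl abc(3)] by blast
  have C: "{a, b, c} = {b \<in> set ps. 0 \<le> affine g b}"
    using arg_cong[OF abc(1), of set] by auto
  have "tiled (B \<union> {a, b, c}) L"
    by (rule tiled_join[OF B(1) tiled_triangle[OF abc(2)], of g]) (use B(2) C in auto)
  moreover have "B \<union> {a, b, c} \<union> set L = set ps" using B(2) C by auto
  ultimately show ?case by blast
qed

definition grid :: "nat \<Rightarrow> nat \<Rightarrow> (nat \<times> nat) set" where
  "grid a b = {..<a} \<times> {..<b}"

definition tiles_grid :: "nat \<Rightarrow> nat \<Rightarrow> (nat \<times> nat) list \<Rightarrow> bool" where
  "tiles_grid a b L \<longleftrightarrow> (\<exists>B. tiled B L \<and> B \<union> set L = grid a b)"

lemma Un_swap: "A \<union> B \<union> C = A \<union> C \<union> B"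
  by blast

lemma tiled_beside:
  assumes "tiled B L" "B \<union> set L \<subseteq> grid a b" "tiles_grid c b []"
  shows "tiled (B \<union> translate (a, 0) ` grid c b) L"
proof (rule tiled_join[OF assms(1), of _ "(- int a, 1, 0)"])
  show "tiled (translate (a, 0) ` grid c b) []"
    using assms(3) by (intro tiled_translate) (simp add: tiles_grid_def)
qed (use assms(2) in \<open>auto simp: affine_def grid_def translate_def\<close>)

lemma tiles_grid_beside:
  assumes "tiles_grid a b L" "tiles_grid c b []"
  shows "tiles_grid (a + c) b L"
proof -
  obtain B where B: "tiled B L" "B \<union> set L = grid a b" using assms(1) unfolding tiles_grid_def
      by blast
  have "translate (a, 0) ` grid c b = {a..<a + c} \<times> {..<b}"
  proof -
    have "p \<in> translate (a, 0) ` grid c b" if "p \<in> {a..<a + c} \<times> {..<b}" for p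
      using that by (intro image_eqI[of _ _ "(fst p - a, snd p)"])
          (auto simp: translate_def grid_def)
    then show ?thesis by (auto simp: translate_def grid_def)
  qed
  then have "(B \<union> set L) \<union> translate (a, 0) ` grid c b = grid (a + c) b"
    unfolding B(2) by (auto simp: grid_def)
  then have "(B \<union> translate (a, 0) ` grid c b) \<union> set L = grid (a + c) b"
    by (subst Un_swap)
  moreover have "tiled (B \<union> translate (a, 0) ` grid c b) L"
    using B by (intro tiled_beside assms(2)) simp_all
  ultimately show ?thesis
    unfolding tiles_grid_def by (intro exI[of _ "B \<union> translate (a, 0) ` grid c b"] conjI)
qed

lemma tiles_grid_above:
  assumes "tiles_grid a b L" "tiles_grid a c []"
  shows "tiles_grid a (b + c) L"
proof -
  obtain B where B: "tiled B L" "B \<union> set L = grid a b" using assms(1) unfolding tiles_grid_def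
      by blast
  have eq: "translate (0, b) ` grid a c = {..<a} \<times> {b..<b + c}"
  proof -
    have "p \<in> translate (0, b) ` grid a c" if "p \<in> {..<a} \<times> {b..<b + c}" for p
      using that by (intro image_eqI[of _ _ "(fst p, snd p - b)"])
          (auto simp: translate_def grid_def)
    then show ?thesis by (auto simp: translate_def grid_def)
  qed
  have "tiled (B \<union> translate (0, b) ` grid a c) L"
  proof (rule tiled_join[OF B(1), of _ "(- int b, 0, 1)"])
    show "tiled (translate (0, b) ` grid a c) []"
      using assms(2) by (intro tiled_translate) (simp add: tiles_grid_def)
  qed (use B(2)[THEN equalityD1] eq in \<open>auto simp: affine_def grid_def\<close>)
  moreover have "(B \<union> set L) \<union> translate (0, b) ` grid a c = grid a (b + c)"
    unfolding B(2) eq by (auto simp: grid_def)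
  then have "(B \<union> translate (0, b) ` grid a c) \<union> set L = grid a (b + c)"
    by (subst Un_swap)
  ultimately show ?thesis
    unfolding tiles_grid_def by (intro exI[of _ "B \<union> translate (0, b) ` grid a c"] conjI)
qed

lemma tiles_grid_if_peels:
  assumes "peels gs (List.product [0..<a] [0..<b]) L"
  shows "tiles_grid a b L"
  using tiled_if_peels[OF assms] by (simp add: tiles_grid_def grid_def atLeast0LessThan)

text \<open>The cutting lines of the small grids below come from a computer search.\<close>

lemma tiles_grid_3_2: "tiles_grid 3 2 []"
  by (rule tiles_grid_if_peels[of "[(1, - 1, - 1), (0, 0, 1)]"])
      (simp add: affine_def det3_def upt_rec)

lemma tiles_grid_2_3: "tiles_grid 2 3 []"
  by (rule tiles_grid_if_peels[of "[(1, - 1, - 1), (- 1, 0, 1)]"])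
      (simp add: affine_def det3_def upt_rec)

lemma tiles_grid_9_5: "tiles_grid 9 5 []"
  by (rule tiles_grid_if_peels[of "[(1, - 1, - 1), (- 11, 1, 1), (- 7, 1, - 1), (- 3, - 1, 1), (3,
      - 1, - 2),
       (1, - 1, 0), (- 1, - 1, 1), (7, - 2, - 1), (- 13, 1, 2), (- 7, 1, 0),
       (- 5, 1, - 1), (1, 0, - 1), (6, - 1, - 1), (2, - 1, 1), (- 5, 1, 0)]"])
           (simp add: affine_def det3_def upt_rec)

lemma tiles_grid_5_9: "tiles_grid 5 9 []"
  by (rule tiles_grid_if_peels[of "[(1, - 1, - 1), (- 11, 1, 1), (- 3, 1, - 1), (- 7, - 1, 1),
      (- 5, 2, - 1),
       (1, 0, - 1), (3, - 1, - 1), (7, - 1, - 2), (- 13, 2, 1), (- 7, 0, 1),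
       (- 5, - 1, 1), (1, - 1, 0), (6, - 1, - 1), (- 3, - 1, 1), (- 3, 1, 0)]"])
           (simp add: affine_def det3_def upt_rec)

lemma tiles_grid_2_2: "tiles_grid 2 2 [(1, 1)]"
  by (rule tiles_grid_if_peels[of "[(1, - 1, - 1)]"]) (simp add: affine_def det3_def upt_rec)

lemma tiles_grid_4_2: "tiles_grid 4 2 [(1, 1), (2, 0)]"
  by (rule tiles_grid_if_peels[of "[(1, - 1, - 1), (- 3, 1, 1)]"])
      (simp add: affine_def det3_def upt_rec)

lemma tiles_grid_2_4: "tiles_grid 2 4 [(0, 3), (1, 3)]"
  by (rule tiles_grid_if_peels[of "[(1, - 1, - 1), (2, 0, - 1)]"])
      (simp add: affine_def det3_def upt_rec)

lemma tiles_grid_4_4: "tiles_grid 4 4 [(0, 3)]"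
  by (rule tiles_grid_if_peels[of "[(1, - 1, - 1), (- 5, 1, 1), (- 2, 1, - 1), (0, 1, - 1), (2, 1,
      - 1)]"]) (simp add: affine_def det3_def upt_rec)

lemma tiles_grid_5_5: "tiles_grid 5 5 [(0, 2)]"
  by (rule tiles_grid_if_peels[of "[(1, - 1, - 1), (- 7, 1, 1), (- 3, 1, - 1), (- 3, - 1, 1), (1,
      1, - 3),
       (- 3, 1, 0), (- 3, 0, 1), (- 1, 1, 0)]"]) (simp add: affine_def det3_def upt_rec)

lemma tiles_grid_5_7: "tiles_grid 5 7 [(3, 4), (4, 4)]"
  by (rule tiles_grid_if_peels[of "[(1, - 1, - 1), (- 9, 1, 1), (- 3, 1, - 1), (- 5, - 1, 1),
      (- 5, 2, - 1),
       (1, 0, - 1), (3, - 1, - 1), (7, - 1, - 2), (1, - 1, 0), (- 5, 0, 1),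
       (6, - 1, - 1)]"]) (simp add: affine_def det3_def upt_rec)

lemma tiles_grid_7_5: "tiles_grid 7 5 [(5, 2), (6, 2)]"
  by (rule tiles_grid_if_peels[of "[(1, - 1, - 1), (- 9, 1, 1), (- 5, 1, - 1), (- 3, - 1, 1), (3,
      - 1, - 2),
       (1, - 1, 0), (- 1, - 1, 1), (5, - 1, - 2), (3, - 1, 0), (- 3, 0, 1),
       (6, - 1, - 1)]"]) (simp add: affine_def det3_def upt_rec)

lemma tiles_grid_7_7: "tiles_grid 7 7 [(3, 3)]"
  by (rule tiles_grid_if_peels[of "[(1, - 1, - 1), (- 11, 1, 1), (- 5, 1, - 1), (- 5, - 1, 1), (3,
      - 1, - 2),
       (- 15, 2, 1), (- 9, - 1, 2), (- 9, 1, 1), (- 12, 1, 2), (- 3, - 1, 1),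
       (1, - 1, 0), (- 1, - 1, 1), (- 10, 1, 2), (- 8, 2, - 1), (- 2, 1, - 1),
       (2, 0, - 1)]"]) (simp add: affine_def det3_def upt_rec)

lemma tiles_grid_even_3: "0 < m \<Longrightarrow> tiles_grid (2 * m) 3 []"
proof (induction m rule: nat_induct_non_zero)
  case (Suc m)
  then show ?case using tiles_grid_beside[OF Suc.IH tiles_grid_2_3] by (simp add: add.commute)
qed (use tiles_grid_2_3 in simp)

lemma tiles_grid_3_even: "0 < m \<Longrightarrow> tiles_grid 3 (2 * m) []"
proof (induction m rule: nat_induct_non_zero)
  case (Suc m)
  then show ?case using tiles_grid_above[OF Suc.IH tiles_grid_3_2] by (simp add: add.commute)
qed (use tiles_grid_3_2 in simp)

lemma tiles_grid_6: "2 \<le> n \<Longrightarrow> tiles_grid 6 n []"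
proof (induction n rule: less_induct)
  case (less n)
  have 2: "tiles_grid 6 2 []" using tiles_grid_beside[OF tiles_grid_3_2 tiles_grid_3_2] by simp
  consider "n = 2" | "n = 3" | "4 \<le> n" using less.prems by linarith
  then show ?case
  proof cases
    case 1
    then show ?thesis using 2 by simp
  next
    case 2
    then show ?thesis using tiles_grid_even_3[of 3] by simp
  next
    case 3
    then have "tiles_grid 6 (n - 2) []" using less by simp
    moreover have "n - 2 + 2 = n" using 3 by simp
    ultimately show ?thesis using tiles_grid_above[OF _ 2, of "n - 2"] by (simp only:)
  qed
qed

lemma tiles_grid_by_6: "2 \<le> n \<Longrightarrow> tiles_grid n 6 []"
proof (induction n rule: less_induct)
  case (less n)
  have 2: "tiles_grid 2 6 []" using tiles_grid_above[OF tiles_grid_2_3 tiles_grid_2_3] by simp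
  consider "n = 2" | "n = 3" | "4 \<le> n" using less.prems by linarith
  then show ?case
  proof cases
    case 1
    then show ?thesis using 2 by simp
  next
    case 2
    then show ?thesis using tiles_grid_3_even[of 3] by simp
  next
    case 3
    then have "tiles_grid (n - 2) 6 []" using less by simp
    moreover have "n - 2 + 2 = n" using 3 by simp
    ultimately show ?thesis using tiles_grid_beside[OF _ 2, of "n - 2"] by (simp only:)
  qed
qed

definition leftover :: "(nat \<times> nat) list \<Rightarrow> bool" where
  "leftover L \<longleftrightarrow> L = [] \<or> (\<exists>a. L = [a]) \<or> (\<exists>a b. L = [a, b] \<and> fst a \<noteq> fst b)"

definition tileable :: "nat \<Rightarrow> nat \<Rightarrow> bool" where
  "tileable a b \<longleftrightarrow> (\<exists>L. leftover L \<and> tiles_grid a b L)"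

lemma tileableI: "tiles_grid a b L \<Longrightarrow> leftover L \<Longrightarrow> tileable a b"
  unfolding tileable_def by blast

lemma tileable_beside: "tileable a b \<Longrightarrow> tiles_grid c b [] \<Longrightarrow> tileable (a + c) b"
  unfolding tileable_def using tiles_grid_beside by blast

lemma tileable_above: "tileable a b \<Longrightarrow> tiles_grid a c [] \<Longrightarrow> tileable a (b + c)"
  unfolding tileable_def using tiles_grid_above by blast

text \<open>The grids at which the removal of strips of width six ends.\<close>

lemma tileable_small:
  "tileable 2 2" "tileable 2 3" "tileable 2 4" "tileable 2 5" "tileable 2 7"
  "tileable 3 2" "tileable 3 4" "tileable 4 2" "tileable 4 3" "tileable 4 4" "tileable 4 5"
      "tileable 4 7"
  "tileable 5 2" "tileable 5 4" "tileable 5 5" "tileable 5 7" "tileable 7 2" "tileable 7 4"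
      "tileable 7 5"
  "tileable 7 7" "tileable 9 5" "tileable 5 9" "tileable 9 7" "tileable 7 9" "tileable 9 9"
proof -
  note [simp] = leftover_def
  show 22: "tileable 2 2" by (rule tileableI[OF tiles_grid_2_2]) simp
  show "tileable 2 3" by (rule tileableI[OF tiles_grid_2_3]) simp
  show 24: "tileable 2 4" by (rule tileableI[OF tiles_grid_2_4]) simp
  show "tileable 2 5" using tileable_above[OF 22 tiles_grid_2_3] by simp
  show "tileable 2 7" using tileable_above[OF 24 tiles_grid_2_3] by simp
  show "tileable 3 2" by (rule tileableI[OF tiles_grid_3_2]) simp
  have t34: "tiles_grid 3 4 []" using tiles_grid_3_even[of 2] by simp
  have t43: "tiles_grid 4 3 []" using tiles_grid_even_3[of 2] by simp
  show "tileable 3 4" by (rule tileableI[OF t34]) simp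
  show 42: "tileable 4 2" by (rule tileableI[OF tiles_grid_4_2]) simp
  show "tileable 4 3" by (rule tileableI[OF t43]) simp
  show 44: "tileable 4 4" by (rule tileableI[OF tiles_grid_4_4]) simp
  show "tileable 4 5" using tileable_above[OF 42 t43] by simp
  show "tileable 4 7" using tileable_above[OF 44 t43] by simp
  show "tileable 5 2" using tileable_beside[OF 22 tiles_grid_3_2] by simp
  show "tileable 5 4" using tileable_beside[OF 24 t34] by simp
  show "tileable 5 5" by (rule tileableI[OF tiles_grid_5_5]) simp
  show "tileable 5 7" by (rule tileableI[OF tiles_grid_5_7]) simp
  show "tileable 7 2" using tileable_beside[OF 42 tiles_grid_3_2] by simp
  show "tileable 7 4" using tileable_beside[OF 44 t34] by simp
  show "tileable 7 5" by (rule tileableI[OF tiles_grid_7_5]) simp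
  show "tileable 7 7" by (rule tileableI[OF tiles_grid_7_7]) simp
  show 95: "tileable 9 5" by (rule tileableI[OF tiles_grid_9_5]) simp
  show 59: "tileable 5 9" by (rule tileableI[OF tiles_grid_5_9]) simp
  have t62: "tiles_grid 6 2 []" "tiles_grid 2 6 []" by (simp_all add: tiles_grid_6 tiles_grid_by_6)
  have t92: "tiles_grid 9 2 []" "tiles_grid 2 9 []"
    using tiles_grid_beside[OF t62(1) tiles_grid_3_2] tiles_grid_above[OF t62(2) tiles_grid_2_3]
        by simp_all
  show "tileable 9 7" using tileable_above[OF 95 t92(1)] by simp
  show "tileable 7 9" using tileable_beside[OF 59 t92(2)] by simp
  have t94: "tiles_grid 9 4 []" using tiles_grid_above[OF t92(1) t92(1)] by simp
  show "tileable 9 9" using tileable_above[OF 95 t94] by simp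
qed

text \<open>Strips of width six can be removed as long as the rest is again admissible. A side of nine
  points facing an odd side is not reduced to three, which would give an exceptional grid.\<close>

lemma tileable_grid:
  assumes "2 \<le> a" "2 \<le> b" "\<not> (a = 3 \<and> odd b)" "\<not> (b = 3 \<and> odd a)"
  shows "tileable a b"
  using assms
proof (induction "a + b" arbitrary: a b rule: less_induct)
  case less
  consider "8 \<le> a" "\<not> (a = 9 \<and> odd b)" | "8 \<le> b" "\<not> (b = 9 \<and> odd a)"
    | "a = 6" | "b = 6" | "a \<in> {2, 3, 4, 5, 7, 9}" "b \<in> {2, 3, 4, 5, 7, 9}"
      "a = 9 \<longrightarrow> odd b" "b = 9 \<longrightarrow> odd a"
    using less.prems(1,2) by force
  then show ?case
  proof cases
    case 1
    then have "tileable (a - 6) b" using less.prems by (intro less.hyps) auto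
    from tileable_beside[OF this tiles_grid_6] show ?thesis using less.prems(2) 1 by simp
  next
    case 2
    then have "tileable a (b - 6)" using less.prems by (intro less.hyps) auto
    from tileable_above[OF this tiles_grid_by_6] show ?thesis using less.prems(1) 2 by simp
  next
    case 3
    then show ?thesis using tileableI[OF tiles_grid_6[OF less.prems(2)]] by (simp add: leftover_def)
  next
    case 4
    then show ?thesis using tileableI[OF tiles_grid_by_6[OF less.prems(1)]] by
        (simp add: leftover_def)
  next
    case 5
    then show ?thesis using less.prems tileable_small by auto
  qed
qed

text \<open>The exceptional grids consist of a number of complete \<open>2 \<times> 3\<close> blocks and one \<open>3 \<times> 3\<close>
  block, which splits into two triangles and a row. The three points of the row are not affinely
  independent, and one of them has to be left out.\<close>

lemma tiled_odd_by_3: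
  assumes "odd a" "3 \<le> a"
  shows "\<exists>B L. tiled B L \<and> leftover L \<and> B \<union> set L = grid a 3 - {(2, 2)}"
proof -
  let ?L = "[(0, 2), (1, 2)]"
  let ?B = "translate (3, 0) ` grid (a - 3) 3"
  have "\<exists>B. tiled B ?L \<and> B \<union> set ?L = set [(0,0), (1,0), (2,0), (0,1), (1,1), (2,1), (0,2), (1,2)]"
    by (rule tiled_if_peels[of "[(1, - 1, - 1), (1, 0, - 1)]"])
       (simp add: affine_def det3_def)
  then obtain B where B: "tiled B ?L"
    "B \<union> set ?L = set [(0,0), (1,0), (2,0), (0,1), (1,1), (2,1), (0,2), (1,2)]" by blast
  have L: "leftover ?L" by (simp add: leftover_def)
  have B': "B \<union> set ?L = grid 3 3 - {(2, 2)}"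
  proof -
    have "grid 3 3 = set (List.product [0..<3] [0..<3])" by (simp add: grid_def atLeast0LessThan)
    also have "\<dots> - {(2, 2)} = set (filter (\<lambda>p. p \<noteq> (2, 2)) (List.product [0..<3] [0..<3]))" by auto
    also have "\<dots> = set [(0,0), (0,1), (0,2), (1,0), (1,1), (1,2), (2,0), (2,1)]" by
        (simp add: upt_rec numeral_2_eq_2)
    also have "\<dots> = set [(0,0), (1,0), (2,0), (0,1), (1,1), (2,1), (0,2), (1,2)]"
      by (simp only: list.set insert_commute)
    finally show ?thesis unfolding B(2) by (rule sym)
  qed
  show ?thesis
  proof (cases "a = 3")
    case True
    then show ?thesis using B(1) B' L by blast
  next
    case False
    then have "even (a - 3)" "0 < a - 3" using assms by simp_all
    then obtain m where m: "a - 3 = 2 * m" "0 < m" by (elim evenE) simp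
    have "tiles_grid (a - 3) 3 []" unfolding m(1) by (rule tiles_grid_even_3[OF m(2)])
    then have "tiled (B \<union> ?B) ?L"
      using B(1) B' by (intro tiled_beside) auto
    moreover have "?B = {3..<a} \<times> {..<3}"
    proof -
      have "p \<in> ?B" if "p \<in> {3..<a} \<times> {..<3}" for p
        using that by (intro image_eqI[of _ _ "(fst p - 3, snd p)"])
            (auto simp: translate_def grid_def)
      then show ?thesis using assms(2) by (auto simp: translate_def grid_def)
    qed
    then have "(B \<union> set ?L) \<union> ?B = grid a 3 - {(2, 2)}"
      unfolding B' using assms(2) by (auto simp: grid_def)
    then have "(B \<union> ?B) \<union> set ?L = grid a 3 - {(2, 2)}" by (subst Un_swap)
    ultimately show ?thesis using L by (intro exI[of _ "B \<union> ?B"] exI[of _ ?L] conjI)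
  qed
qed

text \<open>The combinatorial data in the form that the independence criterion needs: the \<open>N\<close> points
  are numbered so that the points of the \<open>i\<close>-th cell have the numbers \<open>3i\<close>, \<open>3i + 1\<close>, \<open>3i + 2\<close>.
  Only the last cell may be incomplete.\<close>

definition triangulation :: "nat \<Rightarrow> (nat \<Rightarrow> nat \<times> nat) \<Rightarrow> (nat \<Rightarrow> int \<times> int \<times> int) \<Rightarrow> bool" where
  "triangulation N pt f \<longleftrightarrow> inj_on pt {..<N} \<and>
     (\<forall>p<N. \<forall>i\<le>(N - 1) div 3. i \<noteq> p div 3 \<longrightarrow> affine (f i) (pt p) < affine (f (p div 3)) (pt p)) \<and>
     (\<forall>i. 3 * i + 1 < N \<longrightarrow> fst (pt (3 * i)) \<noteq> fst (pt (3 * i + 1))) \<and>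
     (\<forall>i. 3 * i + 2 < N \<longrightarrow> det3 (pt (3 * i)) (pt (3 * i + 1)) (pt (3 * i + 2)) \<noteq> 0)"

lemma triangulation_of_tiled:
  assumes "tiled B L" "leftover L"
  shows "\<exists>pt f. triangulation (card (B \<union> set L)) pt f \<and> pt ` {..<card (B \<union> set L)} = B \<union> set L"
proof -
  obtain ts f where ts: "separated (ts @ [(f, L)])" "\<forall>t\<in>set ts. triangle (snd t)"
    "(\<Union>t\<in>set ts. set (snd t)) = B"
    using assms(1) unfolding tiled_def by blast
  define us where "us = ts @ [(f, L)]"
  define n where "n = length ts"
  define N where "N = 3 * n + length L"
  define pt where "pt p = snd (us ! (p div 3)) ! (p mod 3)" for p
  have full: "triangle (snd (us ! i))" if "i < n" for i
    using ts(2) that unfolding us_def n_def by (simp add: nth_append)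
  have last: "snd (us ! n) = L" unfolding us_def n_def by simp
  have len: "length (snd (us ! i)) = 3" if "i < n" for i
    using full[OF that] unfolding triangle_def by auto
  have len_us: "length us = Suc n" unfolding us_def n_def by simp
  have L3: "length L < 3" using assms(2) unfolding leftover_def by auto
  have div: "p div 3 \<le> n" "p mod 3 < length (snd (us ! (p div 3)))" if "p < N" for p
  proof -
    show *: "p div 3 \<le> n" using that L3 unfolding N_def by simp
    show "p mod 3 < length (snd (us ! (p div 3)))"
    proof (cases "p div 3 < n")
      case False
      then have "p div 3 = n" using * by simp
      then have "p = 3 * n + p mod 3" using mult_div_mod_eq[of 3 p] by simp
      then show ?thesis using that \<open>p div 3 = n\<close> last unfolding N_def by simp
    qed (simp add: len)
  qed
  have mem: "pt p \<in> set (snd (us ! (p div 3)))" if "p < N" for p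
    unfolding pt_def using div(2)[OF that] by simp
  have beats: "beats (us ! i) (us ! l)" if "i \<le> n" "l \<le> n" "i \<noteq> l" for i l
    using ts(1) that len_us unfolding separated_def us_def[symmetric] sorted_wrt_iff_nth_less
    by (cases "i < l") auto
  have win: "affine (fst (us ! i)) (pt p) < affine (fst (us ! (p div 3))) (pt p)"
    if "p < N" "i \<le> n" "i \<noteq> p div 3" for p i
    using beats[OF div(1)[OF that(1)] that(2)] that(3) mem[OF that(1)] unfolding beats_def by auto
  have dist: "distinct (snd (us ! i))" if "i \<le> n" for i
  proof (cases "i = n")
    case True
    then show ?thesis using assms(2) last unfolding leftover_def by auto
  next
    case False
    then show ?thesis using full[of i] that unfolding triangle_def by (auto simp: det3_def)
  qed
  have inj: "inj_on pt {..<N}"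
  proof (rule inj_onI)
    fix p q assume p: "p \<in> {..<N}" "q \<in> {..<N}" "pt p = pt q"
    have "p div 3 = q div 3"
      using win[of p "q div 3"] win[of q "p div 3"] div(1)[of p] div(1)[of q] p by (cases "p div 3
          = q div 3") auto
    moreover from this have "p mod 3 = q mod 3"
      using p(3) div(2)[of p] div(2)[of q] dist[OF div(1), of p] p(1,2) unfolding pt_def
      by (simp add: nth_eq_iff_index_eq)
    ultimately show "p = q" by (metis mult_div_mod_eq)
  qed
  have pt_nth: "pt (3 * i + c) = snd (us ! i) ! c" if "c < 3" for i c
    using that unfolding pt_def by simp
  have us_sets: "(\<Union>i\<le>n. set (snd (us ! i))) = B \<union> set L"
  proof -
    have "(\<Union>i\<le>n. set (snd (us ! i))) = (\<Union>t\<in>set us. set (snd t))"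
      unfolding set_conv_nth[of us] len_us by (auto simp: less_Suc_eq_le)
    then show ?thesis unfolding us_def using ts(3) by auto
  qed
  have image: "pt ` {..<N} = B \<union> set L"
  proof
    show "pt ` {..<N} \<subseteq> B \<union> set L" using mem div(1) unfolding us_sets[symmetric] by fastforce
    show "B \<union> set L \<subseteq> pt ` {..<N}"
    proof
      fix b assume "b \<in> B \<union> set L"
      then obtain i where i: "i \<le> n" "b \<in> set (snd (us ! i))" unfolding us_sets[symmetric] by blast
      then obtain c where c: "c < length (snd (us ! i))" "b = snd (us ! i) ! c" by
          (auto simp: in_set_conv_nth)
      have "c < 3 \<and> 3 * i + c < N"
      proof (cases "i = n")
        case True
        then show ?thesis using c(1) last L3 unfolding N_def by simp
      next
        case False
        then show ?thesis using c(1) len[of i] i(1) unfolding N_def by simp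
      qed
      then show "b \<in> pt ` {..<N}" using c(2) pt_nth[of c i] by (intro image_eqI[of _ _ "3 * i
          + c"]) auto
    qed
  qed
  have N: "card (B \<union> set L) = N" unfolding image[symmetric] using inj by (simp add: card_image)
  have shape: "fst (pt (3 * i)) \<noteq> fst (pt (3 * i + 1))" if "3 * i + 1 < N" for i
  proof (cases "i < n")
    case True
    then show ?thesis using full[of i] pt_nth[of 0 i] pt_nth[of 1 i] unfolding triangle_def by auto
  next
    case False
    then have "i = n" "2 \<le> length L" using that L3 unfolding N_def by auto
    then show ?thesis using assms(2) last pt_nth[of 0 i] pt_nth[of 1 i] unfolding leftover_def
        by auto
  qed
  have tri: "det3 (pt (3 * i)) (pt (3 * i + 1)) (pt (3 * i + 2)) \<noteq> 0" if "3 * i + 2 < N" for i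
  proof -
    have "i < n" using that L3 unfolding N_def by auto
    then show ?thesis using full[of i] pt_nth[of 0 i] pt_nth[of 1 i] pt_nth[of 2 i]
        unfolding triangle_def by auto
  qed
  have "(N - 1) div 3 \<le> n" using L3 unfolding N_def by auto
  then have "triangulation N pt (\<lambda>i. fst (us ! i))"
    unfolding triangulation_def using inj win shape tri by auto
  then show ?thesis using image N by auto
qed

lemma triangulation_mono:
  assumes "triangulation N pt f" "j \<le> N"
  shows "triangulation j pt f"
proof -
  have "(j - 1) div 3 \<le> (N - 1) div 3" using assms(2) by (intro div_le_mono diff_le_mono)
  moreover have "{..<j} \<subseteq> {..<N}" using assms(2) by auto
  ultimately show ?thesis
    using assms unfolding triangulation_def by (auto intro: inj_on_subset elim: order_trans)
qed

lemma coords_alg_indep_triangulation: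
  assumes "triangulation j pt f" "pt ` {..<j} \<subseteq> {..d} \<times> {..e}" "j \<le> 3 * k" "0 < j"
  shows "coords_alg_indep (range (\<lambda>z :: nat \<Rightarrow> 'k::field_char_0. secant_param d e k (freeze j z)))
      (pt ` {..<j})"
proof (rule coords_alg_indep_cells[OF assms(3,4), of _ _ _ f])
  show "fst (pt p) \<le> d \<and> snd (pt p) \<le> e" if "p < j" for p
    using assms(2) that by (auto simp: image_subset_iff mem_Times_iff)
qed (use assms(1) in \<open>simp_all add: triangulation_def det3_def\<close>)

section \<open>Secants of the Segre--Veronese surface\<close>

abbreviation sv_point :: "nat \<Rightarrow> nat \<Rightarrow> (nat \<Rightarrow> 'k::field) \<Rightarrow> (nat \<Rightarrow> 'k) \<Rightarrow> nat \<times> nat \<Rightarrow> 'k" where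
  "sv_point d e u w \<equiv> tensor (sym_power d u) (sym_power e w)"

definition sv_surface :: "nat \<Rightarrow> nat \<Rightarrow> (nat \<times> nat \<Rightarrow> 'k::field) set set" where
  "sv_surface d e = segre_veronese d e ` (proj_line \<times> proj_line)"

definition affine_point :: "'k::field \<Rightarrow> nat \<Rightarrow> 'k" where
  "affine_point x i = (if i = 0 then 1 else if i = 1 then x else 0)"

lemma sv_chart_eq: "sv_chart d e x y = sv_point d e (affine_point x) (affine_point y)"
  by (simp add: fun_eq_iff sv_chart_def tensor_def sym_power_def affine_point_def)

lemma sv_surface_eq:
  "sv_surface d e = {fun_vs.span {sv_point d e u w} | u w :: nat \<Rightarrow> 'k::field.
     u \<in> coord_space {..1} \<and> u \<noteq> 0 \<and> w \<in> coord_space {..1} \<and> w \<noteq> 0}"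
proof -
  have "sv_surface d e = {segre_veronese d e (fun_vs.span {u}, fun_vs.span {w}) | u w :: nat \<Rightarrow> 'k.
     u \<in> coord_space {..1} \<and> u \<noteq> 0 \<and> w \<in> coord_space {..1} \<and> w \<noteq> 0}"
    unfolding sv_surface_def proj_line_def proj_space_def by fast
  then show ?thesis unfolding segre_veronese_span .
qed

lemma affine_point_nonzero: "affine_point x \<noteq> 0"
  by (auto simp: fun_eq_iff affine_point_def)

lemma chart_in_surface: "fun_vs.span {sv_chart d e x y} \<in> sv_surface d e"
proof -
  have "affine_point z \<in> coord_space {..1}" for z :: 'a
    by (simp add: coord_space_def affine_point_def)
  then show ?thesis unfolding sv_surface_eq sv_chart_eq using affine_point_nonzero by blast
qed

lemma subspace_sv_space: "fun_vs.subspace (sv_space d e)"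
  unfolding fun_vs.subspace_def sv_space_def coord_space_def by (simp add: fscale_def)

lemma sv_point_in_sv_space: "sv_point d e u w \<in> sv_space d e"
proof -
  have "sv_point d e u w (i, j) = 0" if "\<not> (i \<le> d \<and> j \<le> e)" for i j
    using that by (auto simp: tensor_def sym_power_def binomial_eq_0)
  then show ?thesis unfolding sv_space_def coord_space_def by auto
qed

lemma surface_vectors_in_sv_space:
  assumes "Q \<in> sv_surface d e"
  shows "Q \<subseteq> sv_space d e"
proof -
  obtain u w where "Q = fun_vs.span {sv_point d e u w}" using assms unfolding sv_surface_eq by blast
  then show ?thesis
    using fun_vs.span_minimal[OF _ subspace_sv_space[of d e], of "{sv_point d e u w}"]
      sv_point_in_sv_space[of d u e w] by simp
qed

lemma infinite_sv_surface:
  assumes "1 \<le> d"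
  shows "infinite (sv_surface d e :: (nat \<times> nat \<Rightarrow> 'k::field_char_0) set set)"
proof -
  let ?Q = "\<lambda>x :: 'k. fun_vs.span {sv_chart d e x 0}"
  have "inj ?Q"
  proof (rule injI)
    fix x y assume "?Q x = ?Q y"
    then have "sv_chart d e x 0 \<in> ?Q y" using fun_vs.span_base[of "sv_chart d e x 0" "{sv_chart d
        e x 0}"] by simp
    then obtain c where c: "sv_chart d e x 0 = fscale c (sv_chart d e y 0)"
      unfolding fun_vs.span_singleton by blast
    from fun_cong[OF c, of "(0, 0)"] have "c = 1" by (simp add: sv_chart_def fscale_def)
    with fun_cong[OF c, of "(1, 0)"] show "x = y" using assms by (simp add: sv_chart_def fscale_def)
  qed
  then have "infinite (range ?Q)" by (simp add: finite_image_iff infinite_UNIV_char_0)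
  moreover have "range ?Q \<subseteq> sv_surface d e" using chart_in_surface by blast
  ultimately show ?thesis using finite_subset by blast
qed

text \<open>The union whose closure is the secant variety of the surface.\<close>

definition secant_span :: "nat \<Rightarrow> nat \<Rightarrow> nat \<Rightarrow> (nat \<times> nat \<Rightarrow> 'k::field) set set" where
  "secant_span d e k = (\<Union>S \<in> {S. S \<subseteq> sv_surface d e \<and> finite S \<and> card S = k}. proj_space
      (fun_vs.span (\<Union>S)))"

lemma secant_variety_eq:
  "secant_variety (sv_space d e) (sv_surface d e) k = zariski
      (sv_space d e) closure_of secant_span d e k"
  unfolding secant_variety_def secant_span_def ..

lemma secant_span_subset: "secant_span d e k \<subseteq> proj_space (sv_space d e)"
proof
  fix P assume "P \<in> secant_span d e k"
  then obtain S v where S: "S \<subseteq> sv_surface d e" "P = fun_vs.span {v}" "v \<in> fun_vs.span (\<Union>S)" "v \<noteq> 0"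
    unfolding secant_span_def proj_space_def by blast
  have "\<Union>S \<subseteq> sv_space d e" using S(1) surface_vectors_in_sv_space by blast
  then have "v \<in> sv_space d e" using S(3) fun_vs.span_minimal[OF _ subspace_sv_space] by blast
  then show "P \<in> proj_space (sv_space d e)" using S unfolding proj_space_def by blast
qed

lemma secant_span_vector:
  fixes v :: "nat \<times> nat \<Rightarrow> 'k::field"
  assumes S: "S \<subseteq> sv_surface d e" "finite S" "card S = k" and v: "v \<in> fun_vs.span (\<Union>S)"
  obtains c u w where "v = (\<lambda>b. \<Sum>i<k. c i * sv_point d e (u i) (w i) b)"
proof -
  obtain h where h: "bij_betw h {..<k} S"
    using ex_bij_betw_nat_finite[OF S(2)] S(3) by (auto simp: atLeast0LessThan)
  then have "\<forall>i\<in>{..<k}. \<exists>u w. h i = fun_vs.span {sv_point d e u w}"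
    using S(1) unfolding sv_surface_eq bij_betw_def by blast
  then obtain u w where uw: "\<And>i. i < k \<Longrightarrow> h i = fun_vs.span {sv_point d e (u i) (w i)}"
    by (metis lessThan_iff)
  define L where "L = {v. \<exists>c. v = (\<lambda>b. \<Sum>i<k. c i * sv_point d e (u i) (w i) b)}"
  have "fun_vs.subspace L"
    unfolding fun_vs.subspace_def
  proof (intro conjI ballI allI)
    show "0 \<in> L" unfolding L_def by (intro CollectI exI[of _ "\<lambda>_. 0"]) (simp add: fun_eq_iff)
  next
    fix x y assume "x \<in> L" "y \<in> L"
    then obtain c c' where "x = (\<lambda>b. \<Sum>i<k. c i * sv_point d e (u i) (w i) b)"
      "y = (\<lambda>b. \<Sum>i<k. c' i * sv_point d e (u i) (w i) b)" unfolding L_def by blast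
    then have "x + y = (\<lambda>b. \<Sum>i<k. (c i + c' i) * sv_point d e (u i) (w i) b)"
      by (simp add: fun_eq_iff sum.distrib distrib_right)
    then show "x + y \<in> L" unfolding L_def by (intro CollectI exI[of _ "\<lambda>i. c i + c' i"])
  next
    fix a x assume "x \<in> L"
    then obtain c where "x = (\<lambda>b. \<Sum>i<k. c i * sv_point d e (u i) (w i) b)" unfolding L_def by blast
    then have "fscale a x = (\<lambda>b. \<Sum>i<k. (a * c i) * sv_point d e (u i) (w i) b)"
      by (simp add: fun_eq_iff fscale_def sum_distrib_left mult.assoc)
    then show "fscale a x \<in> L" unfolding L_def by (intro CollectI exI[of _ "\<lambda>i. a * c i"])
  qed
  moreover have "\<Union>S \<subseteq> L"
  proof
    fix x assume "x \<in> \<Union>S"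
    then obtain Q where "Q \<in> S" "x \<in> Q" by blast
    then obtain i where i: "i < k" "x \<in> h i" using h unfolding bij_betw_def by blast
    then have "x \<in> fun_vs.span {sv_point d e (u i) (w i)}" using uw by simp
    then obtain a where "x = fscale a (sv_point d e (u i) (w i))"
      unfolding fun_vs.span_singleton by blast
    moreover have "(\<Sum>l<k. (if l = i then a else 0) * sv_point d e (u l) (w l) b) =
        a * sv_point d e (u i) (w i) b" for b
    proof -
      have "(\<Sum>l<k. (if l = i then a else 0) * sv_point d e (u l) (w l) b) =
          (\<Sum>l<k. if l = i then a * sv_point d e (u i) (w i) b else 0)"
        by (intro sum.cong) auto
      then show ?thesis using i(1) by simp
    qed
    ultimately have "x = (\<lambda>b. \<Sum>l<k. (if l = i then a else 0) * sv_point d e (u l) (w l) b)"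
      by (simp add: fun_eq_iff fscale_def)
    then show "x \<in> L" unfolding L_def by (intro CollectI exI[of _ "\<lambda>l. if l = i then a else 0"])
  qed
  ultimately have "v \<in> L" using v fun_vs.span_minimal by blast
  then show ?thesis using that unfolding L_def by blast
qed

text \<open>The affine charts are dense: replacing the homogeneous coordinates \<open>u\<^sub>0, w\<^sub>0\<close> of all
  points by \<open>u\<^sub>0 + x, w\<^sub>0 + x\<close> moves every point into the chart, except for finitely many \<open>x\<close>,
  and the value of \<open>f\<close> is a polynomial in \<open>x\<close>.\<close>

lemma form_vanishes_on_sum_of_points:
  fixes f :: "(nat \<times> nat \<Rightarrow> 'k::field_char_0) \<Rightarrow> 'k"
  assumes f: "hom_form m f" and 0: "\<And>z. f (secant_param d e k z) = 0"
  shows "f (\<lambda>b. \<Sum>i<k. c i * sv_point d e (u i) (w i) b) = 0"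
proof -
  define \<gamma> where "\<gamma> x = (\<lambda>b. \<Sum>i<k. c i * sv_point d e ((u i)(0 := u i 0 + x)) ((w i)(0 := w i 0
      + x)) b)" for x
  have "\<exists>q. \<forall>x. \<gamma> x b = poly q x" for b
    unfolding \<gamma>_def
    by (intro exI[of _ "\<Sum>i<k. [:c i * of_nat (d choose fst b) * u i 1 ^ fst b * of_nat
        (e choose snd b) * w i 1 ^ snd b:] *
          ([:u i 0, 1:] ^ (d - fst b) * [:w i 0, 1:] ^ (e - snd b))"] allI)
       (simp add: poly_sum tensor_def sym_power_def split_beta mult_ac)
  from hom_form_poly[of m f \<gamma>, OF f this] obtain q where q: "\<And>x. f (\<gamma> x) = poly q x" by blast
  have good: "poly q x = 0" if x: "\<And>i. i < k \<Longrightarrow> u i 0 + x \<noteq> 0 \<and> w i 0 + x \<noteq> 0" for x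
  proof -
    define z where "z p = (let i = p div 3 in
        if p mod 3 = 0 then c i * (u i 0 + x) ^ d * (w i 0 + x) ^ e
        else if p mod 3 = 1 then u i 1 / (u i 0 + x) else w i 1 / (w i 0 + x))" for p
    have mod3: "Suc (3 * i) mod 3 = 1" "Suc (Suc (3 * i)) mod 3 = 2" "Suc (3 * i) div 3 = i" "Suc
        (Suc (3 * i)) div 3 = i" for i
      by presburger+
    have z: "z (3 * i) = c i * (u i 0 + x) ^ d * (w i 0 + x) ^ e" "z (3 * i + 1) = u i 1 / (u i 0
        + x)"
      "z (3 * i + 2) = w i 1 / (w i 0 + x)" for i
      by (simp_all add: z_def mod3)
    have pow: "of_nat (n choose l) * a ^ (n - l) * b ^ l = of_nat (n choose l) * a ^ n *
        (b / a) ^ l"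
      if "a \<noteq> 0" for a b :: 'k and n l
    proof (cases "l \<le> n")
      case True
      then show ?thesis using that by (simp add: power_divide power_diff)
    qed (simp add: binomial_eq_0)
    have "\<gamma> x b = secant_param d e k z b" for b
      unfolding \<gamma>_def secant_param_def
    proof (intro sum.cong refl)
      fix i assume "i \<in> {..<k}"
      then have "u i 0 + x \<noteq> 0" "w i 0 + x \<noteq> 0" using x by auto
      then show "c i * sv_point d e ((u i)(0 := u i 0 + x)) ((w i)(0 := w i 0 + x)) b =
          z (3 * i) * sv_chart d e (z (3 * i + 1)) (z (3 * i + 2)) b"
        unfolding z by (simp add: tensor_def sym_power_def sv_chart_def split_beta pow)
    qed
    then have "\<gamma> x = secant_param d e k z" by (simp add: fun_eq_iff)
    then show ?thesis using q[of x] 0[of z] by simp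
  qed
  have "q = 0"
  proof (rule ccontr)
    assume "q \<noteq> 0"
    let ?bad = "(\<lambda>i. - u i 0) ` {..<k} \<union> (\<lambda>i. - w i 0) ` {..<k}"
    have "x \<in> {x. poly q x = 0} \<union> ?bad" for x
    proof (cases "\<forall>i<k. u i 0 + x \<noteq> 0 \<and> w i 0 + x \<noteq> 0")
      case False
      then show ?thesis by (auto simp: eq_neg_iff_add_eq_0 image_iff add.commute)
    qed (use good in blast)
    then have "UNIV = {x. poly q x = 0} \<union> ?bad" by blast
    moreover have "finite ({x. poly q x = 0} \<union> ?bad)" using poly_roots_finite[OF \<open>q \<noteq> 0\<close>] by simp
    ultimately show False using infinite_UNIV_char_0[where 'a = 'k] by simp
  qed
  moreover have "\<gamma> 0 = (\<lambda>b. \<Sum>i<k. c i * sv_point d e (u i) (w i) b)"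
    by (simp add: \<gamma>_def)
  ultimately show ?thesis using q[of 0] by simp
qed

lemma closedin_zero_locus_form: "hom_form m f \<Longrightarrow> closedin (zariski V) (zero_locus V {f})"
  unfolding closedin_zariski zariski_closed_def by (intro exI[of _ "{f}"]) auto

lemma form_vanishes_on_secant_variety:
  fixes f :: "(nat \<times> nat \<Rightarrow> 'k::field_char_0) \<Rightarrow> 'k"
  assumes f: "hom_form m f" and 0: "\<And>z. f (secant_param d e k z) = 0"
    and v: "v \<in> \<Union>(secant_variety (sv_space d e) (sv_surface d e) k)"
  shows "f v = 0"
proof -
  have "secant_span d e k \<subseteq> zero_locus (sv_space d e) {f}"
  proof
    fix P :: "(nat \<times> nat \<Rightarrow> 'k) set" assume P: "P \<in> secant_span d e k"
    then obtain S v where S: "S \<subseteq> sv_surface d e" "finite S" "card S = k" and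
      v: "P = fun_vs.span {v}" "v \<in> fun_vs.span (\<Union>S)"
      unfolding secant_span_def proj_space_def by blast
    obtain c u w where cuw: "v = (\<lambda>b. \<Sum>i<k. c i * sv_point d e (u i) (w i) b)"
      using secant_span_vector[OF S v(2)] by blast
    have "f v = 0" unfolding cuw by (rule form_vanishes_on_sum_of_points[OF f 0])
    then have "f x = 0" if "x \<in> P" for x
      using that unfolding v(1) fun_vs.span_singleton by (auto simp: hom_form_scale[OF f])
    then show "P \<in> zero_locus (sv_space d e) {f}"
      using P secant_span_subset unfolding zero_locus_def by blast
  qed
  then have "secant_variety (sv_space d e) (sv_surface d e) k \<subseteq> zero_locus (sv_space d e) {f}"
    unfolding secant_variety_eq using closedin_zero_locus_form[OF f] by (rule closure_of_minimal)
  then show ?thesis using v unfolding zero_locus_def by auto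
qed

lemma poly_fun_secant_param:
  "(\<lambda>z. secant_param d e k (freeze j z) b) \<in> (poly_fun {..<j} (1 + d + e) ::
      ((nat \<Rightarrow> 'k::field) \<Rightarrow> 'k) set)"
proof -
  have fr: "(\<lambda>z. freeze j z p) \<in> (poly_fun {..<j} 1 :: ((nat \<Rightarrow> 'k) \<Rightarrow> 'k) set)" for p
  proof (cases "p < j")
    case True
    then show ?thesis using poly_fun_coord[of "{..<j}" p] by (simp add: freeze_def)
  next
    case False
    then show ?thesis by (cases "p mod 3 = 0") (simp_all add: freeze_def poly_fun_const)
  qed
  show ?thesis
  proof (cases "fst b \<le> d \<and> snd b \<le> e")
    case True
    have "(\<lambda>z :: nat \<Rightarrow> 'k. freeze j z (3 * i) * (of_nat (d choose fst b) * of_nat (e choose snd b) *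
        freeze j z (3 * i + 1) ^ fst b * freeze j z (3 * i + 2) ^ snd b))
        \<in> poly_fun {..<j} (1 + (0 + fst b * 1 + snd b * 1))" for i
      by (intro poly_fun_mult fr poly_fun_power poly_fun_const)
    then have "(\<lambda>z :: nat \<Rightarrow> 'k. freeze j z (3 * i) * (of_nat (d choose fst b) * of_nat
        (e choose snd b) *
        freeze j z (3 * i + 1) ^ fst b * freeze j z (3 * i + 2) ^ snd b)) \<in> poly_fun {..<j} (1 + d
            + e)" for i
      by (rule subsetD[OF poly_fun_mono, rotated]) (use True in auto)
    then show ?thesis
      unfolding secant_param_def sv_chart_def split_beta by (intro poly_fun_sum)
  next
    case False
    then have "sv_chart d e x y b = 0" for x y :: 'k
      by (auto simp: sv_chart_def split_beta binomial_eq_0)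
    then show ?thesis unfolding secant_param_def using poly_fun_const by simp
  qed
qed

lemma cone_secant_param: "cone (range (\<lambda>z :: nat \<Rightarrow> 'a::field. secant_param d e k (freeze j z)))"
  unfolding cone_def
proof (intro allI ballI)
  fix c :: 'a and v :: "nat \<times> nat \<Rightarrow> 'a" assume "v \<in> range (\<lambda>z. secant_param d e k (freeze j z))"
  then obtain z :: "nat \<Rightarrow> 'a" where z: "v = secant_param d e k (freeze j z)" by blast
  define z' where "z' p = (if p mod 3 = 0 then c * z p else z p)" for p
  have mod3: "Suc (3 * i) mod 3 = 1" "Suc (Suc (3 * i)) mod 3 = 2" for i :: nat by presburger+
  have "fscale c v = secant_param d e k (freeze j z')"
    unfolding z secant_param_def fscale_def sum_distrib_left
    by (intro ext sum.cong refl) (simp add: freeze_def z'_def mod3 mult.assoc)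
  then show "fscale c v \<in> range (\<lambda>z. secant_param d e k (freeze j z))" by blast
qed

lemma secant_param_in_sv_space: "secant_param d e k z \<in> sv_space d e"
proof -
  have "sv_chart d e x y b = 0" if "b \<notin> {..d} \<times> {..e}" for x y :: 'a and b
    using that by (cases b) (auto simp: sv_chart_def binomial_eq_0)
  then show ?thesis unfolding sv_space_def coord_space_def secant_param_def by simp
qed

lemma secant_param_freeze_full: "secant_param d e k (freeze (3 * k) z) = secant_param d e k z"
  unfolding secant_param_def by (intro ext sum.cong refl) (simp add: freeze_def)

lemma proj_dim_secant_variety_le:
  "proj_dim (sv_space d e) (secant_variety (sv_space d e) (sv_surface d e ::
      (nat \<times> nat \<Rightarrow> 'k::field_char_0) set set) k)
     \<le> enat (3 * k - 1)"
proof -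
  have "proj_dim (sv_space d e) (secant_variety (sv_space d e) (sv_surface d e ::
      (nat \<times> nat \<Rightarrow> 'k) set set) k)
     \<le> enat (card {..<3 * k} - 1)"
  proof (rule proj_dim_le_parameters[OF _ poly_fun_secant_param cone_secant_param])
    fix m f and v :: "nat \<times> nat \<Rightarrow> 'k" assume f: "hom_form m f" and v: "v \<in> \<Union>(secant_variety
        (sv_space d e) (sv_surface d e) k)"
      and 0: "\<forall>w\<in>range (\<lambda>z :: nat \<Rightarrow> 'k. secant_param d e k (freeze (3 * k) z)). f w = 0"
    show "f v = 0"
      by (rule form_vanishes_on_secant_variety[OF f _ v]) (use 0 in \<open>simp add:
          secant_param_freeze_full\<close>)
  qed simp
  then show ?thesis by simp
qed

lemma sym_power_nonzero:
  fixes u :: "nat \<Rightarrow> 'k::field_char_0"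
  assumes "u \<in> coord_space {..1}" "u \<noteq> 0"
  shows "\<exists>i. sym_power d u i \<noteq> 0"
proof (cases "u 0 = 0")
  case True
  have "u 1 \<noteq> 0"
  proof
    assume "u 1 = 0"
    then have "u i = 0" for i
      using True assms(1) by (cases "i \<le> 1") (auto simp: coord_space_def le_Suc_eq)
    then show False using assms(2) by (auto simp: fun_eq_iff)
  qed
  then have "sym_power d u d \<noteq> 0" by (simp add: sym_power_def)
  then show ?thesis by blast
next
  case False
  then have "sym_power d u 0 \<noteq> 0" by (simp add: sym_power_def)
  then show ?thesis by blast
qed

lemma surface_subset_secant_variety:
  "sv_surface d e \<subseteq> secant_variety (sv_space d e) (sv_surface d e ::
      (nat \<times> nat \<Rightarrow> 'k::field_char_0) set set) 1"
proof -
  have "Q \<in> secant_span d e 1" if Q: "Q \<in> sv_surface d e" for Q :: "(nat \<times> nat \<Rightarrow> 'k) set"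
  proof -
    obtain u w :: "nat \<Rightarrow> 'k" where uw: "Q = fun_vs.span {sv_point d e u w}"
      "u \<in> coord_space {..1}" "u \<noteq> 0" "w \<in> coord_space {..1}" "w \<noteq> 0"
      using Q unfolding sv_surface_eq by blast
    obtain i j where "sym_power d u i \<noteq> 0" "sym_power e w j \<noteq> 0"
      using sym_power_nonzero uw by blast
    then have "sv_point d e u w (i, j) \<noteq> 0" by (simp add: tensor_def)
    then have t: "sv_point d e u w \<noteq> 0" by (metis zero_fun_apply)
    have "Q \<in> proj_space (fun_vs.span (\<Union>{Q}))"
      unfolding proj_space_def using t uw(1) fun_vs.span_base[of "sv_point d e u w" "{sv_point d e
          u w}"]
      by (intro CollectI exI[of _ "sv_point d e u w"]) (simp add: fun_vs.span_base)
    then show ?thesis unfolding secant_span_def using Q by (intro UN_I[of "{Q}"]) simp_all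
  qed
  moreover have "secant_span d e 1 \<subseteq> secant_variety (sv_space d e) (sv_surface d e ::
      (nat \<times> nat \<Rightarrow> 'k) set set) 1"
    unfolding secant_variety_eq by (rule closure_of_subset) (simp add: secant_span_subset)
  ultimately show ?thesis by blast
qed

lemma proj_dim_surface_le:
  "proj_dim (sv_space d e) (sv_surface d e :: (nat \<times> nat \<Rightarrow> 'k::field_char_0) set set) \<le> enat 2"
proof -
  have "proj_dim (sv_space d e) (sv_surface d e :: (nat \<times> nat \<Rightarrow> 'k) set set) \<le> enat
      (card {..<3 * 1 :: nat} - 1)"
  proof (rule proj_dim_le_parameters[OF _ poly_fun_secant_param cone_secant_param])
    fix m f and v :: "nat \<times> nat \<Rightarrow> 'k" assume f: "hom_form m f" and v: "v \<in> \<Union>(sv_surface d e)"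
      and 0: "\<forall>w\<in>range (\<lambda>z :: nat \<Rightarrow> 'k. secant_param d e 1 (freeze (3 * 1) z)). f w = 0"
    have "v \<in> \<Union>(secant_variety (sv_space d e) (sv_surface d e) 1)"
      by (rule subsetD[OF Union_mono[OF surface_subset_secant_variety] v])
    then show "f v = 0"
      by (rule form_vanishes_on_secant_variety[OF f, rotated])
          (use 0 in \<open>simp only: secant_param_freeze_full ball_simps\<close>)
  qed simp
  then show ?thesis by simp
qed

text \<open>The summands involve at most \<open>k\<close> distinct points of the surface, but \<^const>\<open>secant_variety\<close>
  asks for exactly \<open>k\<close>; since the surface is infinite, the missing ones can be added.\<close>

lemma secant_param_in_secant_variety:
  fixes z :: "nat \<Rightarrow> 'k::field_char_0"
  assumes "1 \<le> d" and nz: "secant_param d e k z \<noteq> 0"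
  shows "fun_vs.span {secant_param d e k z} \<in> secant_variety (sv_space d e) (sv_surface d e) k"
proof -
  let ?Q = "\<lambda>i. fun_vs.span {sv_chart d e (z (3 * i + 1)) (z (3 * i + 2))}"
  have "?Q ` {..<k} \<subseteq> sv_surface d e" using chart_in_surface by blast
  moreover have "card (?Q ` {..<k}) \<le> k" using card_image_le[of "{..<k}" ?Q] by simp
  moreover have inf: "infinite (sv_surface d e - ?Q ` {..<k})"
    by (rule Diff_infinite_finite[OF _ infinite_sv_surface[OF assms(1)]]) simp
  from infinite_arbitrarily_large[OF inf, of "k - card (?Q ` {..<k})"]
  obtain S' where "finite S'" "card S' = k - card (?Q ` {..<k})" "S' \<subseteq> sv_surface d e - ?Q ` {..<k}"
    by (elim exE conjE)
  moreover from this have "card (?Q ` {..<k} \<union> S') = card (?Q ` {..<k}) + card S'"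
    by (intro card_Un_disjoint) auto
  ultimately have S: "?Q ` {..<k} \<subseteq> ?Q ` {..<k} \<union> S'" "?Q ` {..<k} \<union> S' \<subseteq> sv_surface d e"
    "finite (?Q ` {..<k} \<union> S')" "card (?Q ` {..<k} \<union> S') = k"
    by auto
  define S where "S = ?Q ` {..<k} \<union> S'"
  note S = S[folded S_def]
  have "secant_param d e k z = (\<Sum>i<k. fscale (z (3 * i)) (sv_chart d e (z (3 * i + 1)) (z (3 * i
      + 2))))"
    by (simp add: fun_eq_iff secant_param_def sum_apply fscale_def)
  also have "\<dots> \<in> fun_vs.span (\<Union>S)"
  proof (intro fun_vs.span_sum fun_vs.span_scale fun_vs.span_base)
    fix i assume "i \<in> {..<k}"
    then have "?Q i \<in> S" using S(1) by blast
    then show "sv_chart d e (z (3 * i + 1)) (z (3 * i + 2)) \<in> \<Union>S"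
      by (rule UnionI) (simp add: fun_vs.span_base)
  qed
  finally have "fun_vs.span {secant_param d e k z} \<in> secant_span d e k"
    unfolding secant_span_def proj_space_def using S nz by blast
  moreover have "secant_span d e k \<subseteq> secant_variety (sv_space d e) (sv_surface d e ::
      (nat \<times> nat \<Rightarrow> 'k) set set) k"
    unfolding secant_variety_eq by (rule closure_of_subset) (simp add: secant_span_subset)
  ultimately show ?thesis by blast
qed

lemma secant_param_1_in_surface:
  fixes z :: "nat \<Rightarrow> 'k::field"
  assumes "secant_param d e 1 z \<noteq> 0"
  shows "fun_vs.span {secant_param d e 1 z} \<in> sv_surface d e"
proof -
  have eq: "secant_param d e 1 z = fscale (z 0) (sv_chart d e (z 1) (z 2))"
    by (simp add: secant_param_def fscale_def fun_eq_iff numeral_2_eq_2)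
  with assms have "z 0 \<noteq> 0" by (auto simp: fscale_def fun_eq_iff)
  then have "fun_vs.span {fscale (z 0) (sv_chart d e (z 1) (z 2))} = fun_vs.span {sv_chart d e
      (z 1) (z 2)}"
    unfolding fun_vs.span_eq
    using fun_vs.span_scale[OF fun_vs.span_base[of "fscale (z 0) (sv_chart d e (z 1) (z 2))"],
        of "{fscale (z 0) (sv_chart d e (z 1) (z 2))}" "inverse (z 0)"]
    by (simp add: fun_vs.span_base fun_vs.span_scale)
  then show ?thesis unfolding eq using chart_in_surface by simp
qed

text \<open>Every initial piece of a triangulation is a triangulation, so the first \<open>i\<close> points give
  \<open>i\<close> independent coordinates on the secant vectors with \<open>i\<close> free parameters, for all \<open>i \<le> j\<close>.\<close>

lemma triangulation_le_proj_dim: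
  fixes X :: "(nat \<times> nat \<Rightarrow> 'k::field_char_0) set set"
  assumes tri: "triangulation j pt f" and box: "pt ` {..<j} \<subseteq> {..d} \<times> {..e}" and j: "j \<le> 3 * k" "0
      < j"
    and X: "\<And>z. secant_param d e k z \<noteq> 0 \<Longrightarrow> fun_vs.span {secant_param d e k z} \<in> X"
  shows "enat (j - 1) \<le> proj_dim (sv_space d e) X"
proof (rule proj_dim_ge_parameters[where P = "\<lambda>i. {..<Suc i}" and D = "\<lambda>i. pt ` {..<Suc i}"
      and \<phi> = "\<lambda>i z. secant_param d e k (freeze (Suc i) z)" and C = "1 + d + e"])
  fix i assume i: "i \<le> j - 1"
  have ti: "triangulation (Suc i) pt f" using triangulation_mono[OF tri] i j by simp
  then have "inj_on pt {..<Suc i}" unfolding triangulation_def by simp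
  then show "card (pt ` {..<Suc i}) = Suc i" by (simp add: card_image)
  have "pt ` {..<Suc i} \<subseteq> pt ` {..<j}" using i j by (intro image_mono) auto
  then show "coords_alg_indep (range (\<lambda>z. secant_param d e k (freeze (Suc i) z :: nat \<Rightarrow> 'k)))
      (pt ` {..<Suc i})"
  proof (rule coords_alg_indep_triangulation[OF ti order_trans[OF _ box]])
    show "Suc i \<le> 3 * k" using i j by linarith
  qed simp_all
next
  fix i
  show "range (\<lambda>z. secant_param d e k (freeze (Suc i) z :: nat \<Rightarrow> 'k)) \<subseteq>
      range (\<lambda>z. secant_param d e k (freeze (Suc (Suc i)) z))"
  proof -
    have "secant_param d e k (freeze (Suc i) z) = secant_param d e k (freeze (Suc (Suc i)) (freeze
        (Suc i) z))"
      for z :: "nat \<Rightarrow> 'k"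
      by (rule arg_cong[of _ _ "secant_param d e k"]) (auto simp: freeze_def)
    then show ?thesis by blast
  qed
qed (use X secant_param_in_sv_space in \<open>auto simp: poly_fun_secant_param[simplified]
    cone_secant_param\<close>)

lemma dim_sv_space: "fun_vs.dim (sv_space d e :: (nat \<times> nat \<Rightarrow> 'k::field) set) = (d + 1) * (e + 1)"
proof -
  let ?G = "{..d} \<times> {..e}"
  define E :: "nat \<times> nat \<Rightarrow> nat \<times> nat \<Rightarrow> 'k" where "E b = (\<lambda>c. if c = b then 1 else 0)" for b
  have inj: "inj E" by (rule injI) (metis E_def zero_neq_one)
  have comb: "(\<Sum>b\<in>?G. fscale (a b) (E b)) c = (if c \<in> ?G then a c else 0)" for a c
  proof -
    have "(\<Sum>b\<in>?G. fscale (a b) (E b)) c = (\<Sum>b\<in>?G. if b = c then a c else 0)"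
      unfolding sum_apply by (intro sum.cong) (auto simp: fscale_def E_def)
    then show ?thesis by simp
  qed
  show ?thesis
  proof (rule fun_vs.dim_unique[of "E ` ?G"])
    show "E ` ?G \<subseteq> sv_space d e" by (auto simp: sv_space_def coord_space_def E_def)
    show "sv_space d e \<subseteq> fun_vs.span (E ` ?G)"
    proof
      fix v :: "nat \<times> nat \<Rightarrow> 'k" assume v: "v \<in> sv_space d e"
      have "v = (\<Sum>b\<in>?G. fscale (v b) (E b))"
        using v by (intro ext) (simp only: comb, auto simp: sv_space_def coord_space_def)
      also have "\<dots> \<in> fun_vs.span (E ` ?G)"
        by (intro fun_vs.span_sum fun_vs.span_scale fun_vs.span_base) auto
      finally show "v \<in> fun_vs.span (E ` ?G)" .
    qed
    show "fun_vs.independent (E ` ?G)"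
    proof (subst fun_vs.dependent_finite)
      have "\<forall>b\<in>?G. a (E b) = 0" if "(\<Sum>x\<in>E ` ?G. fscale (a x) x) = 0" for a
      proof
        fix b assume b: "b \<in> ?G"
        have "(\<Sum>b\<in>?G. fscale (a (E b)) (E b)) b = 0"
          using that inj by (simp add: sum.reindex inj_on_subset[OF inj])
        then show "a (E b) = 0" unfolding comb using b by simp
      qed
      then show "\<not> (\<exists>u. (\<exists>v\<in>E ` ?G. u v \<noteq> 0) \<and> (\<Sum>v\<in>E ` ?G. fscale (u v) v) = 0)" by blast
    qed simp
    show "card (E ` ?G) = (d + 1) * (e + 1)"
      by (subst card_image[OF inj_on_subset[OF inj]]) simp_all
  qed
qed

text \<open>The ambient space as the range of a polynomial map with one parameter for each coordinate.\<close>

definition on_grid :: "nat \<Rightarrow> nat \<Rightarrow> (nat \<times> nat \<Rightarrow> 'k::field) \<Rightarrow> nat \<times> nat \<Rightarrow> 'k" where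
  "on_grid d e z = (\<lambda>b. if b \<in> {..d} \<times> {..e} then z b else 0)"

lemma range_on_grid: "range (on_grid d e) = (sv_space d e :: (nat \<times> nat \<Rightarrow> 'a::field) set)"
proof -
  have "on_grid d e v = v" if "v \<in> sv_space d e" for v :: "nat \<times> nat \<Rightarrow> 'a"
    using that by (auto simp: fun_eq_iff on_grid_def sv_space_def coord_space_def)
  then have "v \<in> range (on_grid d e)" if "v \<in> sv_space d e" for v :: "nat \<times> nat \<Rightarrow> 'a"
    using that rangeI[of "on_grid d e" v] by simp
  then have "sv_space d e \<subseteq> range (on_grid d e :: _ \<Rightarrow> nat \<times> nat \<Rightarrow> 'a)" by (intro subsetI)
  moreover have "range (on_grid d e) \<subseteq> sv_space d e"
    by (auto simp: on_grid_def sv_space_def coord_space_def)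
  ultimately show ?thesis by blast
qed

lemma poly_fun_on_grid: "(\<lambda>z. on_grid d e z b) \<in> poly_fun ({..d} \<times> {..e}) 1"
proof (cases "b \<in> {..d} \<times> {..e}")
  case True
  then show ?thesis unfolding on_grid_def using poly_fun_coord[of "{..d} \<times> {..e}" b] by simp
next
  case False
  then show ?thesis unfolding on_grid_def using poly_fun_const by simp
qed

lemma cone_sv_space: "cone (sv_space d e)"
  unfolding cone_def using fun_vs.subspace_scale[OF subspace_sv_space] by blast

lemma proj_space_vectors: "v \<in> \<Union>(proj_space (sv_space d e)) \<Longrightarrow> v \<in> sv_space d e"
  unfolding proj_space_def using fun_vs.subspace_scale[OF subspace_sv_space]
  by (auto simp: fun_vs.span_singleton)

lemma proj_dim_le_ambient:
  fixes Y :: "(nat \<times> nat \<Rightarrow> 'k::field_char_0) set set"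
  assumes "Y \<subseteq> proj_space (sv_space d e)"
  shows "proj_dim (sv_space d e) Y \<le> enat ((d + 1) * (e + 1) - 1)"
proof -
  have "proj_dim (sv_space d e) Y \<le> enat (card ({..d} \<times> {..e}) - 1)"
  proof (rule proj_dim_le_parameters[OF _ poly_fun_on_grid])
    fix m and f :: "(nat \<times> nat \<Rightarrow> 'k) \<Rightarrow> 'k" and v assume 0: "\<forall>w\<in>range (on_grid d e). f w =
        (0 :: 'k)" and v: "v \<in> \<Union>Y"
    have "v \<in> range (on_grid d e)"
      unfolding range_on_grid by (rule proj_space_vectors[OF subsetD[OF Union_mono[OF assms] v]])
    with 0 show "f v = 0" by (rule bspec)
  qed (simp_all add: range_on_grid cone_sv_space)
  then show ?thesis by simp
qed

lemma irreducible_closedin_subtopology_closed: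
  assumes Y: "closedin T Y" and irr: "irreducible_closedin (subtopology T Y) Z"
  shows "irreducible_closedin T Z"
  unfolding irreducible_closedin_def
proof (intro conjI allI impI)
  have Z: "closedin (subtopology T Y) Z" "Z \<noteq> {}"
    "\<And>A B. closedin (subtopology T Y) A \<Longrightarrow> closedin (subtopology T Y) B \<Longrightarrow> Z \<subseteq> A \<union> B \<Longrightarrow> Z \<subseteq> A \<or> Z \<subseteq> B"
    using irr unfolding irreducible_closedin_def by simp_all
  show "closedin T Z" using closedin_trans_full[OF Z(1) Y] .
  show "Z \<noteq> {}" by fact
  fix A B assume AB: "closedin T A \<and> closedin T B \<and> Z \<subseteq> A \<union> B"
  have ZY: "Z \<subseteq> Y" using closedin_subset[OF Z(1)] by simp
  have "closedin (subtopology T Y) (A \<inter> Y)" "closedin (subtopology T Y) (B \<inter> Y)"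
    using AB by (auto simp: closedin_subtopology)
  moreover have "Z \<subseteq> (A \<inter> Y) \<union> (B \<inter> Y)" using AB ZY by blast
  ultimately show "Z \<subseteq> A \<or> Z \<subseteq> B" using Z(3)[of "A \<inter> Y" "B \<inter> Y"] by blast
qed

lemma irreducible_ambient:
  fixes d e :: nat
  defines "V \<equiv> sv_space d e :: (nat \<times> nat \<Rightarrow> 'k::field_char_0) set"
  shows "irreducible_closedin (zariski V) (proj_space V)"
proof -
  have V: "range (on_grid d e :: _ \<Rightarrow> nat \<times> nat \<Rightarrow> 'k) = V" unfolding V_def by (rule range_on_grid)
  define u :: "nat \<times> nat \<Rightarrow> 'k" where "u = (\<lambda>b. if b = (0, 0) then 1 else 0)"
  have u: "u \<in> V" "u \<noteq> 0"
    unfolding V_def sv_space_def coord_space_def by (auto simp: u_def fun_eq_iff)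
  have "irreducible_closedin (subtopology (zariski V) (proj_space V)) (closure_in V (proj_space V)
      (range (on_grid d e)))"
  proof (rule irreducible_closure_in[OF poly_fun_on_grid])
    show "fun_vs.span {v} \<in> proj_space V" if "v \<in> range (on_grid d e)" "v \<noteq> 0" for v
      using that unfolding V proj_space_def by blast
  qed (use u V in auto)
  moreover have "closure_in V (proj_space V) (range (on_grid d e)) = proj_space V"
  proof -
    have "\<forall>f\<in>{f. (\<exists>m. hom_form m f) \<and> (\<forall>v\<in>V. f v = 0)}. \<forall>v\<in>P. f v = 0" if "P \<in> proj_space V" for P
    proof (intro ballI)
      fix f v assume f: "f \<in> {f. (\<exists>m. hom_form m f) \<and> (\<forall>v\<in>V. f v = 0)}" and "v \<in> P"
      then have "v \<in> \<Union>(proj_space V)" using that by (intro UnionI)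
      then have "v \<in> V" unfolding V_def by (rule proj_space_vectors)
      with f show "f v = 0" by simp
    qed
    then show ?thesis unfolding closure_in_def zero_locus_def V by
        (intro equalityI subsetI) simp_all
  qed
  moreover have "subtopology (zariski V) (proj_space V) = zariski V"
    using subtopology_topspace[of "zariski V"] by simp
  ultimately show ?thesis by simp
qed

text \<open>A chain in \<open>Y\<close> can be prolonged by the whole projective space.\<close>

lemma proj_dim_le_hypersurface:
  fixes Y :: "(nat \<times> nat \<Rightarrow> 'k::field_char_0) set set"
  assumes Y: "closedin (zariski (sv_space d e)) Y" and f: "hom_form m f" "\<And>v. v \<in> \<Union>Y \<Longrightarrow> f v = 0"
    and u: "u \<in> sv_space d e" "u \<noteq> 0" "f u \<noteq> 0"
  shows "proj_dim (sv_space d e) Y \<le> enat ((d + 1) * (e + 1) - 2)"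
  unfolding proj_dim_def krull_dim_def
proof (rule SUP_least)
  let ?V = "sv_space d e :: (nat \<times> nat \<Rightarrow> 'k) set"
  fix n assume "n \<in> {n. \<exists>Z. (\<forall>i\<le>n. irreducible_closedin (subtopology (zariski ?V) Y) (Z i)) \<and>
                            (\<forall>i<n. Z i \<subset> Z (Suc i))}"
  then obtain Z where Z: "\<forall>i\<le>n. irreducible_closedin (subtopology (zariski ?V) Y) (Z i)"
    "\<forall>i<n. Z i \<subset> Z (Suc i)"
    unfolding mem_Collect_eq by (elim exE conjE)
  define Z' where "Z' i = (if i \<le> n then Z i else proj_space ?V)" for i
  have irr: "irreducible_closedin (zariski ?V) (Z' i)" for i
  proof (cases "i \<le> n")
    case True
    have "irreducible_closedin (subtopology (zariski ?V) Y) (Z i)" using Z(1) True by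
        (elim allE impE)
    from irreducible_closedin_subtopology_closed[OF Y this] show ?thesis using True by
        (simp add: Z'_def)
  next
    case False
    then show ?thesis using irreducible_ambient[of d e] by (simp add: Z'_def)
  qed
  have "Z n \<subset> proj_space ?V"
  proof -
    have Zn: "irreducible_closedin (subtopology (zariski ?V) Y) (Z n)" using Z(1) by
        (elim allE impE) simp_all
    then have "Z n \<subseteq> Y" "Z n \<subseteq> proj_space ?V" using irreducible_subset[OF Zn] by simp_all
    moreover have "fun_vs.span {u} \<in> proj_space ?V" using u unfolding proj_space_def by blast
    moreover have "fun_vs.span {u} \<notin> Y"
    proof
      assume "fun_vs.span {u} \<in> Y"
      then have "u \<in> \<Union>Y" by (rule UnionI) (simp add: fun_vs.span_base)
      then show False using f(2) u(3) by simp
    qed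
    ultimately show ?thesis by blast
  qed
  then have strict: "Z' i \<subset> Z' (Suc i)" if "i < Suc n" for i
    using that Z(2) unfolding Z'_def by (cases "i = n") auto
  have "Suc n < card ({..d} \<times> {..e})"
  proof (rule chain_length_less_parameters[where \<phi> = "on_grid d e" and X = "proj_space ?V" and V =
      ?V and Z = Z' and C = 1])
    show "irreducible_closedin (subtopology (zariski ?V) (proj_space ?V)) (Z' i)" for i
      using irr subtopology_topspace[of "zariski ?V"] by simp
    show "(\<lambda>z. on_grid d e z b :: 'k) \<in> poly_fun ({..d} \<times> {..e}) 1" for b by (rule poly_fun_on_grid)
    show "cone (range (on_grid d e) :: (nat \<times> nat \<Rightarrow> 'k) set)" unfolding range_on_grid by
        (rule cone_sv_space)
    fix m and f :: "(nat \<times> nat \<Rightarrow> 'k) \<Rightarrow> 'k" and v assume 0: "\<forall>w\<in>range (on_grid d e). f w =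
        (0 :: 'k)" and v: "v \<in> \<Union>(proj_space ?V)"
    have "v \<in> range (on_grid d e)"
      unfolding range_on_grid by (rule proj_space_vectors[OF v])
    with 0 show "f v = 0" by (rule bspec)
  qed (simp_all add: strict)
  then show "enat n \<le> enat ((d + 1) * (e + 1) - 2)" by simp
qed

section \<open>The defective secant variety\<close>

text \<open>The indices \<open>r = 2i + a\<close> with \<open>a \<le> 1\<close> number the monomial basis of \<open>S\<^sup>m \<otimes> S\<^sup>1\<close>, where
  \<open>d = 2m\<close>. The binomial coefficients are divided out so that the matrix of \<open>u\<^sup>d \<otimes> w\<^sup>2\<close> is the
  product of a column, the coordinate vector of the monomials in \<open>u\<close> and \<open>w\<close>, with its
  transpose.\<close>

definition catalecticant :: "nat \<Rightarrow> (nat \<times> nat \<Rightarrow> 'k::field) \<Rightarrow> 'k mat" where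
  "catalecticant d v = mat (d + 2) (d + 2) (\<lambda>(r, c).
     let i = r div 2 + c div 2; j = r mod 2 + c mod 2
     in inverse (of_nat (d choose i) * of_nat (2 choose j)) * v (i, j))"

lemma catalecticant_carrier: "catalecticant d v \<in> carrier_mat (d + 2) (d + 2)"
  by (simp add: catalecticant_def)

lemma hom_form_det_catalecticant: "hom_form (d + 2) (\<lambda>v. det (catalecticant d v))"
proof -
  have eq: "det (catalecticant d v) = (\<Sum>p | p permutes {0..<d + 2}. signof p * (\<Prod>r = 0..<d
      + 2. catalecticant d v $$ (r, p r)))"
    for v :: "nat \<times> nat \<Rightarrow> 'a" by (rule det_def'[OF catalecticant_carrier])
  show ?thesis
    unfolding eq
  proof (intro hom_form_sum hom_form_scalar)
    fix p assume "p \<in> {p. p permutes {0..<d + 2}}"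
    then have p: "p r < d + 2" if "r < d + 2" for r
      using permutes_in_image[of p "{0..<d + 2}" r] that by simp
    have "hom_form 1 (\<lambda>v. catalecticant d v $$ (r, p r))" if "r \<in> {0..<d + 2}" for r
    proof -
      have "r < d + 2" using that by simp
      then show ?thesis
        unfolding catalecticant_def Let_def
        using p[of r] by (simp add: hom_form_scalar[OF hom_form.coord, simplified])
    qed
    then have "hom_form (\<Sum>r = 0..<d + 2. 1) (\<lambda>v. \<Prod>r = 0..<d + 2. catalecticant d v $$ (r, p r))"
      by (rule hom_form_prod)
    then show "hom_form (d + 2) (\<lambda>v. \<Prod>r = 0..<d + 2. catalecticant d v $$ (r, p r))" by simp
  qed
qed

lemma det_zero_row:
  assumes A: "A \<in> carrier_mat n n" and r: "r < n" and 0: "\<And>c. c < n \<Longrightarrow> A $$ (r, c) =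
      (0 :: 'k::field)"
  shows "det A = 0"
  unfolding det_def'[OF A]
proof (intro sum.neutral ballI)
  fix p assume "p \<in> {p. p permutes {0..<n}}"
  then have "p r < n" using permutes_in_image[of p "{0..<n}" r] r by simp
  then have "(\<Prod>i = 0..<n. A $$ (i, p i)) = 0" using r 0 by (intro prod_zero bexI[of _ r]) auto
  then show "signof p * (\<Prod>i = 0..<n. A $$ (i, p i)) = 0" by simp
qed

text \<open>A sum of \<open>d + 1\<close> matrices of rank one, of size \<open>d + 2\<close>. It is the product \<open>A B\<close>, where the
  columns of \<open>A\<close> and the rows of \<open>B\<close> are the factors of the summands and the last row of \<open>B\<close> is
  zero.\<close>

lemma det_catalecticant_secant:
  fixes z :: "nat \<Rightarrow> 'k::field_char_0"
  assumes "even d"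
  shows "det (catalecticant d (secant_param d 2 (d + 1) z)) = 0"
proof -
  define h where "h l r = z (3 * l + 1) ^ (r div 2) * z (3 * l + 2) ^ (r mod 2)" for l r
  define A where "A = mat (d + 2) (d + 2) (\<lambda>(r, l). if l < d + 1 then z (3 * l) * h l r else 0)"
  define B where "B = mat (d + 2) (d + 2) (\<lambda>(l, c). if l < d + 1 then h l c else 0)"
  have AB: "A \<in> carrier_mat (d + 2) (d + 2)" "B \<in> carrier_mat (d + 2) (d + 2)"
    by (simp_all add: A_def B_def)
  have "catalecticant d (secant_param d 2 (d + 1) z) = A * B"
  proof (rule eq_matI)
    fix r c assume "r < dim_row (A * B)" "c < dim_col (A * B)"
    then have rc: "r < d + 2" "c < d + 2" using AB by auto
    let ?i = "r div 2 + c div 2" and ?j = "r mod 2 + c mod 2"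
    obtain b where b: "d = 2 * b" using assms by (elim evenE)
    have "r div 2 \<le> b" "c div 2 \<le> b" using rc unfolding b by linarith+
    then have i: "?i \<le> d" unfolding b by simp
    have j: "?j \<le> 2" by (simp add: add_mono[of _ 1 _ 1, simplified])
    have nz: "of_nat (d choose ?i) * of_nat (2 choose ?j) \<noteq> (0 :: 'k)" using i j by simp
    have "catalecticant d (secant_param d 2 (d + 1) z) $$ (r, c) =
        inverse (of_nat (d choose ?i) * of_nat (2 choose ?j)) * secant_param d 2 (d + 1) z (?i, ?j)"
      using rc by (simp add: catalecticant_def Let_def)
    also have "secant_param d 2 (d + 1) z (?i, ?j) =
        (of_nat (d choose ?i) * of_nat (2 choose ?j)) * (\<Sum>l<d + 1. z (3 * l) * h l r * h l c)"
      unfolding secant_param_def sv_chart_def prod.case sum_distrib_left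
      by (intro sum.cong refl) (simp add: h_def power_add mult_ac)
    also have "inverse (of_nat (d choose ?i) * of_nat (2 choose ?j)) * \<dots> = (\<Sum>l<d + 1. z
        (3 * l) * h l r * h l c)"
    proof -
      have "inverse q * (q * s) = s" if "q \<noteq> 0" for q s :: 'k using that by simp
      from this[OF nz] show ?thesis .
    qed
    also have "\<dots> = (\<Sum>l = 0..<d + 2. A $$ (r, l) * B $$ (l, c))"
      using rc by (simp add: A_def B_def atLeast0LessThan)
    also have "\<dots> = (A * B) $$ (r, c)"
      using rc AB by (simp add: scalar_prod_def)
    finally show "catalecticant d (secant_param d 2 (d + 1) z) $$ (r, c) = (A * B) $$ (r, c)" .
  qed (simp_all add: catalecticant_def A_def B_def)
  moreover have "det B = 0"
    by (rule det_zero_row[OF AB(2), of "d + 1"]) (simp_all add: B_def)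
  ultimately show ?thesis using det_mult[OF AB] by simp
qed

text \<open>The tensor with a single entry, at the centre of the grid, has as its matrix the
  permutation matrix of the reversal.\<close>

lemma det_catalecticant_nonzero:
  assumes "even d"
  shows "\<exists>v :: nat \<times> nat \<Rightarrow> 'k::field_char_0. v \<in> sv_space d 2 \<and> v \<noteq> 0 \<and> det (catalecticant d v) \<noteq> 0"
proof -
  obtain m where m: "d = 2 * m" using assms by (elim evenE)
  define v :: "nat \<times> nat \<Rightarrow> 'k" where "v = (\<lambda>b. if b = (m, 1) then of_nat (d choose m) * of_nat
      (2 choose 1) else 0)"
  have nz: "of_nat (d choose m) * of_nat (2 choose 1) \<noteq> (0 :: 'k)" using m by simp
  have entry: "catalecticant d v $$ (r, c) = (if r + c = d + 1 then 1 else 0)" if "r < d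
      + 2" "c < d + 2" for r c
  proof -
    have split: "i + i' = m \<and> x + y = 1 \<longleftrightarrow> (2 * i + x) + (2 * i' + y) = 2 * m + 1"
      if "x < 2" "y < 2" for i i' x y :: nat
    proof -
      have "x = 0 \<or> x = 1" "y = 0 \<or> y = 1" using that by auto
      then show ?thesis by (elim disjE) (simp_all, presburger+)
    qed
    have "r div 2 + c div 2 = m \<and> r mod 2 + c mod 2 = 1 \<longleftrightarrow> r + c = d + 1"
      using split[of "r mod 2" "c mod 2" "r div 2" "c div 2"] unfolding m by simp
    then show ?thesis using that nz by (auto simp: catalecticant_def Let_def v_def)
  qed
  have "catalecticant d v * catalecticant d v = 1\<^sub>m (d + 2)"
  proof (rule eq_matI)
    fix r c assume "r < dim_row (1\<^sub>m (d + 2) :: 'k mat)" "c < dim_col (1\<^sub>m (d + 2) :: 'k mat)"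
    then have rc: "r < d + 2" "c < d + 2" by simp_all
    have "(catalecticant d v * catalecticant d v) $$ (r, c) =
        (\<Sum>l = 0..<d + 2. catalecticant d v $$ (r, l) * catalecticant d v $$ (l, c))"
      using rc catalecticant_carrier[of d v] by (simp add: scalar_prod_def)
    also have "\<dots> = (\<Sum>l = 0..<d + 2. if l = d + 1 - r then (if r = c then 1 else 0) else 0)"
      using rc by (intro sum.cong refl) (auto simp: entry)
    also have "\<dots> = (if r = c then 1 else 0)" using rc by (subst sum.delta) auto
    also have "\<dots> = 1\<^sub>m (d + 2) $$ (r, c)" using rc by simp
    finally show "(catalecticant d v * catalecticant d v) $$ (r, c) = 1\<^sub>m (d + 2) $$ (r, c)" .
  qed (simp_all add: catalecticant_def)
  then have "det (catalecticant d v) * det (catalecticant d v) = 1"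
    using det_mult[OF catalecticant_carrier catalecticant_carrier, of d v v] by simp
  then have "det (catalecticant d v) \<noteq> 0" by auto
  moreover have "v \<in> sv_space d 2" by (simp add: v_def sv_space_def coord_space_def m)
  moreover have "v (m, 1) \<noteq> 0" using nz by (simp add: v_def)
  then have "v \<noteq> 0" by auto
  ultimately show ?thesis by blast
qed

section \<open>Dimensions of the secant varieties\<close>

lemma triangulated_grid:
  assumes "1 \<le> e" "e \<le> d" "\<not> (e = 2 \<and> even d)"
  obtains pt f where "triangulation ((d + 1) * (e + 1)) pt f" "pt ` {..<(d + 1) * (e + 1)}
      \<subseteq> {..d} \<times> {..e}"
proof -
  have "tileable (d + 1) (e + 1)"
  proof (rule tileable_grid)
    show "\<not> (d + 1 = 3 \<and> odd (e + 1))"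
    proof
      assume "d + 1 = 3 \<and> odd (e + 1)"
      then have "d = 2" "even e" by simp_all
      then have "e = 2" using assms(1,2) by (cases "e = 1") auto
      then show False using assms(3) \<open>d = 2\<close> by simp
    qed
    show "\<not> (e + 1 = 3 \<and> odd (d + 1))" using assms(3) by auto
  qed (use assms in simp_all)
  then obtain L B where L: "leftover L" "tiled B L" "B \<union> set L = grid (d + 1) (e + 1)"
    unfolding tileable_def tiles_grid_def by blast
  moreover have "card (grid (d + 1) (e + 1)) = (d + 1) * (e + 1)"
    unfolding grid_def by (simp add: card_cartesian_product)
  moreover have "grid (d + 1) (e + 1) \<subseteq> {..d} \<times> {..e}" by (auto simp: grid_def)
  ultimately show ?thesis
    using triangulation_of_tiled[OF L(2,1)] that by metis
qed

lemma triangulated_grid_minus_point: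
  assumes "even d" "2 \<le> d"
  obtains pt f where "triangulation (3 * d + 2) pt f" "pt ` {..<3 * d + 2} \<subseteq> {..d} \<times> {..2}"
proof -
  obtain B L where L: "tiled B L" "leftover L" "B \<union> set L = grid (d + 1) 3 - {(2, 2)}"
    using tiled_odd_by_3[of "d + 1"] assms by auto
  have "card (grid (d + 1) 3 - {(2, 2)}) = 3 * d + 2"
    unfolding grid_def using assms by (subst card_Diff_singleton)
        (simp_all add: card_cartesian_product)
  moreover have "grid (d + 1) 3 - {(2, 2)} \<subseteq> {..d} \<times> {..2}" by (auto simp: grid_def)
  ultimately show ?thesis
    using triangulation_of_tiled[OF L(1,2)] L(3) that by metis
qed

lemma proj_dim_surface:
  assumes "1 \<le> d" "1 \<le> e"
  shows "proj_dim (sv_space d e) (sv_surface d e :: (nat \<times> nat \<Rightarrow> 'k::field_char_0) set set) = 2"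
proof -
  define pt :: "nat \<Rightarrow> nat \<times> nat" where "pt p = [(0, 0), (1, 0), (0, 1)] ! p" for p
  have lt3: "p < 3 \<longleftrightarrow> p = 0 \<or> p = 1 \<or> p = 2" for p :: nat by auto
  have "triangulation 3 pt (\<lambda>_. (0, 0, 0))"
    unfolding triangulation_def by (auto simp: inj_on_def pt_def lt3 det3_def)
  moreover have "pt ` {..<3} \<subseteq> {..d} \<times> {..e}" using assms by (auto simp: pt_def lt3)
  ultimately have "enat (3 - 1) \<le> proj_dim (sv_space d e) (sv_surface d e ::
      (nat \<times> nat \<Rightarrow> 'k) set set)"
    by (rule triangulation_le_proj_dim[where k = 1]) (simp_all add: secant_param_1_in_surface del:
        One_nat_def)
  then show ?thesis using proj_dim_surface_le[of d e, where 'k = 'k] by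
      (simp add: numeral_eq_enat antisym)
qed

lemma expected_dim_surface:
  assumes "1 \<le> d" "1 \<le> e" "1 \<le> k"
  shows "expected_dim (sv_space d e) (sv_surface d e :: (nat \<times> nat \<Rightarrow> 'k::field_char_0) set set) k =
    enat (min (3 * k - 1) ((d + 1) * (e + 1) - 1))"
  unfolding expected_dim_def proj_dim_surface[OF assms(1,2)] dim_sv_space
  by (simp add: numeral_eq_enat one_enat_def min_def mult.commute)

lemma secant_variety_closed:
  "closedin (zariski (sv_space d e)) (secant_variety (sv_space d e) (sv_surface d e) k)"
  "secant_variety (sv_space d e) (sv_surface d e) k \<subseteq> proj_space (sv_space d e)"
  unfolding secant_variety_eq using closure_of_subset_topspace[of "zariski (sv_space d e)"]
      by simp_all

text \<open>With at most \<open>N\<close> parameters, use the first \<open>3k\<close> points of the triangulation; otherwise use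
  all of them.\<close>

lemma nondefective_if_triangulated:
  assumes de: "1 \<le> d" "1 \<le> e"
    and tri: "triangulation ((d + 1) * (e + 1)) pt f" "pt ` {..<(d + 1) * (e + 1)} \<subseteq> {..d} \<times> {..e}"
  shows "nondefective (sv_space d e) (sv_surface d e :: (nat \<times> nat \<Rightarrow> 'k::field_char_0) set set)"
  unfolding nondefective_def nondefective_secant_def
proof (intro allI impI)
  fix k :: nat assume k: "1 \<le> k"
  let ?N = "(d + 1) * (e + 1)" and ?V = "sv_space d e :: (nat \<times> nat \<Rightarrow> 'k) set"
  let ?S = "secant_variety ?V (sv_surface d e) k"
  define j where "j = min (3 * k) ?N"
  have j: "j \<le> 3 * k" "0 < j" "j \<le> ?N" using k by (auto simp: j_def)
  have "pt ` {..<j} \<subseteq> pt ` {..<?N}" using j(3) by (intro image_mono) simp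
  then have "enat (j - 1) \<le> proj_dim ?V ?S"
    using secant_param_in_secant_variety[OF de(1)]
    by (intro triangulation_le_proj_dim[OF triangulation_mono[OF tri(1) j(3)] _ j(1,2)]
        order_trans[OF _ tri(2)])
  moreover have "proj_dim ?V ?S \<le> enat (3 * k - 1)" by (rule proj_dim_secant_variety_le)
  moreover have "proj_dim ?V ?S \<le> enat (?N - 1)" by (rule proj_dim_le_ambient[OF
      secant_variety_closed(2)])
  moreover have "j - 1 = min (3 * k - 1) (?N - 1)" unfolding j_def by (simp only: min_diff)
  ultimately show "proj_dim ?V ?S = expected_dim ?V (sv_surface d e) k"
    unfolding expected_dim_surface[OF de k] by (auto simp: min_def intro: antisym)
qed

text \<open>The determinant keeps the variety inside a hypersurface. Conversely, the triangulation of
  the grid without a point gives \<open>3d + 2 = N - 1\<close> independent coordinates.\<close>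

lemma proj_dim_defective_secant:
  assumes "even d" "2 \<le> d"
  shows "proj_dim (sv_space d 2) (secant_variety (sv_space d 2) (sv_surface d 2 ::
      (nat \<times> nat \<Rightarrow> 'k::field_char_0) set set) (d + 1))
    = enat (3 * d + 1)"
proof (rule antisym)
  let ?V = "sv_space d 2 :: (nat \<times> nat \<Rightarrow> 'k) set"
  let ?S = "secant_variety ?V (sv_surface d 2) (d + 1)"
  obtain u :: "nat \<times> nat \<Rightarrow> 'k" where u: "u \<in> ?V" "u \<noteq> 0" "det (catalecticant d u) \<noteq> 0"
    using det_catalecticant_nonzero[OF assms(1)] by blast
  have "proj_dim ?V ?S \<le> enat ((d + 1) * (2 + 1) - 2)"
  proof (rule proj_dim_le_hypersurface[OF secant_variety_closed(1) hom_form_det_catalecticant _ u])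
    fix v assume v: "v \<in> \<Union>?S"
    show "det (catalecticant d v) = 0"
      by (rule form_vanishes_on_secant_variety[OF hom_form_det_catalecticant _ v])
         (rule det_catalecticant_secant[OF assms(1)])
  qed
  moreover have "(d + 1) * (2 + 1) - 2 = 3 * d + 1" by simp
  ultimately show "proj_dim ?V ?S \<le> enat (3 * d + 1)" by (simp only:)
  obtain pt f where tri: "triangulation (3 * d + 2) pt f" "pt ` {..<3 * d + 2} \<subseteq> {..d} \<times> {..2}"
    using triangulated_grid_minus_point[OF assms] .
  have "enat (3 * d + 2 - 1) \<le> proj_dim ?V ?S"
  proof (rule triangulation_le_proj_dim[OF tri])
    show "fun_vs.span {secant_param d 2 (d + 1) z} \<in> ?S" if "secant_param d 2 (d + 1) z \<noteq> 0" for z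
      by (rule secant_param_in_secant_variety[OF _ that]) (use assms in simp)
  qed simp_all
  then show "enat (3 * d + 1) \<le> proj_dim ?V ?S" by simp
qed

theorem theorem1p1:
  fixes d e :: nat
    and V :: "(nat \<times> nat \<Rightarrow> 'k::{alg_closed_field, field_char_0}) set"
    and X :: "(nat \<times> nat \<Rightarrow> 'k) set set"
  assumes "1 \<le> e" and "e \<le> d"
  defines "V \<equiv> sv_space d e"
    and "X \<equiv> segre_veronese d e ` (proj_line \<times> proj_line)"
  shows "(nondefective V X \<longleftrightarrow> \<not> (e = 2 \<and> even d)) \<and>
         (e = 2 \<and> even d \<longrightarrow> secant_codim V X (d + 1) = 1 \<and> expected_codim V X (d + 1) = 0)"
proof -
  have X: "X = sv_surface d e" unfolding X_def sv_surface_def ..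
  have d: "1 \<le> d" using assms(1,2) by simp
  show ?thesis
  proof (cases "e = 2 \<and> even d")
    case False
    obtain pt f where "triangulation ((d + 1) * (e + 1)) pt f" "pt ` {..<(d + 1) * (e + 1)}
        \<subseteq> {..d} \<times> {..e}"
      using triangulated_grid[OF assms(1,2) False] .
    then have "nondefective V X"
      unfolding V_def X by (rule nondefective_if_triangulated[OF d assms(1)])
    with False show ?thesis by blast
  next
    case True
    then have "even d" "2 \<le> d" "e = 2" using assms(2) by simp_all
    then have sec: "proj_dim V (secant_variety V X (d + 1)) = enat (3 * d + 1)"
      unfolding V_def X using proj_dim_defective_secant by simp
    have exp: "expected_dim V X (d + 1) = enat (3 * d + 2)"
      unfolding V_def X using expected_dim_surface[OF d assms(1), of "d + 1", where 'k = 'k] \<open>e =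
          2\<close> by simp
    have dim: "fun_vs.dim V = 3 * d + 3"
      unfolding V_def dim_sv_space using \<open>e = 2\<close> by simp
    have "\<not> nondefective_secant V X (d + 1)"
      unfolding nondefective_secant_def sec exp by simp
    then have "\<not> nondefective V X" unfolding nondefective_def by auto
    moreover have "secant_codim V X (d + 1) = 1" "expected_codim V X (d + 1) = 0"
      unfolding secant_codim_def expected_codim_def sec exp dim by
          (simp_all add: one_enat_def zero_enat_def)
    ultimately show ?thesis using True by simp
  qed
qed

end
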